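(* Let $\mathcal C$ be a small $\mathbb C$-linear category, let $p\in[1,\infty)$, and let $(\mathscr H,\mathcal F)$ be a $p$-summable odd Fredholm module over $\mathcal C$. Let $m$ be an integer with $2m\geq p$. Then the tuple $(\Omega'\mathcal C,\partial',\widehat{Tr}_s,\rho')$ is a $(2m-1)$-dimensional cycle over $\mathcal C$. Moreover, the element $\phi^{2m-1}\in CN^{2m-1}(\mathcal C)$ defined by $$\phi^{2m-1}(f^0\otimes f^1\otimes\cdots\otimes f^{2m-1}):=Tr'_s\left(\mathscr H(f^0)[\mathcal F,f^1]\cdots[\mathcal F,f^{2m-1}]\right)$$ for $f^0\otimes f^1\otimes\cdots\otimes f^{2m-1}\in Hom_{\mathcal C}(X_1,X)\otimes Hom_{\mathcal C}(X_2,X_1)\otimes\cdots\otimes Hom_{\mathcal C}(X,X_{2m-1})$ is a cyclic cocycle over $\mathcal C$.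
   Context: **Odd Fredholm modules.** $\mathcal B(\mathcal H_1,\mathcal H_2)$ denotes bounded operators, $\mathcal B^q$ the $q$-th Schatten class, $Tr$ the usual trace on trace class operators, and $SHilb$ the category of (ungraded) separable Hilbert spaces and bounded linear maps. A $p$-summable odd Fredholm module over $\mathcal C$ is a pair $(\mathscr H,\mathcal F)$, where $\mathscr H:\mathcal C\to SHilb$ is a $\mathbb C$-linear functor and $\mathcal F=\{\mathcal F_X:\mathscr H(X)\to\mathscr H(X)\}_{X\in Ob(\mathcal C)}$ is a family of bounded operators with $\mathcal F_X^2=id$, such that $[\mathcal F,f]:=\mathcal F_Y\mathscr H(f)-\mathscr H(f)\mathcal F_X\in\mathcal B^p(\mathscr H(X),\mathscr H(Y))$ for every $f\in Hom_{\mathcal C}(X,Y)$. **DG-semicategories and cycles.** A semicategory is a category without the requirement of identity morphisms; a semifunctor preserves composition only. A DG-semicategory $(\mathcal S,\hat\partial)$ is a $\mathbb C$-linear semicategory whose morphism spaces are cochain complexes $(Hom^n_{\mathcal S}(X,Y),\hat\partial)_{n\ge0}$ such that composition adds degrees and $\hat\partial(gf)=\hat\partial(g)f+(-1)^{|g|}g\hat\partial(f)$. $\mathcal S^0$ is the semicategory of degree $0$ morphisms. A closed graded trace of dimension $n$ on $\mathcal S$ is a family of linear maps $\hat T_X:Hom^n_{\mathcal S}(X,X)\to\mathbb C$ with $\hat T_X(\hat\partial f)=0$ for $f\in Hom^{n-1}_{\mathcal S}(X,X)$ and $\hat T_X(gg')=(-1)^{ij}\hat T_Y(g'g)$ for $g\in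 Hom^i_{\mathcal S}(Y,X)$, $g'\in Hom^j_{\mathcal S}(X,Y)$, $i+j=n$. An $n$-dimensional cycle over $\mathcal C$ is a tuple $(\mathcal S,\hat\partial,\hat T,\rho)$ with $(\mathcal S,\hat\partial)$ a DG-semicategory such that $\mathcal S^0$ is an ordinary category, $\hat T$ an $n$-dimensional closed graded trace on $\mathcal S$, and $\rho:\mathcal C\to\mathcal S^0$ a $\mathbb C$-linear semifunctor. **The tuple.** $\Omega'\mathcal C$ has the objects of $\mathcal C$, and $Hom^j_{\Omega'\mathcal C}(X,Y)\subseteq\mathcal B(\mathscr H(X),\mathscr H(Y))$ is the linear span of the operators $\mathscr H(\tilde f^0)[\mathcal F,f^1]\cdots[\mathcal F,f^j]$, where $f^1\in Hom_{\mathcal C}(X_2,X_1),\dots,f^j\in Hom_{\mathcal C}(X,X_j)$ are composable, $\tilde f^0=f^0+\mu$ with $f^0\in Hom_{\mathcal C}(X_1,Y)$ and $\mu\in\mathbb C$ ($\mu=0$ unless $X_1=Y$), and $\mathscr H(\tilde f^0)=\mathscr H(f^0)+\mu\cdot id$ (for $j=0$, $X_1=X$). The degree $|T|$ of $T\in Hom^j_{\Omega'\mathcal C}(X,Y)$ is $j$. Composition is composition of operators, and $\partial'T=[\mathcal F,T]:=\mathcal F_YT-(-1)^{|T|}T\mathcal F_X$. The semifunctor $\rho':\mathcal C\to\Omega'^0\mathcal C$ is the identity on objects and sends $f$ to $\mathscr H(f)$. For $T$ with $\partial'T$ trace class, $Tr'_s(T):=\frac12Tr(\mathcal F_X\,\partial'(T))$;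 $\widehat{Tr}_s$ is the collection of the maps $Tr'_s:Hom^{2m-1}_{\Omega'\mathcal C}(X,X)\to\mathbb C$, $X\in Ob(\mathcal C)$. **Cyclic cocycles.** $CN_n(\mathcal C)=\bigoplus_{(X_0,\dots,X_n)}Hom_{\mathcal C}(X_1,X_0)\otimes Hom_{\mathcal C}(X_2,X_1)\otimes\cdots\otimes Hom_{\mathcal C}(X_0,X_n)$ and $CN^n(\mathcal C)$ is its linear dual. For $\phi\in CN^n(\mathcal C)$, $(b\phi)(f^0\otimes\cdots\otimes f^{n+1})=\sum_{i=0}^n(-1)^i\phi(f^0\otimes\cdots\otimes f^if^{i+1}\otimes\cdots\otimes f^{n+1})+(-1)^{n+1}\phi(f^{n+1}f^0\otimes f^1\otimes\cdots\otimes f^n)$ and $(\lambda\phi)(f^0\otimes\cdots\otimes f^n)=(-1)^n\phi(f^n\otimes f^0\otimes\cdots\otimes f^{n-1})$. $\phi$ is a cyclic cocycle if $b\phi=0$ and $\lambda\phi=\phi$. *)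

theory Defs
  imports "HOL-Analysis.Analysis" "HOL-Library.Function_Algebras"
begin

section \<open>Complex vector spaces and complex inner products\<close>

class scaleC =
  fixes scaleC :: "complex \<Rightarrow> 'a \<Rightarrow> 'a" (infixr "*\<^sub>C" 75)

class complex_vector = scaleC + ab_group_add +
  assumes scaleC_add_right: "a *\<^sub>C (x + y) = a *\<^sub>C x + a *\<^sub>C y"
    and scaleC_add_left: "(a + b) *\<^sub>C x = a *\<^sub>C x + b *\<^sub>C x"
    and scaleC_scaleC: "a *\<^sub>C b *\<^sub>C x = (a * b) *\<^sub>C x"
    and scaleC_one: "1 *\<^sub>C x = x"

global_interpretation complex_vector: vector_space "scaleC :: complex \<Rightarrow> 'a \<Rightarrow> 'a::complex_vector"
  by unfold_locales
    (simp_all add: scaleC_add_right scaleC_add_left scaleC_scaleC scaleC_one)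

instantiation complex :: complex_vector
begin
definition scaleC_complex_def: "c *\<^sub>C (z::complex) = c * z"
instance by standard (simp_all add: scaleC_complex_def algebra_simps)
end

instantiation "fun" :: (type, complex_vector) complex_vector
begin
definition scaleC_fun_def: "c *\<^sub>C f = (\<lambda>x. c *\<^sub>C f x)"
instance
  by standard
    (simp_all add: scaleC_fun_def fun_eq_iff scaleC_add_right scaleC_add_left scaleC_scaleC scaleC_one)
end

text \<open>Complex inner product spaces, antilinear in the first argument. The library's real inner
  product is the real part of \<open>cinner\<close>, so that norm, topology and completeness are
  those of the library; positive definiteness is inherited from \<^class>\<open>real_inner\<close>.\<close>

class complex_inner = complex_vector + real_inner +
  fixes cinner :: "'a \<Rightarrow> 'a \<Rightarrow> complex"
  assumes scaleR_scaleC: "r *\<^sub>R x = complex_of_real r *\<^sub>C x"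
    and cinner_commute: "cinner x y = cnj (cinner y x)"
    and cinner_add_left: "cinner (x + y) z = cinner x z + cinner y z"
    and cinner_scaleC_left: "cinner (c *\<^sub>C x) y = cnj c * cinner x y"
    and inner_cinner: "inner x y = Re (cinner x y)"

definition clinear_on ::
  "'a::complex_vector set \<Rightarrow> ('a \<Rightarrow> 'b::complex_vector) \<Rightarrow> bool" where
  "clinear_on V f \<longleftrightarrow>
     (\<forall>x\<in>V. \<forall>y\<in>V. f (x + y) = f x + f y) \<and> (\<forall>c. \<forall>x\<in>V. f (c *\<^sub>C x) = c *\<^sub>C f x)"


section \<open>Complex-linear (semi)categories\<close>

text \<open>\<open>Hom C X Y\<close> is the space of morphisms from \<open>X\<close> to \<open>Y\<close>, a linear subspace of the
  arrow type; different hom-spaces may overlap. \<open>Cmp C X Y Z g f\<close> is the composite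
  \<open>X \<rightarrow> Y \<rightarrow> Z\<close>, first \<open>f\<close> and then \<open>g\<close>.\<close>

record ('o, 'a) semicat =
  Ob :: "'o set"
  Hom :: "'o \<Rightarrow> 'o \<Rightarrow> 'a set"
  Cmp :: "'o \<Rightarrow> 'o \<Rightarrow> 'o \<Rightarrow> 'a \<Rightarrow> 'a \<Rightarrow> 'a"

locale clinear_semicategory =
  fixes C :: "('o, 'a::complex_vector) semicat"
  assumes hom_subspace:
      "\<lbrakk>X \<in> Ob C; Y \<in> Ob C\<rbrakk> \<Longrightarrow> complex_vector.subspace (Hom C X Y)"
    and cmp_in_hom:
      "\<lbrakk>X \<in> Ob C; Y \<in> Ob C; Z \<in> Ob C; g \<in> Hom C Y Z; f \<in> Hom C X Y\<rbrakk>
        \<Longrightarrow> Cmp C X Y Z g f \<in> Hom C X Z"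
    and cmp_linear_left:
      "\<lbrakk>X \<in> Ob C; Y \<in> Ob C; Z \<in> Ob C; f \<in> Hom C X Y\<rbrakk>
        \<Longrightarrow> clinear_on (Hom C Y Z) (\<lambda>g. Cmp C X Y Z g f)"
    and cmp_linear_right:
      "\<lbrakk>X \<in> Ob C; Y \<in> Ob C; Z \<in> Ob C; g \<in> Hom C Y Z\<rbrakk>
        \<Longrightarrow> clinear_on (Hom C X Y) (\<lambda>f. Cmp C X Y Z g f)"
    and cmp_assoc:
      "\<lbrakk>W \<in> Ob C; X \<in> Ob C; Y \<in> Ob C; Z \<in> Ob C;
        h \<in> Hom C Y Z; g \<in> Hom C X Y; f \<in> Hom C W X\<rbrakk>
        \<Longrightarrow> Cmp C W X Z (Cmp C X Y Z h g) f = Cmp C W Y Z h (Cmp C W X Y g f)"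

definition is_identity :: "('o, 'a) semicat \<Rightarrow> 'o \<Rightarrow> 'a \<Rightarrow> bool" where
  "is_identity C X e \<longleftrightarrow> e \<in> Hom C X X \<and>
     (\<forall>Y\<in>Ob C. \<forall>f\<in>Hom C X Y. Cmp C X X Y f e = f) \<and>
     (\<forall>Y\<in>Ob C. \<forall>f\<in>Hom C Y X. Cmp C Y X X e f = f)"

locale clinear_category = clinear_semicategory C for C :: "('o, 'a::complex_vector) semicat" +
  assumes identity_exists: "X \<in> Ob C \<Longrightarrow> \<exists>e. is_identity C X e"

locale clinear_semifunctor =
  fixes C :: "('o, 'a::complex_vector) semicat"
    and D :: "('p, 'b::complex_vector) semicat"
    and Fo :: "'o \<Rightarrow> 'p" and Fm :: "'o \<Rightarrow> 'o \<Rightarrow> 'a \<Rightarrow> 'b"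
  assumes fun_ob: "X \<in> Ob C \<Longrightarrow> Fo X \<in> Ob D"
    and fun_hom:
      "\<lbrakk>X \<in> Ob C; Y \<in> Ob C; f \<in> Hom C X Y\<rbrakk> \<Longrightarrow> Fm X Y f \<in> Hom D (Fo X) (Fo Y)"
    and fun_linear: "\<lbrakk>X \<in> Ob C; Y \<in> Ob C\<rbrakk> \<Longrightarrow> clinear_on (Hom C X Y) (Fm X Y)"
    and fun_cmp:
      "\<lbrakk>X \<in> Ob C; Y \<in> Ob C; Z \<in> Ob C; g \<in> Hom C Y Z; f \<in> Hom C X Y\<rbrakk>
        \<Longrightarrow> Fm X Z (Cmp C X Y Z g f) = Cmp D (Fo X) (Fo Y) (Fo Z) (Fm Y Z g) (Fm X Y f)"

locale clinear_functor = clinear_semifunctor C D Fo Fm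
  for C :: "('o, 'a::complex_vector) semicat"
    and D :: "('p, 'b::complex_vector) semicat"
    and Fo :: "'o \<Rightarrow> 'p" and Fm :: "'o \<Rightarrow> 'o \<Rightarrow> 'a \<Rightarrow> 'b" +
  assumes fun_identity:
    "\<lbrakk>X \<in> Ob C; is_identity C X e\<rbrakk> \<Longrightarrow> is_identity D (Fo X) (Fm X X e)"


section \<open>DG-semicategories and cycles\<close>

text \<open>\<open>DHom S n X Y\<close> is the space of degree \<open>n\<close> morphisms \<open>X \<rightarrow> Y\<close>. The same element of the arrow
  type may occur in several degrees and between several pairs of objects, hence the indices:
  \<open>DCmp S i j X Y Z g f\<close> composes \<open>g : Y \<rightarrow> Z\<close> of degree \<open>i\<close> with \<open>f : X \<rightarrow> Y\<close> of degree \<open>j\<close>.\<close>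

record ('o, 'a) dg_semicat =
  DOb :: "'o set"
  DHom :: "nat \<Rightarrow> 'o \<Rightarrow> 'o \<Rightarrow> 'a set"
  DCmp :: "nat \<Rightarrow> nat \<Rightarrow> 'o \<Rightarrow> 'o \<Rightarrow> 'o \<Rightarrow> 'a \<Rightarrow> 'a \<Rightarrow> 'a"
  DDiff :: "nat \<Rightarrow> 'o \<Rightarrow> 'o \<Rightarrow> 'a \<Rightarrow> 'a"

locale dg_semicategory =
  fixes S :: "('o, 'a::complex_vector) dg_semicat"
  assumes dhom_subspace:
      "\<lbrakk>X \<in> DOb S; Y \<in> DOb S\<rbrakk> \<Longrightarrow> complex_vector.subspace (DHom S n X Y)"
    and dcmp_in_hom:
      "\<lbrakk>X \<in> DOb S; Y \<in> DOb S; Z \<in> DOb S; g \<in> DHom S i Y Z; f \<in> DHom S j X Y\<rbrakk>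
        \<Longrightarrow> DCmp S i j X Y Z g f \<in> DHom S (i + j) X Z"
    and dcmp_linear_left:
      "\<lbrakk>X \<in> DOb S; Y \<in> DOb S; Z \<in> DOb S; f \<in> DHom S j X Y\<rbrakk>
        \<Longrightarrow> clinear_on (DHom S i Y Z) (\<lambda>g. DCmp S i j X Y Z g f)"
    and dcmp_linear_right:
      "\<lbrakk>X \<in> DOb S; Y \<in> DOb S; Z \<in> DOb S; g \<in> DHom S i Y Z\<rbrakk>
        \<Longrightarrow> clinear_on (DHom S j X Y) (\<lambda>f. DCmp S i j X Y Z g f)"
    and dcmp_assoc:
      "\<lbrakk>W \<in> DOb S; X \<in> DOb S; Y \<in> DOb S; Z \<in> DOb S;
        h \<in> DHom S i Y Z; g \<in> DHom S j X Y; f \<in> DHom S k W X\<rbrakk>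
        \<Longrightarrow> DCmp S (i + j) k W X Z (DCmp S i j X Y Z h g) f
          = DCmp S i (j + k) W Y Z h (DCmp S j k W X Y g f)"
    and diff_in_hom:
      "\<lbrakk>X \<in> DOb S; Y \<in> DOb S; f \<in> DHom S n X Y\<rbrakk> \<Longrightarrow> DDiff S n X Y f \<in> DHom S (Suc n) X Y"
    and diff_linear:
      "\<lbrakk>X \<in> DOb S; Y \<in> DOb S\<rbrakk> \<Longrightarrow> clinear_on (DHom S n X Y) (DDiff S n X Y)"
    and diff_diff:
      "\<lbrakk>X \<in> DOb S; Y \<in> DOb S; f \<in> DHom S n X Y\<rbrakk>
        \<Longrightarrow> DDiff S (Suc n) X Y (DDiff S n X Y f) = 0"
    and leibniz:
      "\<lbrakk>X \<in> DOb S; Y \<in> DOb S; Z \<in> DOb S; g \<in> DHom S i Y Z; f \<in> DHom S j X Y\<rbrakk>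
        \<Longrightarrow> DDiff S (i + j) X Z (DCmp S i j X Y Z g f)
          = DCmp S (Suc i) j X Y Z (DDiff S i Y Z g) f
            + (-1) ^ i *\<^sub>C DCmp S i (Suc j) X Y Z g (DDiff S j X Y f)"

definition degree_zero :: "('o, 'a) dg_semicat \<Rightarrow> ('o, 'a) semicat" where
  "degree_zero S = \<lparr>Ob = DOb S, Hom = DHom S 0, Cmp = DCmp S 0 0\<rparr>"

definition closed_graded_trace ::
  "nat \<Rightarrow> ('o, 'a::complex_vector) dg_semicat \<Rightarrow> ('o \<Rightarrow> 'a \<Rightarrow> complex) \<Rightarrow> bool" where
  "closed_graded_trace n S T \<longleftrightarrow>
     (\<forall>X\<in>DOb S. clinear_on (DHom S n X X) (T X)) \<and>
     (\<forall>k. \<forall>X\<in>DOb S. \<forall>f\<in>DHom S k X X. Suc k = n \<longrightarrow> T X (DDiff S k X X f) = 0) \<and>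
     (\<forall>i j. \<forall>X\<in>DOb S. \<forall>Y\<in>DOb S. \<forall>g\<in>DHom S i Y X. \<forall>g'\<in>DHom S j X Y. i + j = n \<longrightarrow>
        T X (DCmp S i j X Y X g g') = (-1) ^ (i * j) * T Y (DCmp S j i Y X Y g' g))"

definition is_cycle_over ::
  "('o, 'a::complex_vector) semicat \<Rightarrow> nat \<Rightarrow> ('p, 'b::complex_vector) dg_semicat \<Rightarrow>
    ('p \<Rightarrow> 'b \<Rightarrow> complex) \<Rightarrow> ('o \<Rightarrow> 'p) \<Rightarrow> ('o \<Rightarrow> 'o \<Rightarrow> 'a \<Rightarrow> 'b) \<Rightarrow> bool" where
  "is_cycle_over C n S T \<rho>o \<rho>m \<longleftrightarrow>
     dg_semicategory S \<and> clinear_category (degree_zero S) \<and>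
     closed_graded_trace n S T \<and> clinear_semifunctor C (degree_zero S) \<rho>o \<rho>m"


section \<open>Separable Hilbert spaces, Schatten classes and the trace\<close>

text \<open>Separable Hilbert spaces are complete separable complex subspaces of an ambient inner product
  space \<open>'h\<close>, which need not itself be complete or separable. A set-indexed family of separable
  Hilbert spaces always embeds isometrically in such an \<open>'h\<close>, for instance in its Hilbert sum.\<close>

definition sep_hilbert :: "'h::complex_inner set \<Rightarrow> bool" where
  "sep_hilbert H \<longleftrightarrow> complex_vector.subspace H \<and> complete H \<and>
     (\<exists>D. countable D \<and> D \<subseteq> H \<and> H \<subseteq> closure D)"

text \<open>An operator \<open>H1 \<rightarrow> H2\<close> is a function on the ambient type which is \<open>0\<close> outside \<open>H1\<close>. With this
  convention equality, linear combinations and composition of operators are those of functions.\<close>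

definition bounded_ops :: "'h::complex_inner set \<Rightarrow> 'h set \<Rightarrow> ('h \<Rightarrow> 'h) set" where
  "bounded_ops H1 H2 = {T. T ` H1 \<subseteq> H2 \<and> (\<forall>x. x \<notin> H1 \<longrightarrow> T x = 0) \<and>
     clinear_on H1 T \<and> (\<exists>K. \<forall>x\<in>H1. norm (T x) \<le> K * norm x)}"

definition id_op :: "'h::complex_inner set \<Rightarrow> 'h \<Rightarrow> 'h" where
  "id_op H = (\<lambda>x. if x \<in> H then x else 0)"

definition SHilb :: "('h::complex_inner set, 'h \<Rightarrow> 'h) semicat" where
  "SHilb = \<lparr>Ob = {H. sep_hilbert H}, Hom = bounded_ops, Cmp = (\<lambda>_ _ _ S T. S \<circ> T)\<rparr>"

definition adjoint_op ::
  "'h::complex_inner set \<Rightarrow> 'h set \<Rightarrow> ('h \<Rightarrow> 'h) \<Rightarrow> ('h \<Rightarrow> 'h)" where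
  "adjoint_op H1 H2 T = (THE S. S \<in> bounded_ops H2 H1 \<and>
     (\<forall>x\<in>H1. \<forall>y\<in>H2. cinner (T x) y = cinner x (S y)))"

definition compact_op :: "'h::complex_inner set \<Rightarrow> ('h \<Rightarrow> 'h) \<Rightarrow> bool" where
  "compact_op H1 T \<longleftrightarrow> compact (closure (T ` {x\<in>H1. norm x \<le> 1}))"

text \<open>The singular values of \<open>T\<close> are the square roots \<open>\<sigma>\<close> of the eigenvalues of \<open>T\<^sup>*T\<close>; the
  multiplicity of \<open>\<sigma>\<close> is the dimension of the eigenspace, finite for \<open>\<sigma> > 0\<close> and \<open>T\<close> compact.\<close>

definition singular_mult ::
  "'h::complex_inner set \<Rightarrow> 'h set \<Rightarrow> ('h \<Rightarrow> 'h) \<Rightarrow> real \<Rightarrow> nat" where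
  "singular_mult H1 H2 T \<sigma> =
     complex_vector.dim {x\<in>H1. adjoint_op H1 H2 T (T x) = complex_of_real (\<sigma>\<^sup>2) *\<^sub>C x}"

text \<open>The \<open>q\<close>-th Schatten class: compact operators whose singular values, counted with multiplicity,
  have a finite sum of \<open>q\<close>-th powers. (Compactness must be required, as an operator that is not
  compact need not have any eigenvalues.)\<close>

definition schatten ::
  "real \<Rightarrow> 'h::complex_inner set \<Rightarrow> 'h set \<Rightarrow> ('h \<Rightarrow> 'h) set" where
  "schatten q H1 H2 = {T\<in>bounded_ops H1 H2. compact_op H1 T \<and>
     (\<lambda>\<sigma>. real (singular_mult H1 H2 T \<sigma>) * \<sigma> powr q) summable_on {0<..}}"

abbreviation trace_class :: "'h::complex_inner set \<Rightarrow> 'h set \<Rightarrow> ('h \<Rightarrow> 'h) set" where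
  "trace_class \<equiv> schatten 1"

definition orthonormal_basis :: "'h::complex_inner set \<Rightarrow> 'h set \<Rightarrow> bool" where
  "orthonormal_basis H B \<longleftrightarrow> B \<subseteq> H \<and>
     (\<forall>x\<in>B. \<forall>y\<in>B. cinner x y = (if x = y then 1 else 0)) \<and>
     H \<subseteq> closure (complex_vector.span B)"

text \<open>For trace class \<open>T\<close> the value does not depend on the orthonormal basis.\<close>

definition trace_op :: "'h::complex_inner set \<Rightarrow> ('h \<Rightarrow> 'h) \<Rightarrow> complex" where
  "trace_op H T = (\<Sum>\<^sub>\<infinity>e\<in>(SOME B. orthonormal_basis H B). cinner e (T e))"


section \<open>Odd Fredholm modules\<close>

text \<open>The graded commutator \<open>[F, T]\<close> for \<open>T : H X \<rightarrow> H Y\<close> regarded as an element of degree \<open>k\<close>.\<close>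

definition gcomm ::
  "('o \<Rightarrow> 'h \<Rightarrow> 'h::complex_inner) \<Rightarrow> nat \<Rightarrow> 'o \<Rightarrow> 'o \<Rightarrow> ('h \<Rightarrow> 'h) \<Rightarrow> ('h \<Rightarrow> 'h)" where
  "gcomm F k X Y T = (F Y \<circ> T) - (-1) ^ k *\<^sub>C (T \<circ> F X)"

locale odd_fredholm_module = clinear_functor C SHilb Ho Hm
  for C :: "('o, 'a::complex_vector) semicat"
    and Ho :: "'o \<Rightarrow> 'h::complex_inner set" and Hm :: "'o \<Rightarrow> 'o \<Rightarrow> 'a \<Rightarrow> 'h \<Rightarrow> 'h" +
  fixes p :: real and F :: "'o \<Rightarrow> 'h \<Rightarrow> 'h"
  assumes F_bounded: "X \<in> Ob C \<Longrightarrow> F X \<in> bounded_ops (Ho X) (Ho X)"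
    and F_square: "X \<in> Ob C \<Longrightarrow> (F X \<circ> F X) = id_op (Ho X)"
    and commutator_schatten:
      "\<lbrakk>X \<in> Ob C; Y \<in> Ob C; f \<in> Hom C X Y\<rbrakk>
        \<Longrightarrow> (F Y \<circ> Hm X Y f) - (Hm X Y f \<circ> F X) \<in> schatten p (Ho X) (Ho Y)"

text \<open>\<open>composable C [X\<^sub>1, \<dots>, X\<^sub>j\<^sub>+\<^sub>1] [f\<^sub>1, \<dots>, f\<^sub>j]\<close> says that \<open>f\<^sub>i : X\<^sub>i\<^sub>+\<^sub>1 \<rightarrow> X\<^sub>i\<close> for all \<open>i\<close>.\<close>

definition composable :: "('o, 'a) semicat \<Rightarrow> 'o list \<Rightarrow> 'a list \<Rightarrow> bool" where
  "composable C Xs fs \<longleftrightarrow> set Xs \<subseteq> Ob C \<and> length Xs = Suc (length fs) \<and>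
     (\<forall>i<length fs. fs ! i \<in> Hom C (Xs ! Suc i) (Xs ! i))"

text \<open>For composable lists as above, \<open>comm_prod\<close> is the operator
  \<open>[F, f\<^sub>1] \<dots> [F, f\<^sub>j] : H X\<^sub>j\<^sub>+\<^sub>1 \<rightarrow> H X\<^sub>1\<close>, the empty product being the identity of \<open>H X\<^sub>1\<close>. The last
  equation is for lists of wrong lengths, which do not occur.\<close>

fun comm_prod ::
  "('o \<Rightarrow> 'h::complex_inner set) \<Rightarrow> ('o \<Rightarrow> 'o \<Rightarrow> 'a \<Rightarrow> 'h \<Rightarrow> 'h) \<Rightarrow> ('o \<Rightarrow> 'h \<Rightarrow> 'h) \<Rightarrow>
    'o list \<Rightarrow> 'a list \<Rightarrow> 'h \<Rightarrow> 'h" where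
  "comm_prod Ho Hm F [X] [] = id_op (Ho X)"
| "comm_prod Ho Hm F (X # X' # Xs) (f # fs) =
     ((F X \<circ> Hm X' X f) - (Hm X' X f \<circ> F X')) \<circ> comm_prod Ho Hm F (X' # Xs) fs"
| "comm_prod Ho Hm F _ _ = 0"

definition omega_generators ::
  "('o, 'a::complex_vector) semicat \<Rightarrow> ('o \<Rightarrow> 'h::complex_inner set) \<Rightarrow>
    ('o \<Rightarrow> 'o \<Rightarrow> 'a \<Rightarrow> 'h \<Rightarrow> 'h) \<Rightarrow> ('o \<Rightarrow> 'h \<Rightarrow> 'h) \<Rightarrow> nat \<Rightarrow> 'o \<Rightarrow> 'o \<Rightarrow> ('h \<Rightarrow> 'h) set" where
  "omega_generators C Ho Hm F j X Y =
     {(Hm (hd Xs) Y f0 + \<mu> *\<^sub>C id_op (Ho Y)) \<circ> comm_prod Ho Hm F Xs fs | Xs fs f0 \<mu>.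
        composable C Xs fs \<and> length fs = j \<and> last Xs = X \<and>
        f0 \<in> Hom C (hd Xs) Y \<and> (\<mu> = 0 \<or> hd Xs = Y)}"

definition Omega ::
  "('o, 'a::complex_vector) semicat \<Rightarrow> ('o \<Rightarrow> 'h::complex_inner set) \<Rightarrow>
    ('o \<Rightarrow> 'o \<Rightarrow> 'a \<Rightarrow> 'h \<Rightarrow> 'h) \<Rightarrow> ('o \<Rightarrow> 'h \<Rightarrow> 'h) \<Rightarrow> ('o, 'h \<Rightarrow> 'h) dg_semicat" where
  "Omega C Ho Hm F =
     \<lparr>DOb = Ob C,
      DHom = (\<lambda>j X Y. complex_vector.span (omega_generators C Ho Hm F j X Y)),
      DCmp = (\<lambda>_ _ _ _ _ S T. S \<circ> T),
      DDiff = gcomm F\<rparr>"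

text \<open>\<open>Tr'\<^sub>s\<close> on endomorphisms of \<open>X\<close> of degree \<open>k\<close>.\<close>

definition super_trace ::
  "('o \<Rightarrow> 'h::complex_inner set) \<Rightarrow> ('o \<Rightarrow> 'h \<Rightarrow> 'h) \<Rightarrow> nat \<Rightarrow> 'o \<Rightarrow> ('h \<Rightarrow> 'h) \<Rightarrow> complex" where
  "super_trace Ho F k X T = 1 / 2 * trace_op (Ho X) (F X \<circ> gcomm F k X X T)"


section \<open>Cyclic cocycles\<close>

text \<open>A cochain in \<open>CN\<^sup>n\<close> is given by its values \<open>\<phi> [X\<^sub>0, \<dots>, X\<^sub>n] [f\<^sup>0, \<dots>, f\<^sup>n]\<close> on elementary tensors
  with \<open>f\<^sup>i : X\<^sub>i\<^sub>+\<^sub>1 \<rightarrow> X\<^sub>i\<close> and \<open>X\<^sub>n\<^sub>+\<^sub>1 = X\<^sub>0\<close>: a linear form on the direct sum of tensor products is the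
  same as a family, indexed by the tuples of objects, of multilinear forms in the morphisms. The
  values on other lists are irrelevant.\<close>

definition cyclic_tuple :: "('o, 'a) semicat \<Rightarrow> nat \<Rightarrow> 'o list \<Rightarrow> 'a list \<Rightarrow> bool" where
  "cyclic_tuple C n Xs fs \<longleftrightarrow>
     length Xs = Suc n \<and> length fs = Suc n \<and> composable C (Xs @ [hd Xs]) fs"

definition cochain ::
  "('o, 'a::complex_vector) semicat \<Rightarrow> nat \<Rightarrow> ('o list \<Rightarrow> 'a list \<Rightarrow> complex) \<Rightarrow> bool" where
  "cochain C n \<phi> \<longleftrightarrow> (\<forall>Xs fs. cyclic_tuple C n Xs fs \<longrightarrow>
     (\<forall>i\<le>n. clinear_on (Hom C ((Xs @ [hd Xs]) ! Suc i) (Xs ! i)) (\<lambda>g. \<phi> Xs (fs[i := g]))))"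

definition hochschild_b ::
  "('o, 'a) semicat \<Rightarrow> nat \<Rightarrow> ('o list \<Rightarrow> 'a list \<Rightarrow> complex) \<Rightarrow> 'o list \<Rightarrow> 'a list \<Rightarrow> complex" where
  "hochschild_b C n \<phi> Xs fs =
     (let Ys = Xs @ [hd Xs] in
       (\<Sum>i\<le>n. (-1) ^ i *
          \<phi> (take (Suc i) Xs @ drop (i + 2) Xs)
            (take i fs @ [Cmp C (Ys ! (i + 2)) (Ys ! (i + 1)) (Ys ! i) (fs ! i) (fs ! (i + 1))]
              @ drop (i + 2) fs)) +
       (-1) ^ (n + 1) *
          \<phi> (Xs ! (n + 1) # take n (tl Xs))
            (Cmp C (Xs ! 1) (Xs ! 0) (Xs ! (n + 1)) (fs ! (n + 1)) (fs ! 0) # take n (tl fs)))"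

definition cyclic_op ::
  "nat \<Rightarrow> ('o list \<Rightarrow> 'a list \<Rightarrow> complex) \<Rightarrow> 'o list \<Rightarrow> 'a list \<Rightarrow> complex" where
  "cyclic_op n \<phi> Xs fs = (-1) ^ n * \<phi> (last Xs # butlast Xs) (last fs # butlast fs)"

definition cyclic_cocycle ::
  "('o, 'a::complex_vector) semicat \<Rightarrow> nat \<Rightarrow> ('o list \<Rightarrow> 'a list \<Rightarrow> complex) \<Rightarrow> bool" where
  "cyclic_cocycle C n \<phi> \<longleftrightarrow> cochain C n \<phi> \<and>
     (\<forall>Xs fs. cyclic_tuple C (Suc n) Xs fs \<longrightarrow> hochschild_b C n \<phi> Xs fs = 0) \<and>
     (\<forall>Xs fs. cyclic_tuple C n Xs fs \<longrightarrow> cyclic_op n \<phi> Xs fs = \<phi> Xs fs)"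

text \<open>The cochain \<open>f\<^sup>0 \<otimes> \<dots> \<otimes> f\<^sup>n \<mapsto> Tr'\<^sub>s (H f\<^sup>0 [F, f\<^sup>1] \<dots> [F, f\<^sup>n])\<close>. The product of commutators is
  taken along \<open>[X\<^sub>1, \<dots>, X\<^sub>n, X\<^sub>0]\<close>.\<close>

definition character_cochain ::
  "('o \<Rightarrow> 'h::complex_inner set) \<Rightarrow> ('o \<Rightarrow> 'o \<Rightarrow> 'a \<Rightarrow> 'h \<Rightarrow> 'h) \<Rightarrow> ('o \<Rightarrow> 'h \<Rightarrow> 'h) \<Rightarrow>
    nat \<Rightarrow> 'o list \<Rightarrow> 'a list \<Rightarrow> complex" where
  "character_cochain Ho Hm F n Xs fs =
     (let Ys = tl Xs @ [hd Xs] in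
       super_trace Ho F n (hd Xs)
         (Hm (hd Ys) (hd Xs) (hd fs) \<circ> comm_prod Ho Hm F Ys (tl fs)))"

end

theory Submission
  imports Defs
begin

text \<open>For a compact operator \<open>T\<close> choose \<open>v\<^sub>n\<close>
  maximising \<open>\<parallel>T v\<parallel>\<close> on the unit ball of the orthogonal complement of \<open>v\<^sub>0, \<dots>, v\<^sub>n\<^sub>-\<^sub>1\<close>. The numbers
  \<open>\<sigma>\<^sub>n = \<parallel>T v\<^sub>n\<parallel>\<close> are the singular values with multiplicity, and \<open>\<sigma>\<^sub>n\<close> is at the same time the
  smallest error in approximating \<open>T\<close> by operators of rank at most \<open>n\<close>. Hence the Schatten class of
  exponent \<open>q\<close> consists of the operators whose approximation errors are \<open>q\<close>-summable; for errors, ranks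
  add and errors add or multiply, so that sums and products (Hoelder) are easy to control, and a
  product of \<open>2m\<close> commutators is trace class.

  The trace property \<open>Tr (A B) = Tr (B A)\<close> is needed when only the two products are trace class; it
  follows by computing both sides in bases extending the singular vectors of the compact operator
  \<open>A\<close>. The cycle axioms then reduce to \<open>F \<partial>T = (-1)\<^sup>|\<^sup>T\<^sup>|\<^sup>+\<^sup>1 \<partial>T F\<close>, and the cocycle identities for the
  character are the closedness and the graded trace property combined with a telescoping sum.\<close>

section \<open>Complex inner products\<close>

text \<open>The Schatten classes are defined by eigenspaces of \<open>T\<^sup>*T\<close>, from which
  not even closure under addition can be read off. The comparison with approximation errors is used
  in both directions: for the commutators, which are given as Schatten operators, and for the
  conclusion that \<open>\<partial>T\<close> is trace class. Degree 2m - 1 is the right one because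
  differentiation raises it to 2m, and 2m factors of exponent at most 2m have a product of exponent
  1.

  The Hilbert spaces are subspaces of an ambient space that may fail to be complete, so projections,
  adjoints and bases are built inside a subspace. One fact supplies them: a compact operator attains
  its norm. Applied to rank one operators it gives Riesz representation, applied to successive
  orthogonal complements it gives the singular vectors.

  In the graded trace property with i + j = 2m - 1 and j > 0, the exponents 2m / (i + 1) of
  \<open>\<partial>g\<close> and 2m / j of \<open>g'\<close> both exceed 1, so neither factor need
  be trace class.\<close>

lemma cinner_add_right: "cinner x (y + z) = cinner x y + cinner x z"
  by (metis cinner_add_left cinner_commute complex_cnj_add)

lemma cinner_scaleC_right: "cinner x (c *\<^sub>C y) = c * cinner x y"
  by (metis cinner_commute cinner_scaleC_left complex_cnj_cnj complex_cnj_mult)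

lemma cinner_zero [simp]: "cinner 0 x = 0" "cinner x 0 = 0"
  using cinner_add_left [of 0 0 x] cinner_add_right [of x 0 0] by auto

lemma scaleC_minus_one: "(- 1) *\<^sub>C x = - (x :: 'a :: complex_vector)"
  by (metis complex_vector.scale_minus_left scaleC_one)

lemma cinner_minus: "cinner (- x) y = - cinner x y" "cinner x (- y) = - cinner x y"
  using cinner_scaleC_left [of "-1" x y] cinner_scaleC_right [of x "-1" y]
  by (simp_all add: scaleC_minus_one)

lemma cinner_diff_left: "cinner (x - y) z = cinner x z - cinner y z"
  using cinner_add_left [of x "- y" z] by (simp add: cinner_minus)

lemma cinner_diff_right: "cinner z (x - y) = cinner z x - cinner z y"
  using cinner_add_right [of z x "- y"] by (simp add: cinner_minus)

lemma cinner_sum_left: "cinner (sum f A) y = (\<Sum>a\<in>A. cinner (f a) y)"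
  by (induction A rule: infinite_finite_induct) (auto simp: cinner_add_left)

lemma cinner_sum_right: "cinner y (sum f A) = (\<Sum>a\<in>A. cinner y (f a))"
  by (induction A rule: infinite_finite_induct) (auto simp: cinner_add_right)

lemmas cinner_simps = cinner_add_left cinner_add_right cinner_diff_left cinner_diff_right
  cinner_scaleC_left cinner_scaleC_right cinner_sum_left cinner_sum_right

lemma cinner_self: "cinner x x = complex_of_real ((norm x)\<^sup>2)"
proof (rule complex_eqI)
  show "Re (cinner x x) = Re (complex_of_real ((norm x)\<^sup>2))"
    by (simp add: inner_cinner [symmetric] power2_norm_eq_inner)
  show "Im (cinner x x) = Im (complex_of_real ((norm x)\<^sup>2))"
    using arg_cong [OF cinner_commute [of x x], of Im] by simp
qed

lemma cinner_self_eq_0 [simp]: "cinner x x = 0 \<longleftrightarrow> x = 0"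
  by (simp add: cinner_self)

lemma cinner_swap_0: "cinner x y = 0 \<longleftrightarrow> cinner y x = 0"
  by (metis cinner_commute complex_cnj_zero)

lemma cmod_cinner_commute: "cmod (cinner x y) = cmod (cinner y x)"
  by (metis cinner_commute complex_mod_cnj)

text \<open>The class ties the norm to the real inner product only, so homogeneity for complex
  scalars has to be recovered from \<open>cinner x x\<close>.\<close>

lemma norm_scaleC: "norm (c *\<^sub>C x) = cmod c * norm (x :: 'a :: complex_inner)"
proof -
  have "complex_of_real ((norm (c *\<^sub>C x))\<^sup>2) = c * cnj c * cinner x x"
    unfolding cinner_self [symmetric] by (simp add: cinner_scaleC_left cinner_scaleC_right)
  also have "\<dots> = complex_of_real ((cmod c)\<^sup>2 * (norm x)\<^sup>2)"
    by (simp only: complex_norm_square [symmetric] cinner_self of_real_mult)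
  finally have "complex_of_real ((norm (c *\<^sub>C x))\<^sup>2) = complex_of_real ((cmod c * norm x)\<^sup>2)"
    by (simp only: power_mult_distrib)
  then have "(norm (c *\<^sub>C x))\<^sup>2 = (cmod c * norm x)\<^sup>2"
    using of_real_eq_iff by blast
  then show ?thesis
    by (simp add: power2_eq_iff_nonneg)
qed

lemma norm_add_sq:
  "(norm (x + y))\<^sup>2 = (norm x)\<^sup>2 + (norm y)\<^sup>2 + 2 * Re (cinner x (y :: 'a :: complex_inner))"
  by (simp add: power2_norm_eq_inner inner_add inner_commute inner_cinner [symmetric])

lemma pythagoras:
  assumes "cinner x (y :: 'a :: complex_inner) = 0"
  shows "(norm (x + y))\<^sup>2 = (norm x)\<^sup>2 + (norm y)\<^sup>2"
  using assms by (simp add: norm_add_sq)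

text \<open>Rotating \<open>y\<close> by the unimodular factor \<open>c\<close> makes the inner
  product real and nonnegative, and then the real inequality applies.\<close>

lemma complex_cauchy_schwarz: "cmod (cinner x y) \<le> norm x * norm y"
proof (cases "cinner x y = 0")
  case False
  define c where "c = cnj (cinner x y) / cmod (cinner x y)"
  have "cmod c = 1" using False by (simp add: c_def norm_divide)
  have "cinner x (c *\<^sub>C y) = complex_of_real ((cmod (cinner x y))\<^sup>2) / cmod (cinner x y)"
    unfolding cinner_scaleC_right c_def complex_norm_square by simp
  also have "\<dots> = complex_of_real (cmod (cinner x y))"
    using False by (simp add: power2_eq_square)
  finally have "cinner x (c *\<^sub>C y) = complex_of_real (cmod (cinner x y))" .
  then have "cmod (cinner x y) = inner x (c *\<^sub>C y)"
    by (simp add: inner_cinner)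
  also have "\<dots> \<le> norm x * norm (c *\<^sub>C y)"
    by (rule norm_cauchy_schwarz)
  finally show ?thesis using \<open>cmod c = 1\<close> by (simp add: norm_scaleC)
qed simp

lemma bounded_linear_cinner_right: "bounded_linear (cinner x)"
proof
  show "\<exists>K. \<forall>y. norm (cinner x y) \<le> norm y * K"
    by (rule exI [of _ "norm x"]) (metis complex_cauchy_schwarz mult.commute)
qed (simp_all add: cinner_add_right scaleR_scaleC cinner_scaleC_right scaleR_conv_of_real)

lemma bounded_linear_scaleC: "bounded_linear (\<lambda>x :: 'a :: complex_inner. c *\<^sub>C x)"
proof
  show "\<exists>K. \<forall>x :: 'a. norm (c *\<^sub>C x) \<le> norm x * K"
    by (rule exI [of _ "cmod c"]) (simp add: norm_scaleC)
qed (simp_all add: scaleC_add_right scaleR_scaleC scaleC_scaleC mult.commute)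

lemma bounded_linear_scaleC_left: "bounded_linear (\<lambda>c. c *\<^sub>C (x :: 'a :: complex_inner))"
proof
  show "\<exists>K. \<forall>c. norm (c *\<^sub>C x) \<le> norm c * K"
    by (rule exI [of _ "norm x"]) (simp add: norm_scaleC)
qed (simp_all add: scaleC_add_left scaleR_scaleC scaleC_scaleC scaleR_conv_of_real)


section \<open>Operators between subspaces\<close>

lemma clinear_onD:
  assumes "clinear_on H T"
  shows "\<And>x y. x \<in> H \<Longrightarrow> y \<in> H \<Longrightarrow> T (x + y) = T x + T y"
    and "\<And>c x. x \<in> H \<Longrightarrow> T (c *\<^sub>C x) = c *\<^sub>C T x"
  using assms by (auto simp: clinear_on_def)

lemma clinear_on_0:
  assumes "clinear_on H T" "complex_vector.subspace H"
  shows "T 0 = 0"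
  using clinear_onD(1) [OF assms(1), of 0 0] complex_vector.subspace_0 [OF assms(2)] by simp

lemma clinear_on_diff:
  assumes "clinear_on H T" "complex_vector.subspace H" "x \<in> H" "y \<in> H"
  shows "T (x - y) = T x - T y"
proof -
  have "- y = (-1) *\<^sub>C y" "- T y = (-1) *\<^sub>C T y" by (simp_all add: scaleC_minus_one)
  then have "T (- y) = - T y" using clinear_onD(2) [OF assms(1,4)] by metis
  then show ?thesis
    using clinear_onD(1) [OF assms(1,3), of "- y"] complex_vector.subspace_neg [OF assms(2,4)]
    by simp
qed

lemma clinear_on_sum:
  assumes "clinear_on H T" "complex_vector.subspace H" "\<And>i. i \<in> A \<Longrightarrow> f i \<in> H"
  shows "T (sum f A) = (\<Sum>i\<in>A. T (f i))"
  using assms(3)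
proof (induction A rule: infinite_finite_induct)
  case (insert a A)
  then have "sum f A \<in> H" by (auto intro: complex_vector.subspace_sum [OF assms(2)])
  with insert show ?case using clinear_onD(1) [OF assms(1)] by simp
qed (simp_all add: clinear_on_0 [OF assms(1,2)])

lemma bounded_opsD:
  assumes "T \<in> bounded_ops H1 H2"
  shows "\<And>x. x \<in> H1 \<Longrightarrow> T x \<in> H2" "\<And>x. x \<notin> H1 \<Longrightarrow> T x = 0" "clinear_on H1 T"
  using assms by (auto simp: bounded_ops_def)

lemma bounded_ops_bound:
  assumes "T \<in> bounded_ops H1 H2"
  obtains K where "K \<ge> 0" "\<And>x. x \<in> H1 \<Longrightarrow> norm (T x) \<le> K * norm x"
proof -
  from assms obtain K where K: "\<forall>x\<in>H1. norm (T x) \<le> K * norm x"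
    by (auto simp: bounded_ops_def)
  have "norm (T x) \<le> \<bar>K\<bar> * norm x" if "x \<in> H1" for x
  proof -
    have "K * norm x \<le> \<bar>K\<bar> * norm x" by (intro mult_right_mono) auto
    with K that show ?thesis by force
  qed
  then show thesis by (intro that [of "\<bar>K\<bar>"]) auto
qed

lemma bounded_opsI:
  assumes "\<And>x. x \<in> H1 \<Longrightarrow> T x \<in> H2" "\<And>x. x \<notin> H1 \<Longrightarrow> T x = 0"
    "\<And>x y. x \<in> H1 \<Longrightarrow> y \<in> H1 \<Longrightarrow> T (x + y) = T x + T y"
    "\<And>c x. x \<in> H1 \<Longrightarrow> T (c *\<^sub>C x) = c *\<^sub>C T x"
    "\<And>x. x \<in> H1 \<Longrightarrow> norm (T x) \<le> K * norm x"
  shows "T \<in> bounded_ops H1 H2"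
  using assms unfolding bounded_ops_def clinear_on_def by blast

lemma bounded_ops_0 [simp]:
  assumes "complex_vector.subspace H2"
  shows "0 \<in> bounded_ops H1 H2"
  by (rule bounded_opsI [where K = 0]) (auto simp: complex_vector.subspace_0 [OF assms])

lemma bounded_ops_add:
  assumes S: "S \<in> bounded_ops H1 H2" and T: "T \<in> bounded_ops H1 H2"
    and "complex_vector.subspace H2"
  shows "S + T \<in> bounded_ops H1 H2"
proof -
  obtain K where K: "\<And>x. x \<in> H1 \<Longrightarrow> norm (S x) \<le> K * norm x"
    using bounded_ops_bound [OF S] by blast
  obtain L where L: "\<And>x. x \<in> H1 \<Longrightarrow> norm (T x) \<le> L * norm x"
    using bounded_ops_bound [OF T] by blast
  have "norm (S x + T x) \<le> (K + L) * norm x" if "x \<in> H1" for x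
    using norm_triangle_le [OF add_mono [OF K L]] that by (simp add: algebra_simps)
  with bounded_opsD [OF S] bounded_opsD [OF T] assms(3) show ?thesis
    by (intro bounded_opsI [where K = "K + L"])
      (auto simp: clinear_onD scaleC_add_right algebra_simps intro: complex_vector.subspace_add)
qed

lemma bounded_ops_scaleC:
  assumes T: "T \<in> bounded_ops H1 H2" and "complex_vector.subspace H2"
  shows "c *\<^sub>C T \<in> bounded_ops H1 H2"
proof -
  obtain L where L: "\<And>x. x \<in> H1 \<Longrightarrow> norm (T x) \<le> L * norm x"
    using bounded_ops_bound [OF T] by blast
  have "norm (c *\<^sub>C T x) \<le> (cmod c * L) * norm x" if "x \<in> H1" for x
    using mult_left_mono [OF L [OF that], of "cmod c"] by (simp add: norm_scaleC algebra_simps)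
  with bounded_opsD [OF T] assms(2) show ?thesis
    by (intro bounded_opsI [where K = "cmod c * L"])
      (auto simp: scaleC_fun_def clinear_onD scaleC_add_right scaleC_scaleC mult.commute
        intro: complex_vector.subspace_scale)
qed

lemma bounded_ops_subspace:
  assumes "complex_vector.subspace H2"
  shows "complex_vector.subspace (bounded_ops H1 H2)"
  using assms unfolding complex_vector.subspace_def [of "bounded_ops H1 H2"]
  by (auto intro: bounded_ops_add bounded_ops_scaleC)

lemma bounded_ops_comp:
  assumes S: "S \<in> bounded_ops H2 H3" and T: "T \<in> bounded_ops H1 H2"
    and H2: "complex_vector.subspace H2"
  shows "S \<circ> T \<in> bounded_ops H1 H3"
proof -
  obtain K where K: "K \<ge> 0" "\<And>x. x \<in> H2 \<Longrightarrow> norm (S x) \<le> K * norm x"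
    using bounded_ops_bound [OF S] by blast
  obtain L where L: "\<And>x. x \<in> H1 \<Longrightarrow> norm (T x) \<le> L * norm x"
    using bounded_ops_bound [OF T] by blast
  have "norm (S (T x)) \<le> (K * L) * norm x" if "x \<in> H1" for x
    using order_trans [OF K(2) [OF bounded_opsD(1) [OF T that]] mult_left_mono [OF L [OF that] K(1)]]
    by (simp add: algebra_simps)
  with bounded_opsD [OF S] bounded_opsD [OF T] clinear_on_0 [OF bounded_opsD(3) [OF S] H2]
  show ?thesis
    by (intro bounded_opsI [where K = "K * L"]) (auto simp: clinear_onD)
qed

lemma id_op_bounded: "complex_vector.subspace H \<Longrightarrow> id_op H \<in> bounded_ops H H"
  by (rule bounded_opsI [where K = 1])
    (auto simp: id_op_def complex_vector.subspace_add complex_vector.subspace_scale)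

lemma comp_id_op: "T \<in> bounded_ops H1 H2 \<Longrightarrow> T \<circ> id_op H1 = T"
  if "complex_vector.subspace H1"
  using clinear_on_0 [OF bounded_opsD(3) that] by (auto simp: fun_eq_iff id_op_def bounded_opsD)

lemma id_op_comp: "T \<in> bounded_ops H1 H2 \<Longrightarrow> id_op H2 \<circ> T = T"
  using bounded_opsD by (fastforce simp: fun_eq_iff id_op_def)

text \<open>An operator is linear on its domain only, so additivity in the right factor depends on
  both summands taking values in \<open>H2\<close>. In the left factor it holds for arbitrary
  functions.\<close>

lemma comp_add_right:
  assumes "S \<in> bounded_ops H2 H3" "T \<in> bounded_ops H1 H2" "T' \<in> bounded_ops H1 H2"
    "complex_vector.subspace H2"
  shows "S \<circ> (T + T') = (S \<circ> T) + (S \<circ> T')"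
proof
  fix x
  show "(S \<circ> (T + T')) x = ((S \<circ> T) + (S \<circ> T')) x"
    using bounded_opsD [OF assms(1)] bounded_opsD [OF assms(2)] bounded_opsD [OF assms(3)]
      clinear_on_0 [OF bounded_opsD(3) [OF assms(1)] assms(4)]
    by (cases "x \<in> H1") (simp_all add: clinear_onD)
qed

lemma comp_scaleC_right:
  assumes "S \<in> bounded_ops H2 H3" "T \<in> bounded_ops H1 H2"
    "complex_vector.subspace H2"
  shows "S \<circ> (c *\<^sub>C T) = c *\<^sub>C (S \<circ> T)"
proof
  fix x
  show "(S \<circ> (c *\<^sub>C T)) x = (c *\<^sub>C (S \<circ> T)) x"
    using bounded_opsD [OF assms(1)] bounded_opsD [OF assms(2)]
      clinear_on_0 [OF bounded_opsD(3) [OF assms(1)] assms(3)]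
    by (cases "x \<in> H1") (simp_all add: clinear_onD scaleC_fun_def)
qed

lemma comp_add_left: "(S + S') \<circ> T = (S \<circ> T) + (S' \<circ> T)"
  for S S' :: "'b \<Rightarrow> 'c :: plus"
  by (simp add: fun_eq_iff)

lemma comp_diff_left: "(S - S') \<circ> T = (S \<circ> T) - (S' \<circ> T)"
  for S S' :: "'b \<Rightarrow> 'c :: minus"
  by (simp add: fun_eq_iff)

lemma comp_scaleC_left: "(c *\<^sub>C S) \<circ> T = c *\<^sub>C (S \<circ> T)"
  by (simp add: fun_eq_iff scaleC_fun_def)

lemma diff_conv_scaleC: "S - T = S + (-1) *\<^sub>C (T :: 'a :: complex_vector)"
  by (simp add: scaleC_minus_one)

lemma comp_diff_right:
  assumes "S \<in> bounded_ops H2 H3" "T \<in> bounded_ops H1 H2" "T' \<in> bounded_ops H1 H2"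
    "complex_vector.subspace H2"
  shows "S \<circ> (T - T') = (S \<circ> T) - (S \<circ> T')"
  using assms
  by (simp only: diff_conv_scaleC comp_add_right [OF assms(1,2) bounded_ops_scaleC]
      comp_scaleC_right [OF assms(1)])

lemma bounded_ops_diff:
  assumes "S \<in> bounded_ops H1 H2" "T \<in> bounded_ops H1 H2" "complex_vector.subspace H2"
  shows "S - T \<in> bounded_ops H1 H2"
  using complex_vector.subspace_diff [OF bounded_ops_subspace] assms by blast


section \<open>Maximising vectors, Riesz representation and orthonormal bases\<close>

text \<open>Sequential form of compactness. It passes to every subset of \<open>K\<close>, which the
  successive orthogonal complements require, and it is immediate for the rank one maps used in Riesz
  representation.\<close>

definition subseq_convergent_on where
  "subseq_convergent_on K T \<longleftrightarrow> (\<forall>x :: nat \<Rightarrow> _. (\<forall>k. x k \<in> K \<and> norm (x k) \<le> 1) \<longrightarrow>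
     (\<exists>r l. strict_mono r \<and> (\<lambda>k. T (x (r k))) \<longlonglongrightarrow> l))"

text \<open>No weak compactness is needed: a sequence \<open>x\<^sub>k\<close> in the unit ball along which \<open>T x\<^sub>k\<close> converges
  and \<open>\<parallel>T x\<^sub>k\<parallel>\<close> tends to the norm \<open>s\<close> of \<open>T\<close> is Cauchy by the parallelogram law, since
  \<open>\<parallel>T (x\<^sub>k + x\<^sub>l)\<parallel>\<close> is close to \<open>2 s\<close> and hence \<open>\<parallel>x\<^sub>k + x\<^sub>l\<parallel>\<close> is close to \<open>2\<close>.\<close>

lemma norm_attained:
  fixes T :: "'h::complex_inner \<Rightarrow> 'k::complex_inner"
  assumes K: "complex_vector.subspace K" "complete K" and lin: "clinear_on K T"
    and bdd: "\<And>x. x \<in> K \<Longrightarrow> norm (T x) \<le> B * norm x"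
    and cpt: "subseq_convergent_on K T"
  obtains v where "v \<in> K" "\<And>x. x \<in> K \<Longrightarrow> norm (T x) \<le> norm (T v) * norm x"
    "T v = 0 \<Longrightarrow> v = 0" "norm v = 1 \<or> v = 0"
proof -
  define N where "N = (\<lambda>x. norm (T x)) ` {x\<in>K. norm x \<le> 1}"
  define s where "s = Sup N"
  have T0: "T 0 = 0" by (rule clinear_on_0 [OF lin K(1)])
  have K0: "0 \<in> K" by (rule complex_vector.subspace_0 [OF K(1)])
  have "norm (T x) \<le> \<bar>B\<bar>" if "x \<in> K" "norm x \<le> 1" for x
  proof -
    have "B * norm x \<le> \<bar>B\<bar> * 1" using that by (intro mult_mono) auto
    with bdd [OF that(1)] show ?thesis by simp
  qed
  then have bddN: "bdd_above N" by (auto simp: N_def intro!: bdd_aboveI [of _ "\<bar>B\<bar>"])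
  have "0 \<in> N" using K0 T0 by (auto simp: N_def intro!: image_eqI [of _ _ 0])
  then have s0: "s \<ge> 0" unfolding s_def by (rule cSup_upper [OF _ bddN])
  have le_s: "norm (T x) \<le> s * norm x" if "x \<in> K" for x
  proof (cases "x = 0")
    case False
    define y where "y = complex_of_real (1 / norm x) *\<^sub>C x"
    have y: "y \<in> K" "norm y = 1"
      using that False K(1) by (auto simp: y_def norm_scaleC norm_divide complex_vector.subspace_scale)
    have "norm (T y) \<le> s" unfolding s_def
      by (rule cSup_upper [OF _ bddN]) (use y in \<open>auto simp: N_def\<close>)
    moreover have "norm (T y) = norm (T x) / norm x"
      using that by (simp add: y_def clinear_onD [OF lin] norm_scaleC norm_divide)
    ultimately show ?thesis using False by (simp add: field_simps)
  qed (simp add: T0)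
  show thesis
  proof (cases "s = 0")
    case True
    \<comment> \<open>Here \<open>T\<close> vanishes on \<open>K\<close>. Choosing 0 instead of a
      unit vector keeps \<open>T v = 0 \<Longrightarrow> v = 0\<close> true, so that zero vectors
      later mark the end of the list of singular vectors.\<close>
    show thesis by (rule that [of 0]) (use K0 T0 le_s True in auto)
  next
    case False
    with s0 have s: "s > 0" by simp
    have "\<exists>x. x \<in> K \<and> norm x \<le> 1 \<and> s - inverse (real (Suc k)) < norm (T x)" for k
    proof -
      have "\<exists>y\<in>N. s - inverse (real (Suc k)) < y" unfolding s_def
        by (rule less_cSupE [of "Sup N - inverse (real (Suc k))" N])
          (use \<open>0 \<in> N\<close> in \<open>auto simp: of_nat_Suc [symmetric] simp del: of_nat_Suc\<close>)
      then show ?thesis by (auto simp: N_def)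
    qed
    then obtain x where x: "\<And>k. x k \<in> K" "\<And>k. norm (x k) \<le> 1"
      "\<And>k. s - inverse (real (Suc k)) < norm (T (x k))" by metis
    obtain r l where r: "strict_mono r" and l: "(\<lambda>k. T (x (r k))) \<longlonglongrightarrow> l"
      using cpt x(1,2) unfolding subseq_convergent_on_def by blast
    define y where "y = (\<lambda>k. x (r k))"
    have y: "\<And>k. y k \<in> K" "\<And>k. norm (y k) \<le> 1" using x by (auto simp: y_def)
    have Ty_le: "norm (T (y k)) \<le> s" for k
      using le_s [OF y(1)] mult_left_mono [OF y(2) s0, of k] by (meson order_trans mult_right_le_one_le norm_ge_zero s0 y(2))
    have "(\<lambda>k. s - inverse (real (Suc k))) \<longlonglongrightarrow> s - 0"
      by (intro tendsto_intros LIMSEQ_inverse_real_of_nat)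
    then have "(\<lambda>k. s - inverse (real (Suc (r k)))) \<longlonglongrightarrow> s"
      using LIMSEQ_subseq_LIMSEQ [OF _ r] by (fastforce simp: o_def)
    then have "(\<lambda>k. norm (T (y k))) \<longlonglongrightarrow> s"
      by (rule tendsto_sandwich [OF _ _ _ tendsto_const, rotated 2])
        (use Ty_le x(3) in \<open>auto simp: y_def intro!: always_eventually less_imp_le\<close>)
    moreover have "(\<lambda>k. norm (T (y k))) \<longlonglongrightarrow> norm l"
      using l by (auto simp: y_def intro: tendsto_norm)
    ultimately have nl: "norm l = s" by (rule LIMSEQ_unique [rotated])
    define e where "e = (\<lambda>k. norm (T (y k) - l))"
    have e0: "e \<longlonglongrightarrow> 0" unfolding e_def using l
      by (simp add: y_def LIM_zero tendsto_norm_zero)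
    have dist: "(norm (y k - y j))\<^sup>2 \<le> 4 * ((e k + e j) / s)" for k j
    proof -
      have "2 * s = norm (l + l)" by (metis nl norm_scaleR abs_numeral scaleR_2)
      also have "l + l = (T (y k) + T (y j)) - ((T (y k) - l) + (T (y j) - l))" by simp
      also have "norm \<dots> \<le> norm (T (y k) + T (y j)) + (e k + e j)"
        unfolding e_def by (meson norm_triangle_ineq norm_triangle_ineq4 add_left_mono order_trans)
      also have "T (y k) + T (y j) = T (y k + y j)" by (simp add: clinear_onD [OF lin] y)
      also have "norm \<dots> \<le> s * norm (y k + y j)"
        by (intro le_s complex_vector.subspace_add K y)
      finally have a: "2 - (e k + e j) / s \<le> norm (y k + y j)"
        using s by (simp add: field_simps)
      define a t where "a = norm (y k + y j)" and "t = (e k + e j) / s"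
      have t: "t \<ge> 0" using s by (simp add: t_def e_def)
      \<comment> \<open>The bound \<open>2 - t \<le> a\<close> may be squared only if its left side
        is nonnegative; for \<open>t \<ge> 1\<close> the claim is trivial.\<close>
      have "4 - a\<^sup>2 \<le> 4 * t"
      proof (cases "t \<ge> 1")
        case True
        then show ?thesis using zero_le_power2 [of a] by linarith
      next
        case False
        then have "(2 - t)\<^sup>2 \<le> a\<^sup>2" using a by (intro power_mono) (auto simp: a_def t_def)
        moreover have "(2 - t)\<^sup>2 = 4 - 4 * t + t\<^sup>2" by (simp add: power2_eq_square algebra_simps)
        ultimately show ?thesis using zero_le_power2 [of t] by linarith
      qed
      moreover have "(norm (y k - y j))\<^sup>2 + a\<^sup>2 = 2 * (norm (y k))\<^sup>2 + 2 * (norm (y j))\<^sup>2"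
        by (simp add: a_def power2_norm_eq_inner inner_add inner_diff inner_commute)
      moreover have "(norm (y k))\<^sup>2 \<le> 1" "(norm (y j))\<^sup>2 \<le> 1"
        using y(2) by (auto intro!: power_le_one)
      ultimately show ?thesis unfolding t_def by linarith
    qed
    have "Cauchy y"
    proof (rule metric_CauchyI)
      fix \<epsilon> :: real assume \<epsilon>: "\<epsilon> > 0"
      then have "\<epsilon>\<^sup>2 * s / 8 > 0" using s by simp
      from order_tendstoD(2) [OF e0 this] obtain M where
        M: "\<And>k. k \<ge> M \<Longrightarrow> e k < \<epsilon>\<^sup>2 * s / 8" by (auto simp: eventually_sequentially)
      have "dist (y k) (y j) < \<epsilon>" if "k \<ge> M" "j \<ge> M" for k j
      proof -
        have "(e k + e j) / s < \<epsilon>\<^sup>2 / 4"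
          using M [OF that(1)] M [OF that(2)] s by (simp add: field_simps)
        then have "(norm (y k - y j))\<^sup>2 < \<epsilon>\<^sup>2" using dist [of k j] by linarith
        then show ?thesis using \<epsilon> by (simp add: dist_norm power2_less_imp_less)
      qed
      then show "\<exists>M. \<forall>m\<ge>M. \<forall>n\<ge>M. dist (y m) (y n) < \<epsilon>" by blast
    qed
    then obtain v where v: "v \<in> K" "y \<longlonglongrightarrow> v"
      using K(2) y(1) unfolding complete_def by blast
    have "(\<lambda>k. T (y k)) \<longlonglongrightarrow> T v"
    proof (rule LIM_zero_cancel, rule Lim_null_comparison)
      show "(\<lambda>k. B * norm (y k - v)) \<longlonglongrightarrow> 0"
        using tendsto_mult_right_zero [OF tendsto_norm_zero [OF LIM_zero [OF v(2)]]] .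
      show "\<forall>\<^sub>F k in sequentially. norm (T (y k) - T v) \<le> B * norm (y k - v)"
        using bdd [OF complex_vector.subspace_diff [OF K(1) y(1) v(1)]]
        by (simp add: clinear_on_diff [OF lin K(1) y(1) v(1)])
    qed
    then have "T v = l" using l LIMSEQ_unique by (auto simp: y_def)
    with nl have Tv: "norm (T v) = s" by simp
    have "norm v \<le> 1"
      using tendsto_norm [OF v(2)] y(2) by (intro LIMSEQ_le_const2) auto
    moreover have "norm v \<ge> 1" using le_s [OF v(1)] Tv s by simp
    ultimately show thesis
      using that [of v] v(1) le_s Tv s by force
  qed
qed

text \<open>First variation at the maximiser: moving from \<open>v\<close> in the direction of
  \<open>x\<close> changes the squared norm of the image to first order by a multiple of
  \<open>cinner (T v) (T x)\<close>, while the squared norm of the vector, by orthogonality, changes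
  only to second order.\<close>

lemma maximiser_orthogonal:
  fixes T :: "'h::complex_inner \<Rightarrow> 'k::complex_inner"
  assumes K: "complex_vector.subspace K" and lin: "clinear_on K T"
    and v: "v \<in> K" "norm v = 1 \<or> v = 0" and x: "x \<in> K" "cinner v x = 0"
    and max: "\<And>y. y \<in> K \<Longrightarrow> norm (T y) \<le> norm (T v) * norm y"
  shows "cinner (T v) (T x) = 0"
proof (rule ccontr)
  assume z: "cinner (T v) (T x) \<noteq> 0"
  define z where "z = cinner (T v) (T x)"
  define s where "s = norm (T v)"
  \<comment> \<open>The comparison will end in
    \<open>2 \<le> t * (s\<^sup>2 * (norm x)\<^sup>2)\<close>, and this step length makes the right
    side at most 1; the summand 1 avoids division by zero. The factor \<open>cnj z\<close> in
    \<open>c\<close> turns the first order term real and positive.\<close>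
  define t where "t = 1 / (s\<^sup>2 * (norm x)\<^sup>2 + 1)"
  have den: "s\<^sup>2 * (norm x)\<^sup>2 + 1 > 0" by (simp add: add_nonneg_pos)
  then have t: "t > 0" by (simp add: t_def)
  have nv: "norm v = 1" using v z clinear_on_0 [OF lin K] by auto
  define c where "c = complex_of_real t * cnj z"
  define w where "w = c *\<^sub>C x"
  have w: "w \<in> K" using x K by (auto simp: w_def intro: complex_vector.subspace_scale)
  have Tw: "T w = c *\<^sub>C T x" using x by (simp add: w_def clinear_onD [OF lin])
  have "cinner (T v) (T w) = complex_of_real (t * (cmod z)\<^sup>2)"
    unfolding Tw cinner_scaleC_right z_def [symmetric] c_def
    by (simp add: complex_norm_square mult.commute del: of_real_power)
  then have "2 * (t * (cmod z)\<^sup>2) + s\<^sup>2 \<le> (norm (T v + T w))\<^sup>2"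
    by (simp add: norm_add_sq s_def)
  also have "T v + T w = T (v + w)" using v w by (simp add: clinear_onD [OF lin])
  also have "(norm (T (v + w)))\<^sup>2 \<le> (s * norm (v + w))\<^sup>2"
    unfolding s_def using v w K by (intro power_mono max) (auto intro: complex_vector.subspace_add)
  also have "\<dots> = s\<^sup>2 * (1 + (norm w)\<^sup>2)"
    using x(2) nv by (simp add: power_mult_distrib w_def pythagoras cinner_scaleC_right)
  also have "(norm w)\<^sup>2 = t\<^sup>2 * (cmod z)\<^sup>2 * (norm x)\<^sup>2"
    by (simp add: w_def norm_scaleC c_def norm_mult power_mult_distrib)
  finally have "(t * (cmod z)\<^sup>2) * 2 \<le> (t * (cmod z)\<^sup>2) * (t * (s\<^sup>2 * (norm x)\<^sup>2))"
    by (simp add: algebra_simps power2_eq_square)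
  then have "2 \<le> t * (s\<^sup>2 * (norm x)\<^sup>2)"
    using t z by (subst (asm) mult_le_cancel_left_pos) (auto simp: z_def)
  also have "\<dots> \<le> 1" using den by (simp add: t_def field_simps)
  finally show False by simp
qed

text \<open>The rank one operator \<open>\<lambda>x. g x *\<^sub>C y\<close> is compact because
  bounded sequences of scalars have convergent subsequences, so it attains its norm at some
  \<open>v\<close>. By \<open>maximiser_orthogonal\<close>, \<open>g\<close> vanishes on the
  complement of \<open>v\<close> in \<open>K\<close>, hence \<open>g\<close> is a multiple of
  \<open>cinner v\<close>.\<close>

lemma riesz_representation:
  fixes g :: "'h::complex_inner \<Rightarrow> complex"
  assumes K: "complex_vector.subspace K" "complete K" and lin: "clinear_on K g"
    and bdd: "\<And>x. x \<in> K \<Longrightarrow> cmod (g x) \<le> B * norm x"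
  shows "\<exists>k\<in>K. \<forall>x\<in>K. g x = cinner k x"
proof (cases "\<forall>x\<in>K. g x = 0")
  case True
  then show ?thesis
    by (intro bexI [of _ 0]) (auto simp: complex_vector.subspace_0 [OF K(1)])
next
  case False
  then obtain y where y: "y \<in> K" "g y \<noteq> 0" by blast
  have y0: "y \<noteq> 0" using y(2) clinear_on_0 [OF lin K(1)] by auto
  have glin: "g (a + b) = g a + g b" "g (c *\<^sub>C a) = c * g a" if "a \<in> K" "b \<in> K" for a b c
    using clinear_onD [OF lin] that by (auto simp: scaleC_complex_def)
  define T where "T = (\<lambda>x. g x *\<^sub>C y)"
  have Tlin: "clinear_on K T"
    by (auto simp: clinear_on_def T_def glin scaleC_add_left scaleC_scaleC)
  have Tbdd: "norm (T x) \<le> (B * norm y) * norm x" if "x \<in> K" for x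
    using mult_right_mono [OF bdd [OF that], of "norm y"] by (simp add: T_def norm_scaleC algebra_simps)
  have cpt: "subseq_convergent_on K T" unfolding subseq_convergent_on_def
  proof (intro allI impI)
    fix x :: "nat \<Rightarrow> 'h" assume x: "\<forall>k. x k \<in> K \<and> norm (x k) \<le> 1"
    have "cmod (g (x k)) \<le> \<bar>B\<bar>" for k
    proof -
      have "B * norm (x k) \<le> \<bar>B\<bar> * 1" using x by (intro mult_mono) auto
      with bdd [of "x k"] x show ?thesis by force
    qed
    then have "bounded (range (\<lambda>k. g (x k)))" by (auto simp: bounded_iff)
    then obtain l r where r: "strict_mono r" "((\<lambda>k. g (x k)) \<circ> r) \<longlonglongrightarrow> l"
      using bounded_imp_convergent_subsequence by blast
    have "(\<lambda>k. T (x (r k))) \<longlonglongrightarrow> l *\<^sub>C y"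
      using bounded_linear.tendsto [OF bounded_linear_scaleC_left r(2)] by (simp add: T_def o_def)
    with r(1) show "\<exists>r l. strict_mono r \<and> (\<lambda>k. T (x (r k))) \<longlonglongrightarrow> l" by blast
  qed
  obtain v where v: "v \<in> K" "\<And>x. x \<in> K \<Longrightarrow> norm (T x) \<le> norm (T v) * norm x" "norm v = 1 \<or> v = 0"
    using norm_attained [OF K Tlin Tbdd cpt] by metis
  have "norm (T y) > 0" using y y0 by (simp add: T_def norm_scaleC)
  with v(2) [OF y(1)] have Tv: "T v \<noteq> 0" by auto
  then have gv: "g v \<noteq> 0" by (auto simp: T_def)
  have nv: "norm v = 1" using v(3) Tv clinear_on_0 [OF Tlin K(1)] by auto
  have "g x = cinner (cnj (g v) *\<^sub>C v) x" if x: "x \<in> K" for x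
  proof -
    define x' where "x' = x - cinner v x *\<^sub>C v"
    have x': "x' \<in> K" unfolding x'_def
      by (intro complex_vector.subspace_diff complex_vector.subspace_scale K v x)
    have "cinner v x' = 0" by (simp add: x'_def cinner_simps cinner_self nv)
    from maximiser_orthogonal [OF K(1) Tlin v(1,3) x' this v(2)]
    have "g x' = 0" using gv y0 by (simp add: T_def cinner_simps)
    moreover have "x = x' + cinner v x *\<^sub>C v" by (simp add: x'_def)
    ultimately have "g x = cinner v x * g v"
      using glin x' v(1) complex_vector.subspace_scale [OF K(1) v(1)] by (metis add_0)
    then show ?thesis by (simp add: cinner_simps mult.commute)
  qed
  moreover have "cnj (g v) *\<^sub>C v \<in> K" by (intro complex_vector.subspace_scale K v)
  ultimately show ?thesis by blast
qed

text \<open>The projection \<open>k\<close> is the Riesz vector of \<open>cinner x\<close>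
  restricted to \<open>K\<close>; the point \<open>x\<close> may lie anywhere in the ambient
  space.\<close>

lemma orthogonal_projection:
  assumes "complex_vector.subspace K" "complete K"
  shows "\<exists>k\<in>K. \<forall>y\<in>K. cinner (x - k) y = 0"
proof -
  have "\<exists>k\<in>K. \<forall>y\<in>K. cinner x y = cinner k y"
    by (rule riesz_representation [OF assms, of _ "norm x"])
      (auto simp: clinear_on_def cinner_simps scaleC_complex_def complex_cauchy_schwarz)
  then show ?thesis by (auto simp: cinner_diff_left)
qed

section \<open>Closed spans, orthonormal bases, expansions and adjoints\<close>

lemma closure_complex_subspace:
  fixes V :: "'h::complex_inner set"
  assumes "complex_vector.subspace V"
  shows "complex_vector.subspace (closure V)"
  unfolding complex_vector.subspace_def
proof (intro conjI ballI allI)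
  show "0 \<in> closure V" using complex_vector.subspace_0 [OF assms] closure_subset by blast
next
  fix x y assume "x \<in> closure V" "y \<in> closure V"
  then obtain a b where "\<And>n. a n \<in> V" "a \<longlonglongrightarrow> x" "\<And>n. b n \<in> V" "b \<longlonglongrightarrow> y"
    by (auto simp: closure_sequential)
  then show "x + y \<in> closure V" unfolding closure_sequential
    by (intro exI [of _ "\<lambda>n. a n + b n"]) (auto intro: complex_vector.subspace_add [OF assms] tendsto_add)
next
  fix c x assume "x \<in> closure V"
  then obtain a where "\<And>n. a n \<in> V" "a \<longlonglongrightarrow> x"
    by (auto simp: closure_sequential)
  then show "c *\<^sub>C x \<in> closure V" unfolding closure_sequential
    by (intro exI [of _ "\<lambda>n. c *\<^sub>C a n"])
      (auto intro: complex_vector.subspace_scale [OF assms] bounded_linear.tendsto [OF bounded_linear_scaleC])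
qed

definition orthonormal :: "'h::complex_inner set \<Rightarrow> bool" where
  "orthonormal A \<longleftrightarrow> (\<forall>x\<in>A. \<forall>y\<in>A. cinner x y = (if x = y then 1 else 0))"

text \<open>By Zorn there is a maximal orthonormal set containing \<open>A\<close>. Its span is
  dense: otherwise some vector has a nonzero residual after projection onto the closed span, and the
  normalised residual could be added. The trace identity needs bases through prescribed singular
  vectors, hence the given \<open>A\<close>.\<close>

lemma orthonormal_basis_extend:
  fixes H :: "'h::complex_inner set"
  assumes H: "complex_vector.subspace H" "complete H" and A: "A \<subseteq> H" "orthonormal A"
  obtains B where "A \<subseteq> B" "orthonormal_basis H B"
proof -
  define \<A> where "\<A> = {B. A \<subseteq> B \<and> B \<subseteq> H \<and> orthonormal B}"
  have "\<exists>M\<in>\<A>. \<forall>X\<in>\<A>. M \<subseteq> X \<longrightarrow> X = M"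
  proof (rule subset_Zorn_nonempty)
    show "\<A> \<noteq> {}" using A by (auto simp: \<A>_def)
    fix \<C> assume \<C>: "\<C> \<noteq> {}" "subset.chain \<A> \<C>"
    then have *: "\<C> \<subseteq> \<A>" "\<And>X Y. X \<in> \<C> \<Longrightarrow> Y \<in> \<C> \<Longrightarrow> X \<subseteq> Y \<or> Y \<subseteq> X"
      by (auto simp: subset.chain_def)
    have "orthonormal (\<Union>\<C>)" unfolding orthonormal_def
    proof (intro ballI)
      fix x y assume "x \<in> \<Union>\<C>" "y \<in> \<Union>\<C>"
      then obtain X where "X \<in> \<C>" "x \<in> X" "y \<in> X" using *(2) by (metis UnionE subsetD)
      then show "cinner x y = (if x = y then 1 else 0)"
        using *(1) by (auto simp: \<A>_def orthonormal_def)
    qed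
    then show "\<Union>\<C> \<in> \<A>" using * \<C>(1) by (auto simp: \<A>_def)
  qed
  then obtain B where B: "A \<subseteq> B" "B \<subseteq> H" "orthonormal B"
    and max: "\<And>X. X \<in> \<A> \<Longrightarrow> B \<subseteq> X \<Longrightarrow> X = B" by (auto simp: \<A>_def)
  define K where "K = closure (complex_vector.span B)"
  have K: "complex_vector.subspace K" unfolding K_def
    by (intro closure_complex_subspace complex_vector.subspace_span)
  have "complex_vector.span B \<subseteq> H" using B(2) H(1) by (rule complex_vector.span_minimal)
  then have KH: "K \<subseteq> H" unfolding K_def
    by (rule closure_minimal [OF _ complete_imp_closed [OF H(2)]])
  have "closed K" unfolding K_def by (rule closed_closure)
  then have cK: "complete K" using KH H(2) by (rule complete_closed_subset)
  have "H \<subseteq> K"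
  proof
    fix x assume x: "x \<in> H"
    obtain k where k: "k \<in> K" "\<And>y. y \<in> K \<Longrightarrow> cinner (x - k) y = 0"
      using orthogonal_projection [OF K cK] by blast
    show "x \<in> K"
    proof (rule ccontr)
      assume "x \<notin> K"
      then have ne: "x - k \<noteq> 0" using k by auto
      define z where "z = complex_of_real (1 / norm (x - k)) *\<^sub>C (x - k)"
      have nz: "norm z = 1" using ne by (simp add: z_def norm_scaleC norm_divide)
      have BK: "B \<subseteq> K" unfolding K_def using complex_vector.span_superset closure_subset by blast
      have zB: "cinner z b = 0" "cinner b z = 0" if "b \<in> B" for b
      proof -
        show "cinner z b = 0" using k(2) that BK by (auto simp: z_def cinner_scaleC_left)
        then show "cinner b z = 0" by (rule iffD1 [OF cinner_swap_0])
      qed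
      have zB': "z \<notin> B" using zB(1) [of z] nz by auto
      have "z \<in> H" unfolding z_def using x k(1) KH H(1)
        by (auto intro!: complex_vector.subspace_scale complex_vector.subspace_diff)
      moreover have "orthonormal (insert z B)"
        using B(3) zB zB' nz unfolding orthonormal_def by (auto simp: cinner_self)
      ultimately have "insert z B \<in> \<A>" using B by (auto simp: \<A>_def)
      with max [OF this] zB' show False by auto
    qed
  qed
  then have "orthonormal_basis H B"
    using B by (auto simp: orthonormal_basis_def K_def orthonormal_def)
  with B(1) show thesis by (rule that)
qed

lemma orthonormal_basis_exists:
  fixes H :: "'h::complex_inner set"
  assumes "complex_vector.subspace H" "complete H"
  shows "orthonormal_basis H (SOME B. orthonormal_basis H B)"
proof -
  obtain B where "orthonormal_basis H B"
    using orthonormal_basis_extend [OF assms, of "{}"] by (auto simp: orthonormal_def)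
  then show ?thesis by (rule someI)
qed

lemma bessel_finite:
  assumes "orthonormal J" "finite J"
  shows "y \<in> complex_vector.span J \<Longrightarrow> cinner (x - (\<Sum>e\<in>J. cinner e x *\<^sub>C e)) y = 0"
    and "(\<Sum>e\<in>J. (cmod (cinner e x))\<^sup>2) \<le> (norm x)\<^sup>2"
proof -
  let ?P = "\<Sum>e\<in>J. cinner e x *\<^sub>C e"
  have ort: "cinner (x - ?P) y = 0" if "y \<in> complex_vector.span J" for y
    using that
  proof (induction rule: complex_vector.span_induct_alt)
    case (step c a z)
    have "cinner ?P a = (\<Sum>e\<in>J. if e = a then cnj (cinner e x) else 0)"
      unfolding cinner_sum_left
      by (intro sum.cong) (use assms step in \<open>auto simp: orthonormal_def cinner_scaleC_left\<close>)
    also have "\<dots> = cinner x a" using assms step by (simp add: cinner_commute [of x a])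
    finally show ?case using step by (simp add: cinner_simps)
  qed simp
  then show "cinner (x - ?P) y = 0" if "y \<in> complex_vector.span J" using that .
  have "?P \<in> complex_vector.span J"
    by (intro complex_vector.span_sum complex_vector.span_scale complex_vector.span_base)
  then have "(norm (x - ?P + ?P))\<^sup>2 = (norm (x - ?P))\<^sup>2 + (norm ?P)\<^sup>2"
    by (intro pythagoras ort)
  moreover have "complex_of_real ((norm ?P)\<^sup>2) = complex_of_real (\<Sum>e\<in>J. (cmod (cinner e x))\<^sup>2)"
  proof -
    have "complex_of_real ((norm ?P)\<^sup>2) =
      (\<Sum>e\<in>J. \<Sum>a\<in>J. if a = e then cnj (cinner e x) * cinner e x else 0)"
      unfolding cinner_self [symmetric] cinner_sum_left unfolding cinner_sum_right
      by (intro sum.cong) (use assms in \<open>auto simp: orthonormal_def cinner_simps\<close>)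
    also have "\<dots> = (\<Sum>e\<in>J. complex_of_real ((cmod (cinner e x))\<^sup>2))"
      using assms(2) by (intro sum.cong refl) (simp only: complex_norm_square sum.delta', simp)
    finally show ?thesis by simp
  qed
  ultimately show "(\<Sum>e\<in>J. (cmod (cinner e x))\<^sup>2) \<le> (norm x)\<^sup>2"
    using zero_le_power2 [of "norm (x - ?P)"] unfolding of_real_eq_iff by simp
qed

text \<open>Density gives a finite combination \<open>y\<close> close to \<open>x\<close>. For every
  finite \<open>J\<close> containing its support, the partial sum over \<open>J\<close> is the
  projection of \<open>x\<close> onto the span of \<open>J\<close>, hence at least as close to
  \<open>x\<close> as \<open>y\<close>.\<close>

lemma orthonormal_expansion:
  fixes H :: "'h::complex_inner set"
  assumes B: "orthonormal_basis H B" and x: "x \<in> H"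
  shows "((\<lambda>e. cinner e x *\<^sub>C e) has_sum x) B"
  unfolding has_sum_def tendsto_iff eventually_finite_subsets_at_top
proof (intro allI impI)
  fix \<epsilon> :: real assume "\<epsilon> > 0"
  have ons: "orthonormal B" using B by (auto simp: orthonormal_basis_def orthonormal_def)
  have "x \<in> closure (complex_vector.span B)" using B x by (auto simp: orthonormal_basis_def)
  then obtain y where y: "y \<in> complex_vector.span B" "dist y x < \<epsilon>"
    using \<open>\<epsilon> > 0\<close> by (auto simp: closure_approachable)
  obtain J0 r where J0: "finite J0" "J0 \<subseteq> B" and "y = (\<Sum>a\<in>J0. r a *\<^sub>C a)"
    using y(1) unfolding complex_vector.span_explicit by blast
  then have yJ0: "y \<in> complex_vector.span J0"
    by (simp add: complex_vector.span_sum complex_vector.span_scale complex_vector.span_base)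
  have "dist (\<Sum>e\<in>J. cinner e x *\<^sub>C e) x < \<epsilon>" if J: "finite J" "J0 \<subseteq> J" "J \<subseteq> B" for J
  proof -
    let ?P = "\<Sum>e\<in>J. cinner e x *\<^sub>C e"
    have oJ: "orthonormal J" using ons J(3) by (auto simp: orthonormal_def subset_iff)
    have "y \<in> complex_vector.span J" using yJ0 complex_vector.span_mono [OF J(2)] by blast
    moreover have "?P \<in> complex_vector.span J"
      by (intro complex_vector.span_sum complex_vector.span_scale complex_vector.span_base)
    ultimately have "cinner (x - ?P) (?P - y) = 0"
      by (intro bessel_finite [OF oJ J(1)] complex_vector.span_diff)
    from pythagoras [OF this] have "(norm (x - ?P))\<^sup>2 \<le> (norm (x - y))\<^sup>2" by simp
    then have "dist x ?P \<le> dist x y" unfolding dist_norm by (rule power2_le_imp_le) simp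
    then show ?thesis using y(2) by (simp only: dist_commute [of _ x])
  qed
  with J0(1,2) show "\<exists>X. finite X \<and> X \<subseteq> B \<and>
      (\<forall>Y. finite Y \<and> X \<subseteq> Y \<and> Y \<subseteq> B \<longrightarrow> dist (\<Sum>e\<in>Y. cinner e x *\<^sub>C e) x < \<epsilon>)"
    by (intro exI [of _ J0]) simp
qed

lemma parseval:
  fixes H :: "'h::complex_inner set"
  assumes "orthonormal_basis H B" "x \<in> H"
  shows "((\<lambda>e. cinner y e * cinner e x) has_sum cinner y x) B"
  using has_sum_bounded_linear [OF bounded_linear_cinner_right orthonormal_expansion [OF assms], of y]
  by (simp add: o_def cinner_scaleC_right mult.commute)

text \<open>The definition is a \<open>THE\<close>, so unfolding it takes existence, by Riesz for
  each \<open>y\<close>, and uniqueness. For the latter the convention that operators vanish outside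
  their domain matters.\<close>

lemma adjoint_op:
  fixes T :: "'h::complex_inner \<Rightarrow> 'h"
  assumes H1: "complex_vector.subspace H1" "complete H1"
    and H2: "complex_vector.subspace H2" and T: "T \<in> bounded_ops H1 H2"
  shows "adjoint_op H1 H2 T \<in> bounded_ops H2 H1"
    and "\<And>x y. x \<in> H1 \<Longrightarrow> y \<in> H2 \<Longrightarrow> cinner (T x) y = cinner x (adjoint_op H1 H2 T y)"
proof -
  let ?Q = "\<lambda>S. S \<in> bounded_ops H2 H1 \<and> (\<forall>x\<in>H1. \<forall>y\<in>H2. cinner (T x) y = cinner x (S y))"
  obtain K where K: "K \<ge> 0" "\<And>x. x \<in> H1 \<Longrightarrow> norm (T x) \<le> K * norm x"
    using bounded_ops_bound [OF T] by blast
  note D = bounded_opsD [OF T]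
  have "\<exists>k\<in>H1. \<forall>x\<in>H1. cinner y (T x) = cinner k x" for y
  proof (rule riesz_representation [OF H1, of _ "norm y * K"])
    show "clinear_on H1 (\<lambda>x. cinner y (T x))"
      using clinear_onD [OF D(3)] by (auto simp: clinear_on_def cinner_simps scaleC_complex_def)
    show "cmod (cinner y (T x)) \<le> norm y * K * norm x" if "x \<in> H1" for x
      using order_trans [OF complex_cauchy_schwarz mult_left_mono [OF K(2) [OF that] norm_ge_zero]]
      by (simp add: mult.assoc)
  qed
  then obtain k where k: "\<And>y. k y \<in> H1" "\<And>x y. x \<in> H1 \<Longrightarrow> cinner y (T x) = cinner (k y) x" by metis
  define S where "S = (\<lambda>y. if y \<in> H2 then k y else 0)"
  have eqI: "a = b" if "a \<in> H1" "b \<in> H1" "\<And>x. x \<in> H1 \<Longrightarrow> cinner a x = cinner b x" for a b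
  proof -
    have "cinner (a - b) (a - b) = 0"
      unfolding cinner_diff_left [of a b "a - b"]
      using that(3) [OF complex_vector.subspace_diff [OF H1(1) that(1,2)]] by simp
    then show ?thesis by (simp only: cinner_self_eq_0 right_minus_eq)
  qed
  have S: "cinner (T x) y = cinner x (S y)" if "x \<in> H1" "y \<in> H2" for x y
    using arg_cong [OF k(2) [OF that(1), of y], of cnj] that(2)
    unfolding S_def by (simp add: cinner_commute [symmetric])
  have "S \<in> bounded_ops H2 H1"
  proof (rule bounded_opsI [where K = K])
    fix x y assume xy: "x \<in> H2" "y \<in> H2"
    have "k (x + y) = k x + k y"
      by (rule eqI [OF k(1) complex_vector.subspace_add [OF H1(1) k(1) k(1)]])
        (simp add: cinner_add_left k(2) [symmetric])
    then show "S (x + y) = S x + S y"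
      using xy complex_vector.subspace_add [OF H2 xy] by (simp add: S_def)
  next
    fix c x assume x: "x \<in> H2"
    have "k (c *\<^sub>C x) = c *\<^sub>C k x"
      by (rule eqI [OF k(1) complex_vector.subspace_scale [OF H1(1) k(1)]])
        (simp add: cinner_scaleC_left k(2) [symmetric])
    then show "S (c *\<^sub>C x) = c *\<^sub>C S x"
      using x complex_vector.subspace_scale [OF H2 x] by (simp add: S_def)
  next
    fix y assume y: "y \<in> H2"
    then have kS: "S y \<in> H1" by (simp add: S_def k(1))
    have "(norm (S y))\<^sup>2 = cmod (cinner (S y) (S y))"
      by (simp only: cinner_self norm_of_real abs_power2)
    also have "\<dots> = cmod (cinner (T (S y)) y)" by (simp add: S [OF kS y])
    also have "\<dots> \<le> norm (T (S y)) * norm y" by (rule complex_cauchy_schwarz)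
    also have "\<dots> \<le> K * norm (S y) * norm y" by (intro mult_right_mono K(2) kS) simp
    finally have "norm (S y) * norm (S y) \<le> norm (S y) * (K * norm y)"
      by (simp add: power2_eq_square algebra_simps)
    then show "norm (S y) \<le> K * norm y"
      using K(1) by (cases "S y = 0") (simp_all add: mult_le_cancel_left)
  qed (auto simp: S_def k(1))
  with S have QS: "?Q S" by blast
  have "?Q (THE S. ?Q S)"
  proof (rule theI [where P = ?Q, OF QS])
    fix S' assume Q: "?Q S'"
    show "S' = S"
    proof
      fix y
      show "S' y = S y"
      proof (cases "y \<in> H2")
        case True
        have in1: "S' y \<in> H1" "S y \<in> H1" using Q True k(1) by (auto simp: S_def bounded_ops_def)
        have "cinner x (S' y) = cinner x (S y)" if "x \<in> H1" for x
          using Q S [OF that True] True that by auto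
        then have "cinner (S' y) x = cinner (S y) x" if "x \<in> H1" for x
          using that cinner_commute [of "S' y" x] cinner_commute [of "S y" x] by simp
        then show ?thesis by (rule eqI [OF in1])
      next
        case False
        then show ?thesis using Q by (auto simp: S_def bounded_ops_def)
      qed
    qed
  qed
  then show "adjoint_op H1 H2 T \<in> bounded_ops H2 H1"
    and "\<And>x y. x \<in> H1 \<Longrightarrow> y \<in> H2 \<Longrightarrow> cinner (T x) y = cinner x (adjoint_op H1 H2 T y)"
    unfolding adjoint_op_def by auto
qed

section \<open>Singular value decomposition of compact operators\<close>

lemma norm_sum_orthogonal:
  fixes f :: "'i \<Rightarrow> 'h::complex_inner"
  assumes "finite A" "\<And>i j. i \<in> A \<Longrightarrow> j \<in> A \<Longrightarrow> i \<noteq> j \<Longrightarrow> cinner (f i) (f j) = 0"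
  shows "(norm (\<Sum>i\<in>A. f i))\<^sup>2 = (\<Sum>i\<in>A. (norm (f i))\<^sup>2)"
  using assms
proof (induction A rule: finite_induct)
  case (insert a A)
  have "cinner (f a) (\<Sum>i\<in>A. f i) = 0"
    unfolding cinner_sum_right using insert by (intro sum.neutral) auto
  with insert show ?case by (simp add: pythagoras)
qed simp

lemma orthonormal_independent:
  assumes "orthonormal A"
  shows "\<not> complex_vector.dependent A"
  unfolding complex_vector.independent_explicit_module
proof (intro allI impI)
  fix t u w assume *: "finite t" "t \<subseteq> A" "(\<Sum>x\<in>t. u x *\<^sub>C x) = 0" "w \<in> t"
  have "cinner w (\<Sum>x\<in>t. u x *\<^sub>C x) = (\<Sum>x\<in>t. if w = x then u x else 0)"
    unfolding cinner_sum_right cinner_scaleC_right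
    by (intro sum.cong refl) (use assms * in \<open>auto simp: orthonormal_def subset_iff\<close>)
  with * show "u w = 0" by simp
qed

lemma compact_op_subseq_convergent:
  assumes "compact_op H T"
  shows "subseq_convergent_on H T"
  unfolding subseq_convergent_on_def
proof (intro allI impI)
  fix x :: "nat \<Rightarrow> 'a" assume "\<forall>k. x k \<in> H \<and> norm (x k) \<le> 1"
  then have "\<forall>k. T (x k) \<in> closure (T ` {x\<in>H. norm x \<le> 1})"
    using closure_subset by (auto intro!: subsetD [OF closure_subset])
  then obtain l r where "strict_mono r" "((\<lambda>k. T (x k)) \<circ> r) \<longlonglongrightarrow> l"
    using compact_imp_seq_compact [OF assms [unfolded compact_op_def]]
    unfolding seq_compact_def by meson
  then show "\<exists>r l. strict_mono r \<and> (\<lambda>k. T (x (r k))) \<longlonglongrightarrow> l" by (auto simp: o_def)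
qed

locale singular_system =
  fixes H1 H2 :: "'h::complex_inner set" and T :: "'h \<Rightarrow> 'h" and v :: "nat \<Rightarrow> 'h"
  assumes H1: "complex_vector.subspace H1" "complete H1"
    and H2: "complex_vector.subspace H2"
    and T: "T \<in> bounded_ops H1 H2"
    and v_in: "v n \<in> H1"
    and v_orth: "i \<noteq> j \<Longrightarrow> cinner (v i) (v j) = 0"
    and v_norm: "norm (v n) = 1 \<or> v n = 0"
    and v_ker: "T (v n) = 0 \<Longrightarrow> v n = 0"
    and v_eigen: "x \<in> H1 \<Longrightarrow>
      cinner (T (v n)) (T x) = complex_of_real ((norm (T (v n)))\<^sup>2) * cinner (v n) x"
    and v_max: "x \<in> H1 \<Longrightarrow> (\<And>i. i < n \<Longrightarrow> cinner (v i) x = 0) \<Longrightarrow>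
      norm (T x) \<le> norm (T (v n)) * norm x"
    and sv_tendsto: "(\<lambda>n. norm (T (v n))) \<longlonglongrightarrow> 0"

lemma orthogonal_residual:
  fixes v :: "nat \<Rightarrow> 'h::complex_inner"
  assumes "\<And>i j. i < n \<Longrightarrow> j < n \<Longrightarrow> i \<noteq> j \<Longrightarrow> cinner (v i) (v j) = 0"
    and "\<And>i. i < n \<Longrightarrow> norm (v i) = 1 \<or> v i = 0" and "i < n"
  shows "cinner (v i) (x - (\<Sum>k<n. cinner (v k) x *\<^sub>C v k)) = 0"
proof -
  have "cinner (v i) (\<Sum>k<n. cinner (v k) x *\<^sub>C v k) = (\<Sum>k<n. if i = k then cinner (v k) x else 0)"
    unfolding cinner_sum_right
  proof (intro sum.cong refl)
    fix k assume k: "k \<in> {..<n}"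
    show "cinner (v i) (cinner (v k) x *\<^sub>C v k) = (if i = k then cinner (v k) x else 0)"
      using assms(1) [of i k] assms(2) [OF assms(3)] assms(3) k
      by (auto simp: cinner_scaleC_right cinner_self)
  qed
  then show ?thesis using assms(3) by (simp add: cinner_diff_right)
qed

text \<open>The space \<open>K v n\<close> depends on all earlier choices, hence the choice by
  well-founded recursion. Stationarity of each maximiser makes the images \<open>T (v n)\<close>
  orthogonal as well; if their norms did not tend to 0, all of them would stay above some
  \<epsilon>, and no subsequence of the images could be Cauchy.\<close>

lemma singular_system_exists:
  fixes T :: "'h::complex_inner \<Rightarrow> 'h"
  assumes H1: "complex_vector.subspace H1" "complete H1" and H2: "complex_vector.subspace H2"
    and T: "T \<in> bounded_ops H1 H2" and cpt: "subseq_convergent_on H1 T"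
  obtains v where "singular_system H1 H2 T v"
proof -
  define K where "K = (\<lambda>v (n::nat). {x\<in>H1. \<forall>i<n. cinner (v i) x = 0})"
  have K: "complex_vector.subspace (K v n)" for v n
    unfolding complex_vector.subspace_def K_def using H1(1)
    by (auto simp: cinner_simps complex_vector.subspace_0 complex_vector.subspace_add
        complex_vector.subspace_scale)
  have cK: "complete (K v n)" for v n
  proof -
    have "closed {x. cinner (v i) x = 0}" for i
      by (intro closed_Collect_eq continuous_intros
          bounded_linear.continuous_on [OF bounded_linear_cinner_right])
    then have "closed (\<Inter>i\<in>{..<n}. {x. cinner (v i) x = 0})" by (intro closed_INT) auto
    with H1(2) have "complete (H1 \<inter> (\<Inter>i\<in>{..<n}. {x. cinner (v i) x = 0}))"
      by (rule complete_Int_closed)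
    moreover have "K v n = H1 \<inter> (\<Inter>i\<in>{..<n}. {x. cinner (v i) x = 0})" by (auto simp: K_def)
    ultimately show ?thesis by simp
  qed
  have KH: "K v n \<subseteq> H1" for v n by (auto simp: K_def)
  obtain B where B: "\<And>x. x \<in> H1 \<Longrightarrow> norm (T x) \<le> B * norm x"
    using bounded_ops_bound [OF T] by blast
  have lin: "clinear_on (K v n) T" for v n
    using bounded_opsD(3) [OF T] KH [of v n] by (auto simp: clinear_on_def subset_iff)
  have cptK: "subseq_convergent_on (K v n) T" for v n
    using cpt KH [of v n] by (auto simp: subseq_convergent_on_def subset_iff)
  let ?P = "\<lambda>v n w. w \<in> K v n \<and> (\<forall>x\<in>K v n. norm (T x) \<le> norm (T w) * norm x) \<and>
    (T w = 0 \<longrightarrow> w = 0) \<and> (norm w = 1 \<or> w = 0)"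
  have "\<exists>v. \<forall>n. ?P v n (v n)"
  proof (rule dependent_wellorder_choice)
    fix w and f g :: "nat \<Rightarrow> 'h" and n assume "\<And>m::nat. m < n \<Longrightarrow> f m = g m"
    then have "K f n = K g n" by (auto simp: K_def)
    then show "?P f n w = ?P g n w" by simp
  next
    fix n v
    obtain w where "w \<in> K v n" "\<And>x. x \<in> K v n \<Longrightarrow> norm (T x) \<le> norm (T w) * norm x"
      "T w = 0 \<Longrightarrow> w = 0" "norm w = 1 \<or> w = 0"
    proof (rule norm_attained [OF K [of v n] cK [of v n] lin [of v n] _ cptK [of v n]])
      show "norm (T x) \<le> B * norm x" if "x \<in> K v n" for x using B KH that by blast
    qed blast
    then show "\<exists>w. ?P v n w" by blast
  qed
  then obtain v where v: "\<And>n. v n \<in> K v n"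
    "\<And>n x. x \<in> K v n \<Longrightarrow> norm (T x) \<le> norm (T (v n)) * norm x"
    "\<And>n. T (v n) = 0 \<Longrightarrow> v n = 0" "\<And>n. norm (v n) = 1 \<or> v n = 0" by blast
  have v_in: "v n \<in> H1" for n using v(1) KH by blast
  have orth_less: "cinner (v i) (v j) = 0" if "i < j" for i j
    using v(1) [of j] that by (simp add: K_def)
  have orth: "cinner (v i) (v j) = 0" if "i \<noteq> j" for i j
    using orth_less [of i j] orth_less [of j i] cinner_swap_0 that by (metis nat_neq_iff)
  have crit: "cinner (T (v n)) (T x) = 0" if "x \<in> K v n" "cinner (v n) x = 0" for n x
    by (rule maximiser_orthogonal [OF K lin v(1) v(4) that v(2)])
  have Torth_less: "cinner (T (v i)) (T (v j)) = 0" if "i < j" for i j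
    using crit [of "v j" i] orth_less [OF that] v_in orth_less that by (auto simp: K_def)
  have Torth: "cinner (T (v i)) (T (v j)) = 0" if "i \<noteq> j" for i j
    using Torth_less [of i j] Torth_less [of j i] cinner_swap_0 that by (metis nat_neq_iff)
  note lin1 = bounded_opsD(3) [OF T]
  have eigen: "cinner (T (v n)) (T x) = complex_of_real ((norm (T (v n)))\<^sup>2) * cinner (v n) x"
    if x: "x \<in> H1" for n x
  proof -
    \<comment> \<open>All \<open>Suc n\<close> components up to \<open>v n\<close> are removed: the
      rest then lies in \<open>K v n\<close> and is also orthogonal to \<open>v n\<close>, as
      \<open>crit\<close> demands.\<close>
    define P where "P = (\<Sum>k<Suc n. cinner (v k) x *\<^sub>C v k)"
    have P: "P \<in> H1" unfolding P_def
      by (intro complex_vector.subspace_sum complex_vector.subspace_scale H1 v_in)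
    have z: "x - P \<in> H1" by (intro complex_vector.subspace_diff H1 x P)
    have zorth: "cinner (v i) (x - P) = 0" if "i < Suc n" for i
      unfolding P_def by (rule orthogonal_residual) (use orth v(4) that in auto)
    then have "x - P \<in> K v n" "cinner (v n) (x - P) = 0" using z by (auto simp: K_def)
    from crit [OF this] have "cinner (T (v n)) (T x) = cinner (T (v n)) (T P)"
      by (simp add: clinear_on_diff [OF lin1 H1(1) x P] cinner_diff_right)
    also have "T P = (\<Sum>k<Suc n. cinner (v k) x *\<^sub>C T (v k))"
      unfolding P_def
      by (subst clinear_on_sum [OF lin1 H1(1)])
        (auto simp: clinear_onD [OF lin1] v_in complex_vector.subspace_scale [OF H1(1)] simp del: sum.lessThan_Suc)
    also have "cinner (T (v n)) \<dots> = (\<Sum>k<Suc n. if k = n then cinner (v n) x * cinner (T (v n)) (T (v n)) else 0)"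
      unfolding cinner_sum_right
      by (intro sum.cong refl) (auto simp: cinner_scaleC_right Torth)
    finally show ?thesis by (simp add: cinner_self)
  qed
  have decr: "norm (T (v (Suc n))) \<le> norm (T (v n))" for n
  proof -
    have "v (Suc n) \<in> K v n" using v(1) [of "Suc n"] by (auto simp: K_def)
    from v(2) [OF this] v(4) [of "Suc n"] show ?thesis by auto
  qed
  then have dec: "norm (T (v n)) \<le> norm (T (v m))" if "m \<le> n" for m n
    using that by (rule lift_Suc_antimono_le [of "\<lambda>n. norm (T (v n))"])
  have "(\<lambda>n. norm (T (v n))) \<longlonglongrightarrow> 0"
  proof (rule ccontr)
    assume n0: "\<not> (\<lambda>n. norm (T (v n))) \<longlonglongrightarrow> 0"
    obtain \<epsilon> where \<epsilon>: "\<epsilon> > 0" "\<And>n. norm (T (v n)) \<ge> \<epsilon>"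
    proof -
      obtain \<epsilon> where \<epsilon>: "\<epsilon> > 0" "\<And>N. \<exists>n\<ge>N. norm (T (v n)) \<ge> \<epsilon>"
        using n0 unfolding LIMSEQ_def by (auto simp: not_less)
      then have "norm (T (v n)) \<ge> \<epsilon>" for n using dec by (meson order_trans)
      with \<epsilon>(1) show thesis by (rule that)
    qed
    have "norm (v k) \<le> 1" for k using v(4) [of k] by auto
    then obtain r l where r: "strict_mono r" "(\<lambda>k. T (v (r k))) \<longlonglongrightarrow> l"
      using cpt v_in unfolding subseq_convergent_on_def by blast
    then have "Cauchy (\<lambda>k. T (v (r k)))" by (auto intro: LIMSEQ_imp_Cauchy)
    then obtain N where N: "dist (T (v (r N))) (T (v (r (Suc N)))) < \<epsilon>"
      using \<epsilon>(1) unfolding Cauchy_def by (meson le_SucI order_refl)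
    have "r N \<noteq> r (Suc N)" using r(1) by (metis n_not_Suc_n strict_mono_eq)
    then have "(norm (T (v (r N)) + - T (v (r (Suc N)))))\<^sup>2 =
      (norm (T (v (r N))))\<^sup>2 + (norm (- T (v (r (Suc N)))))\<^sup>2"
      by (intro pythagoras) (simp add: cinner_minus Torth)
    then have "(norm (T (v (r N))))\<^sup>2 \<le> (dist (T (v (r N))) (T (v (r (Suc N)))))\<^sup>2"
      by (simp add: dist_norm)
    then have "norm (T (v (r N))) \<le> dist (T (v (r N))) (T (v (r (Suc N))))"
      by (rule power2_le_imp_le) simp
    with N \<epsilon>(2) [of "r N"] show False by simp
  qed
  with H1 H2 T v_in orth v(3,4) eigen v(2) have "singular_system H1 H2 T v"
    unfolding singular_system_def by (auto simp: K_def)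
  then show thesis by (rule that)
qed

section \<open>Truncation, expansion and multiplicities of singular values\<close>

context singular_system
begin

lemma T_linear: "clinear_on H1 T"
  by (rule bounded_opsD(3) [OF T])

lemma Tv_in: "T (v n) \<in> H2"
  by (rule bounded_opsD(1) [OF T v_in])

lemma Tv_orth: "i \<noteq> j \<Longrightarrow> cinner (T (v i)) (T (v j)) = 0"
  using v_eigen [OF v_in] v_orth by simp

lemma sv_antimono: "m \<le> n \<Longrightarrow> norm (T (v n)) \<le> norm (T (v m))"
proof -
  assume "m \<le> n"
  then have "cinner (v i) (v n) = 0" if "i < m" for i using v_orth that by simp
  from v_max [OF v_in this, of m] v_norm [of n] show ?thesis by auto
qed

lemma v_norm1: "T (v n) \<noteq> 0 \<Longrightarrow> norm (v n) = 1"
  using v_norm [of n] clinear_on_0 [OF T_linear H1(1)] by auto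

text \<open>The residual of \<open>x\<close> after removal of the first \<open>n\<close> components
  is no longer than \<open>x\<close>, and \<open>v_max\<close> bounds \<open>T\<close> on it. This
  is one half of the identification of singular values with approximation errors;
  \<open>singular_value_le_error\<close> is the other.\<close>

lemma truncation_error:
  assumes x: "x \<in> H1"
  shows "norm (T x - (\<Sum>k<n. cinner (v k) x *\<^sub>C T (v k))) \<le> norm (T (v n)) * norm x"
proof -
  define P where "P = (\<Sum>k<n. cinner (v k) x *\<^sub>C v k)"
  have P: "P \<in> H1" unfolding P_def
    by (intro complex_vector.subspace_sum complex_vector.subspace_scale H1 v_in)
  have z: "x - P \<in> H1" by (intro complex_vector.subspace_diff H1 x P)
  have zorth: "cinner (v i) (x - P) = 0" if "i < n" for i
    unfolding P_def by (rule orthogonal_residual) (use v_orth v_norm that in auto)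
  have "cinner (v k) (x - P) = 0 \<Longrightarrow> cinner (x - P) (cinner (v k) x *\<^sub>C v k) = 0" for k
    using cinner_swap_0 [of "x - P" "v k"] by (simp add: cinner_scaleC_right)
  then have "cinner (x - P) P = 0"
    using zorth by (subst P_def, subst cinner_sum_right) (intro sum.neutral, auto)
  from pythagoras [OF this] have "(norm (x - P))\<^sup>2 \<le> (norm x)\<^sup>2" by simp
  then have le: "norm (x - P) \<le> norm x" by (rule power2_le_imp_le) simp
  have "T P = (\<Sum>k<n. cinner (v k) x *\<^sub>C T (v k))"
    unfolding P_def by (subst clinear_on_sum [OF T_linear H1(1)])
      (auto simp: clinear_onD [OF T_linear] v_in complex_vector.subspace_scale [OF H1(1)])
  then have "norm (T x - (\<Sum>k<n. cinner (v k) x *\<^sub>C T (v k))) = norm (T (x - P))"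
    by (simp add: clinear_on_diff [OF T_linear H1(1) x P])
  also have "\<dots> \<le> norm (T (v n)) * norm (x - P)"
    by (rule v_max [OF z zorth])
  also have "\<dots> \<le> norm (T (v n)) * norm x"
    by (intro mult_left_mono le) simp
  finally show ?thesis .
qed

lemma T_sums:
  assumes "x \<in> H1"
  shows "(\<lambda>k. cinner (v k) x *\<^sub>C T (v k)) sums T x"
  unfolding sums_def
proof (rule LIM_zero_cancel, rule Lim_null_comparison)
  show "(\<lambda>n. norm (T (v n)) * norm x) \<longlonglongrightarrow> 0"
    by (rule tendsto_mult_left_zero [OF sv_tendsto])
  show "\<forall>\<^sub>F n in sequentially. norm ((\<Sum>k<n. cinner (v k) x *\<^sub>C T (v k)) - T x) \<le> norm (T (v n)) * norm x"
    using truncation_error [OF assms] by (simp add: norm_minus_commute)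
qed

lemma finite_sv: "\<sigma> > 0 \<Longrightarrow> finite {n. norm (T (v n)) = \<sigma>}"
proof -
  assume "\<sigma> > 0"
  from order_tendstoD(2) [OF sv_tendsto this] obtain N where
    "\<And>n. n \<ge> N \<Longrightarrow> norm (T (v n)) < \<sigma>" by (auto simp: eventually_sequentially)
  then have "{n. norm (T (v n)) = \<sigma>} \<subseteq> {..<N}" by (force simp: not_le)
  then show ?thesis by (rule finite_subset) simp
qed

text \<open>An eigenvector for \<sigma> has no component along a \<open>v n\<close> with a different
  singular value. Subtract its components before an index \<open>N\<close> with
  \<open>norm (T (v N)) < \<sigma>\<close>: the rest is again an eigenvector, so \<open>T\<close>
  stretches it by \<sigma>, but by \<open>v_max\<close> only by less than \<sigma>, hence it is
  0.\<close>

lemma eigenspace_eq: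
  assumes \<sigma>: "\<sigma> > 0"
  shows "{x\<in>H1. \<forall>z\<in>H1. cinner (T z) (T x) = complex_of_real (\<sigma>\<^sup>2) * cinner z x}
    = complex_vector.span (v ` {n. norm (T (v n)) = \<sigma>})" (is "?E = complex_vector.span ?V")
proof
  have subE: "complex_vector.subspace ?E"
    unfolding complex_vector.subspace_def using H1(1) clinear_onD [OF T_linear] clinear_on_0 [OF T_linear H1(1)]
    by (auto simp: cinner_simps complex_vector.subspace_0 complex_vector.subspace_add
        complex_vector.subspace_scale distrib_left mult.left_commute)
  have vE: "v n \<in> ?E" if "norm (T (v n)) = \<sigma>" for n
  proof -
    have "cinner (T z) (T (v n)) = complex_of_real (\<sigma>\<^sup>2) * cinner z (v n)" if z: "z \<in> H1" for z
      using arg_cong [OF v_eigen [OF z, of n], of cnj] \<open>norm (T (v n)) = \<sigma>\<close>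
      by (simp add: cinner_commute [symmetric])
    then show ?thesis using v_in by simp
  qed
  then show "complex_vector.span ?V \<subseteq> ?E"
    by (intro complex_vector.span_minimal subE) auto
  show "?E \<subseteq> complex_vector.span ?V"
  proof
    fix x assume x: "x \<in> ?E"
    then have xH: "x \<in> H1" by simp
    from order_tendstoD(2) [OF sv_tendsto \<sigma>] obtain N where
      N: "norm (T (v N)) < \<sigma>" by (auto simp: eventually_sequentially)
    have coeff: "cinner (v n) x = 0" if "norm (T (v n)) \<noteq> \<sigma>" for n
    proof -
      have "complex_of_real ((norm (T (v n)))\<^sup>2) * cinner (v n) x = complex_of_real (\<sigma>\<^sup>2) * cinner (v n) x"
        using x v_in v_eigen [OF xH, of n] by auto
      moreover have "complex_of_real ((norm (T (v n)))\<^sup>2) \<noteq> complex_of_real (\<sigma>\<^sup>2)"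
        using that \<sigma> unfolding of_real_eq_iff by (simp add: power2_eq_iff_nonneg)
      ultimately show ?thesis by simp
    qed
    define P where "P = (\<Sum>k<N. cinner (v k) x *\<^sub>C v k)"
    have P: "P \<in> complex_vector.span ?V" unfolding P_def
    proof (intro complex_vector.span_sum)
      fix k show "cinner (v k) x *\<^sub>C v k \<in> complex_vector.span ?V"
        by (cases "norm (T (v k)) = \<sigma>")
          (simp_all add: coeff complex_vector.span_zero complex_vector.span_scale complex_vector.span_base)
    qed
    then have PE: "P \<in> ?E" using \<open>complex_vector.span ?V \<subseteq> ?E\<close> by blast
    have z: "x - P \<in> ?E" using complex_vector.subspace_diff [OF subE x PE] .
    have "cinner (v i) (x - P) = 0" if "i < N" for i
      unfolding P_def by (rule orthogonal_residual) (use v_orth v_norm that in auto)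
    with z have le: "norm (T (x - P)) \<le> norm (T (v N)) * norm (x - P)" by (intro v_max) auto
    have "cinner (T (x - P)) (T (x - P)) = complex_of_real (\<sigma>\<^sup>2) * cinner (x - P) (x - P)"
      using z by blast
    then have "(norm (T (x - P)))\<^sup>2 = (\<sigma> * norm (x - P))\<^sup>2"
      unfolding cinner_self of_real_mult [symmetric] of_real_eq_iff by (simp add: power_mult_distrib)
    then have "norm (T (x - P)) = \<sigma> * norm (x - P)"
      using \<sigma> by (simp add: power2_eq_iff_nonneg)
    with le N have "norm (x - P) = 0"
      by (auto simp: mult_le_cancel_right)
    with P show "x \<in> complex_vector.span ?V" by simp
  qed
qed

text \<open>Testing the weak eigenvalue equation against the defect \<open>y\<close> gives the
  equation with the adjoint. The spanning vectors of the eigenspace are orthonormal, so the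
  dimension is their number.\<close>

lemma singular_mult_eq:
  assumes \<sigma>: "\<sigma> > 0"
  shows "singular_mult H1 H2 T \<sigma> = card {n. norm (T (v n)) = \<sigma>}"
proof -
  let ?V = "v ` {n. norm (T (v n)) = \<sigma>}"
  note adj = adjoint_op [OF H1 H2 T]
  have "{x\<in>H1. adjoint_op H1 H2 T (T x) = complex_of_real (\<sigma>\<^sup>2) *\<^sub>C x}
    = {x\<in>H1. \<forall>z\<in>H1. cinner (T z) (T x) = complex_of_real (\<sigma>\<^sup>2) * cinner z x}"
  proof (intro Collect_cong conj_cong refl)
    fix x assume x: "x \<in> H1"
    define y where "y = adjoint_op H1 H2 T (T x) - complex_of_real (\<sigma>\<^sup>2) *\<^sub>C x"
    have Tx: "T x \<in> H2" using bounded_opsD(1) [OF T x] .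
    have y: "y \<in> H1" unfolding y_def
      by (intro complex_vector.subspace_diff complex_vector.subspace_scale H1 x bounded_opsD(1) [OF adj(1) Tx])
    have *: "cinner z y = cinner (T z) (T x) - complex_of_real (\<sigma>\<^sup>2) * cinner z x" if "z \<in> H1" for z
      unfolding y_def cinner_diff_right cinner_scaleC_right by (simp add: adj(2) [OF that Tx])
    have "adjoint_op H1 H2 T (T x) = complex_of_real (\<sigma>\<^sup>2) *\<^sub>C x \<longleftrightarrow> y = 0" by (simp add: y_def)
    also have "\<dots> \<longleftrightarrow> (\<forall>z\<in>H1. cinner z y = 0)" using y by (auto dest: bspec [of _ _ y])
    also have "\<dots> \<longleftrightarrow> (\<forall>z\<in>H1. cinner (T z) (T x) = complex_of_real (\<sigma>\<^sup>2) * cinner z x)"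
      using * by auto
    finally show "adjoint_op H1 H2 T (T x) = complex_of_real (\<sigma>\<^sup>2) *\<^sub>C x \<longleftrightarrow>
      (\<forall>z\<in>H1. cinner (T z) (T x) = complex_of_real (\<sigma>\<^sup>2) * cinner z x)" .
  qed
  then have dim: "singular_mult H1 H2 T \<sigma> = complex_vector.dim ?V"
    unfolding singular_mult_def eigenspace_eq [OF \<sigma>] by (simp add: complex_vector.dim_span)
  have n1: "norm (v n) = 1" if "norm (T (v n)) = \<sigma>" for n
    using v_norm1 [of n] \<sigma> that by auto
  have v_eq: "cinner (v m) (v n) = (if m = n then 1 else 0)"
    if "norm (T (v m)) = \<sigma>" "norm (T (v n)) = \<sigma>" for m n
  proof (cases "m = n")
    case True
    with n1 [OF that(1)] show ?thesis by (simp add: cinner_self)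
  qed (simp add: v_orth)
  have inj: "inj_on v {n. norm (T (v n)) = \<sigma>}"
  proof (rule inj_onI)
    fix m n assume "m \<in> {n. norm (T (v n)) = \<sigma>}" "n \<in> {n. norm (T (v n)) = \<sigma>}" "v m = v n"
    then have "cinner (v m) (v n) \<noteq> 0" using v_eq [of n n] by simp
    then show "m = n" using v_orth [of m n] by blast
  qed
  have "orthonormal ?V" unfolding orthonormal_def
  proof (intro ballI)
    fix x y assume "x \<in> ?V" "y \<in> ?V"
    then obtain m n where mn: "x = v m" "y = v n" "norm (T (v m)) = \<sigma>" "norm (T (v n)) = \<sigma>"
      by blast
    then have "x = y \<longleftrightarrow> m = n" using inj_onD [OF inj, of m n] by blast
    then show "cinner x y = (if x = y then 1 else 0)"
      unfolding mn(1,2) using v_eq [OF mn(3,4)] by simp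
  qed
  then have "complex_vector.dim ?V = card ?V"
    by (intro complex_vector.dim_eq_card_independent orthonormal_independent)
  with dim show ?thesis using card_image [OF inj] by simp
qed

lemma singular_mult_has_sum:
  assumes "\<sigma> > 0"
  shows "((\<lambda>n. norm (T (v n)) powr q) has_sum (real (singular_mult H1 H2 T \<sigma>) * \<sigma> powr q))
    {n. norm (T (v n)) = \<sigma>}"
proof -
  have "(\<Sum>n | norm (T (v n)) = \<sigma>. norm (T (v n)) powr q) = (\<Sum>n | norm (T (v n)) = \<sigma>. \<sigma> powr q)"
    by (intro sum.cong refl) auto
  with has_sum_finite [OF finite_sv [OF assms], of "\<lambda>n. norm (T (v n)) powr q"]
  show ?thesis by (simp add: singular_mult_eq [OF assms])
qed

text \<open>The sum over \<sigma> with multiplicities is a double sum over the pairs of \<sigma> and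
  \<open>n\<close> with \<open>s n = \<sigma>\<close>, in other words a sum over \<open>n\<close>.
  All terms are nonnegative, so summability passes both ways; indices with \<open>s n = 0\<close>
  contribute \<open>0 powr q = 0\<close>.\<close>

lemma schatten_iff:
  "T \<in> schatten q H1 H2 \<longleftrightarrow> compact_op H1 T \<and> summable (\<lambda>n. norm (T (v n)) powr q)"
proof -
  define s where "s = (\<lambda>n. norm (T (v n)))"
  define M where "M = (\<lambda>\<sigma>. real (singular_mult H1 H2 T \<sigma>) * \<sigma> powr q)"
  define f where "f = (\<lambda>x :: real \<times> nat. s (snd x) powr q)"
  define S where "S = (\<lambda>\<sigma>. {n. s n = \<sigma>})"
  have inner: "((\<lambda>n. f (\<sigma>, n)) has_sum M \<sigma>) (S \<sigma>)" if "\<sigma> \<in> {0<..}" for \<sigma>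
    using singular_mult_has_sum [of \<sigma> q] that by (simp add: f_def M_def S_def s_def)
  have 1: "M summable_on {0<..} \<longleftrightarrow> f summable_on Sigma {0<..} S"
  proof
    assume M: "M summable_on {0<..}"
    show "f summable_on Sigma {0<..} S"
      by (rule summable_on_SigmaI [OF inner M]) (simp_all add: f_def)
  next
    assume f: "f summable_on Sigma {0<..} S"
    have "(\<lambda>\<sigma>. infsum (\<lambda>n. f (\<sigma>, n)) (S \<sigma>)) summable_on {0<..}"
      by (rule summable_on_SigmaD [OF f]) (rule has_sum_imp_summable [OF inner])
    moreover have "(\<lambda>\<sigma>. infsum (\<lambda>n. f (\<sigma>, n)) (S \<sigma>)) summable_on {0<..} \<longleftrightarrow> M summable_on {0<..}"
      by (rule summable_on_cong) (rule infsumI [OF inner])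
    ultimately show "M summable_on {0<..}" by blast
  qed
  have bij: "bij_betw (\<lambda>n. (s n, n)) {n. s n > 0} (Sigma {0<..} S)"
    by (rule bij_betwI [of _ _ _ snd]) (auto simp: S_def)
  have 2: "(\<lambda>n. s n powr q) summable_on {n. s n > 0} \<longleftrightarrow> f summable_on Sigma {0<..} S"
    using summable_on_reindex_bij_betw [OF bij, of f] by (simp add: f_def)
  have 3: "(\<lambda>n. s n powr q) summable_on {n. s n > 0} \<longleftrightarrow> (\<lambda>n. s n powr q) summable_on UNIV"
    by (rule summable_on_cong_neutral) (auto simp: s_def)
  have 4: "(\<lambda>n. s n powr q) summable_on UNIV \<longleftrightarrow> summable (\<lambda>n. s n powr q)"
    by (rule summable_on_UNIV_nonneg_real_iff) simp
  show ?thesis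
    using T 1 2 3 4 unfolding schatten_def M_def s_def by simp
qed

end

section \<open>Operators with summable approximation errors\<close>

definition rank_form :: "('h \<Rightarrow> complex) \<times> 'h \<Rightarrow> 'h \<Rightarrow> 'h::complex_inner" where
  "rank_form p x = fst p x *\<^sub>C snd p"

text \<open>Rank at most \<open>n\<close> is witnessed by a list of functionals paired with vectors
  instead of the dimension of the range. Sums then append lists and compositions map over them, so
  ranks add without dimension theory.\<close>

definition fin_rank ::
  "'h::complex_inner set \<Rightarrow> 'h set \<Rightarrow> nat \<Rightarrow> ('h \<Rightarrow> 'h) \<Rightarrow> bool" where
  "fin_rank H1 H2 n R \<longleftrightarrow> R \<in> bounded_ops H1 H2 \<and> (\<exists>L. length L \<le> n \<and>
     (\<forall>p\<in>set L. snd p \<in> H2 \<and> clinear_on H1 (fst p) \<and>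
        (\<exists>K. \<forall>x\<in>H1. cmod (fst p x) \<le> K * norm x)) \<and>
     (\<forall>x\<in>H1. R x = (\<Sum>p\<leftarrow>L. rank_form p x)))"

lemma fin_rankD: "fin_rank H1 H2 n R \<Longrightarrow> R \<in> bounded_ops H1 H2"
  by (simp add: fin_rank_def)

lemma fin_rank_mono: "fin_rank H1 H2 m R \<Longrightarrow> m \<le> n \<Longrightarrow> fin_rank H1 H2 n R"
  unfolding fin_rank_def by (meson order_trans)

lemma fin_rank_add:
  assumes "fin_rank H1 H2 m R" "fin_rank H1 H2 n S" "complex_vector.subspace H2"
  shows "fin_rank H1 H2 (m + n) (R + S)"
proof -
  from assms(1) obtain L where L: "length L \<le> m"
    "\<forall>p\<in>set L. snd p \<in> H2 \<and> clinear_on H1 (fst p) \<and> (\<exists>K. \<forall>x\<in>H1. cmod (fst p x) \<le> K * norm x)"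
    "\<forall>x\<in>H1. R x = (\<Sum>p\<leftarrow>L. rank_form p x)"
    unfolding fin_rank_def by blast
  from assms(2) obtain M where M: "length M \<le> n"
    "\<forall>p\<in>set M. snd p \<in> H2 \<and> clinear_on H1 (fst p) \<and> (\<exists>K. \<forall>x\<in>H1. cmod (fst p x) \<le> K * norm x)"
    "\<forall>x\<in>H1. S x = (\<Sum>p\<leftarrow>M. rank_form p x)"
    unfolding fin_rank_def by blast
  have "R + S \<in> bounded_ops H1 H2"
    using assms by (intro bounded_ops_add fin_rankD)
  moreover have "length (L @ M) \<le> m + n" using L(1) M(1) by simp
  moreover have "\<forall>p\<in>set (L @ M). snd p \<in> H2 \<and> clinear_on H1 (fst p) \<and>
      (\<exists>K. \<forall>x\<in>H1. cmod (fst p x) \<le> K * norm x)"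
    using L(2) M(2) unfolding set_append by blast
  moreover have "\<forall>x\<in>H1. (R + S) x = (\<Sum>p\<leftarrow>L @ M. rank_form p x)"
    using L(3) M(3) by simp
  ultimately show ?thesis unfolding fin_rank_def by blast
qed

lemma sum_list_image_clinear:
  assumes "clinear_on H B" "complex_vector.subspace H" "\<forall>p\<in>set L. f p \<in> H"
  shows "(\<Sum>p\<leftarrow>L. f p) \<in> H \<and> B (\<Sum>p\<leftarrow>L. f p) = (\<Sum>p\<leftarrow>L. B (f p))"
  using assms(3)
proof (induction L)
  case Nil
  then show ?case using clinear_on_0 [OF assms(1,2)] complex_vector.subspace_0 [OF assms(2)] by simp
next
  case (Cons p L)
  then show ?case
    using clinear_onD(1) [OF assms(1)] complex_vector.subspace_add [OF assms(2)] by simp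
qed

lemma fin_rank_comp_left:
  assumes R: "fin_rank H1 H2 n R" and B: "B \<in> bounded_ops H2 H3"
    and H2: "complex_vector.subspace H2"
  shows "fin_rank H1 H3 n (B \<circ> R)"
proof -
  from R obtain L where L: "length L \<le> n"
    "\<forall>p\<in>set L. snd p \<in> H2 \<and> clinear_on H1 (fst p) \<and> (\<exists>K. \<forall>x\<in>H1. cmod (fst p x) \<le> K * norm x)"
    "\<forall>x\<in>H1. R x = (\<Sum>p\<leftarrow>L. rank_form p x)"
    unfolding fin_rank_def by blast
  note BD = bounded_opsD [OF B]
  define M where "M = map (\<lambda>p. (fst p, B (snd p))) L"
  have "B \<circ> R \<in> bounded_ops H1 H3" using bounded_ops_comp [OF B fin_rankD [OF R] H2] .
  moreover have "length M \<le> n" using L(1) by (simp add: M_def)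
  moreover have "\<forall>p\<in>set M. snd p \<in> H3 \<and> clinear_on H1 (fst p) \<and>
      (\<exists>K. \<forall>x\<in>H1. cmod (fst p x) \<le> K * norm x)"
    using L(2) BD(1) by (simp add: M_def)
  moreover have "\<forall>x\<in>H1. (B \<circ> R) x = (\<Sum>p\<leftarrow>M. rank_form p x)"
  proof
    fix x assume x: "x \<in> H1"
    have "B (\<Sum>p\<leftarrow>L. rank_form p x) = (\<Sum>p\<leftarrow>L. B (rank_form p x))"
      by (rule sum_list_image_clinear [OF BD(3) H2, THEN conjunct2])
        (use L(2) in \<open>simp add: rank_form_def complex_vector.subspace_scale [OF H2]\<close>)
    also have "(\<Sum>p\<leftarrow>L. B (rank_form p x)) = (\<Sum>p\<leftarrow>M. rank_form p x)"
      unfolding M_def map_map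
      by (rule arg_cong [of _ _ sum_list], rule map_cong [OF refl])
        (use L(2) clinear_onD(2) [OF BD(3)] in \<open>simp add: rank_form_def\<close>)
    finally show "(B \<circ> R) x = (\<Sum>p\<leftarrow>M. rank_form p x)" using L(3) x by simp
  qed
  ultimately show ?thesis unfolding fin_rank_def by blast
qed

lemma fin_rank_comp_right:
  assumes R: "fin_rank H2 H3 n R" and B: "B \<in> bounded_ops H1 H2"
    and H2: "complex_vector.subspace H2"
  shows "fin_rank H1 H3 n (R \<circ> B)"
proof -
  from R obtain L where L: "length L \<le> n"
    "\<forall>p\<in>set L. snd p \<in> H3 \<and> clinear_on H2 (fst p) \<and> (\<exists>K. \<forall>x\<in>H2. cmod (fst p x) \<le> K * norm x)"
    "\<forall>x\<in>H2. R x = (\<Sum>p\<leftarrow>L. rank_form p x)"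
    unfolding fin_rank_def by blast
  note BD = bounded_opsD [OF B]
  obtain K where K: "K \<ge> 0" "\<And>x. x \<in> H1 \<Longrightarrow> norm (B x) \<le> K * norm x"
    using bounded_ops_bound [OF B] by blast
  define M where "M = map (\<lambda>p. (fst p \<circ> B, snd p)) L"
  have "R \<circ> B \<in> bounded_ops H1 H3" using bounded_ops_comp [OF fin_rankD [OF R] B H2] .
  moreover have "length M \<le> n" using L(1) by (simp add: M_def)
  moreover have "\<forall>p\<in>set M. snd p \<in> H3 \<and> clinear_on H1 (fst p) \<and>
      (\<exists>K. \<forall>x\<in>H1. cmod (fst p x) \<le> K * norm x)"
  proof
    fix p' assume "p' \<in> set M"
    then obtain p where p: "p \<in> set L" "p' = (fst p \<circ> B, snd p)" by (auto simp: M_def)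
    with L(2) obtain C where C: "\<forall>x\<in>H2. cmod (fst p x) \<le> C * norm x" by blast
    have "cmod (fst p (B x)) \<le> (\<bar>C\<bar> * K) * norm x" if "x \<in> H1" for x
    proof -
      have "cmod (fst p (B x)) \<le> C * norm (B x)" using C BD(1) that by blast
      also have "\<dots> \<le> \<bar>C\<bar> * (K * norm x)"
        by (intro mult_mono K that) auto
      finally show ?thesis by (simp add: mult.assoc)
    qed
    moreover have "clinear_on H1 (fst p \<circ> B)"
      using L(2) p(1) BD(1) clinear_onD [OF BD(3)] by (simp add: clinear_on_def)
    ultimately show "snd p' \<in> H3 \<and> clinear_on H1 (fst p') \<and>
      (\<exists>K. \<forall>x\<in>H1. cmod (fst p' x) \<le> K * norm x)"
      using L(2) p by auto
  qed
  moreover have "\<forall>x\<in>H1. (R \<circ> B) x = (\<Sum>p\<leftarrow>M. rank_form p x)"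
    using L(3) BD(1) by (simp add: M_def rank_form_def o_def)
  ultimately show ?thesis unfolding fin_rank_def by blast
qed

text \<open>The number \<open>a\<close> is an upper bound for the approximation number of index
  \<open>n\<close>; no infimum is taken.\<close>

definition approximable ::
  "'h::complex_inner set \<Rightarrow> 'h set \<Rightarrow> ('h \<Rightarrow> 'h) \<Rightarrow> nat \<Rightarrow> real \<Rightarrow> bool" where
  "approximable H1 H2 T n a \<longleftrightarrow>
     (\<exists>R. fin_rank H1 H2 n R \<and> (\<forall>x\<in>H1. norm (T x - R x) \<le> a * norm x))"

lemma approximable_mono:
  assumes "approximable H1 H2 T m a" "m \<le> n"
  shows "approximable H1 H2 T n a"
  using assms fin_rank_mono unfolding approximable_def by blast

lemma approximable_add:
  assumes "approximable H1 H2 S m a" "approximable H1 H2 T n b" "complex_vector.subspace H2"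
  shows "approximable H1 H2 (S + T) (m + n) (a + b)"
proof -
  from assms(1) obtain R where R: "fin_rank H1 H2 m R" "\<forall>x\<in>H1. norm (S x - R x) \<le> a * norm x"
    unfolding approximable_def by blast
  from assms(2) obtain Q where Q: "fin_rank H1 H2 n Q" "\<forall>x\<in>H1. norm (T x - Q x) \<le> b * norm x"
    unfolding approximable_def by blast
  have "norm ((S + T) x - (R + Q) x) \<le> (a + b) * norm x" if "x \<in> H1" for x
  proof -
    have "norm ((S x - R x) + (T x - Q x)) \<le> a * norm x + b * norm x"
      using R(2) Q(2) that by (intro norm_triangle_le add_mono) auto
    then show ?thesis by (simp add: algebra_simps)
  qed
  with fin_rank_add [OF R(1) Q(1) assms(3)] show ?thesis unfolding approximable_def by blast
qed

lemma approximable_comp_left: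
  assumes "approximable H1 H2 T n a" "B \<in> bounded_ops H2 H3" "T \<in> bounded_ops H1 H2"
    "complex_vector.subspace H2" "K \<ge> 0" "\<And>x. x \<in> H2 \<Longrightarrow> norm (B x) \<le> K * norm x"
  shows "approximable H1 H3 (B \<circ> T) n (K * a)"
proof -
  from assms(1) obtain R where R: "fin_rank H1 H2 n R" "\<forall>x\<in>H1. norm (T x - R x) \<le> a * norm x"
    unfolding approximable_def by blast
  have "norm ((B \<circ> T) x - (B \<circ> R) x) \<le> (K * a) * norm x" if x: "x \<in> H1" for x
  proof -
    have in2: "T x \<in> H2" "R x \<in> H2"
      using bounded_opsD(1) [OF assms(3) x] bounded_opsD(1) [OF fin_rankD [OF R(1)] x] .
    have "norm ((B \<circ> T) x - (B \<circ> R) x) = norm (B (T x - R x))"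
      by (simp add: clinear_on_diff [OF bounded_opsD(3) [OF assms(2)] assms(4) in2])
    also have "\<dots> \<le> K * norm (T x - R x)"
      by (intro assms(6) complex_vector.subspace_diff [OF assms(4)] in2)
    also have "\<dots> \<le> K * (a * norm x)" using R(2) x by (intro mult_left_mono assms(5)) auto
    finally show ?thesis by (simp add: mult.assoc)
  qed
  with fin_rank_comp_left [OF R(1) assms(2,4)] show ?thesis unfolding approximable_def by blast
qed

text \<open>With approximants \<open>R\<close> of \<open>T\<close> and \<open>Q\<close> of \<open>S\<close> one has
  \<open>(T - R)(S - Q) = T S - (R (S - Q) + T Q)\<close>, so that errors multiply while ranks add.\<close>

lemma approximable_comp:
  assumes "approximable H2 H3 T m a" "approximable H1 H2 S n b"
    and T: "T \<in> bounded_ops H2 H3" and S: "S \<in> bounded_ops H1 H2"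
    and H2: "complex_vector.subspace H2" and H3: "complex_vector.subspace H3" and "a \<ge> 0"
  shows "approximable H1 H3 (T \<circ> S) (m + n) (a * b)"
proof -
  from assms(1) obtain R where R: "fin_rank H2 H3 m R" "\<forall>x\<in>H2. norm (T x - R x) \<le> a * norm x"
    unfolding approximable_def by blast
  from assms(2) obtain Q where Q: "fin_rank H1 H2 n Q" "\<forall>x\<in>H1. norm (S x - Q x) \<le> b * norm x"
    unfolding approximable_def by blast
  have SQ: "S - Q \<in> bounded_ops H1 H2"
    by (intro bounded_ops_diff S fin_rankD [OF Q(1)] H2)
  define P where "P = (R \<circ> (S - Q)) + (T \<circ> Q)"
  have P: "fin_rank H1 H3 (m + n) P" unfolding P_def
    by (intro fin_rank_add H3 fin_rank_comp_right [OF R(1) SQ H2] fin_rank_comp_left [OF Q(1) T H2])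
  have "norm ((T \<circ> S) x - P x) \<le> (a * b) * norm x" if x: "x \<in> H1" for x
  proof -
    have in2: "S x \<in> H2" "Q x \<in> H2"
      using bounded_opsD(1) [OF S x] bounded_opsD(1) [OF fin_rankD [OF Q(1)] x] .
    then have d: "S x - Q x \<in> H2" by (intro complex_vector.subspace_diff [OF H2])
    have "(T \<circ> S) x - P x = T (S x - Q x) - R (S x - Q x)"
      by (simp add: P_def clinear_on_diff [OF bounded_opsD(3) [OF T] H2 in2])
    also have "norm \<dots> \<le> a * norm (S x - Q x)" using R(2) d by blast
    also have "\<dots> \<le> a * (b * norm x)" using Q(2) x by (intro mult_left_mono assms) auto
    finally show ?thesis by (simp add: mult.assoc)
  qed
  with P show ?thesis unfolding approximable_def by blast
qed

text \<open>Any \<open>q\<close>-summable majorant of the approximation numbers serves, monotone or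
  not.\<close>

definition approx_class :: "real \<Rightarrow> 'h::complex_inner set \<Rightarrow> 'h set \<Rightarrow> ('h \<Rightarrow> 'h) set" where
  "approx_class q H1 H2 = {T \<in> bounded_ops H1 H2. \<exists>\<alpha>. (\<forall>n. 0 \<le> \<alpha> n \<and> approximable H1 H2 T n (\<alpha> n)) \<and>
     summable (\<lambda>n. \<alpha> n powr q)}"

lemma approx_classD: "T \<in> approx_class q H1 H2 \<Longrightarrow> T \<in> bounded_ops H1 H2"
  by (simp add: approx_class_def)

lemma approx_classE:
  assumes "T \<in> approx_class q H1 H2"
  obtains \<alpha> where "\<And>n. 0 \<le> \<alpha> n" "\<And>n. approximable H1 H2 T n (\<alpha> n)" "summable (\<lambda>n. \<alpha> n powr q)"
  using assms by (auto simp: approx_class_def)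

lemma approx_classI:
  assumes "T \<in> bounded_ops H1 H2" "\<And>n. 0 \<le> \<alpha> n" "\<And>n. approximable H1 H2 T n (\<alpha> n)"
    "summable (\<lambda>n. \<alpha> n powr q)"
  shows "T \<in> approx_class q H1 H2"
  using assms unfolding approx_class_def by blast

text \<open>Ranks add under sums and products, so an approximant of rank \<open>n\<close> is
  assembled from two of rank \<open>n div 2\<close>. Each error is thereby used twice, which at most
  doubles the sum.\<close>

lemma summable_div_2:
  fixes f :: "nat \<Rightarrow> real"
  assumes "summable f" "\<And>n. f n \<ge> 0"
  shows "summable (\<lambda>n. f (n div 2))"
proof (rule summableI_nonneg_bounded)
  fix N
  have eq: "(\<Sum>i<2 * N. f (i div 2)) = 2 * (\<Sum>i<N. f i)" for N
    by (induction N) (simp_all add: algebra_simps)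
  have "(\<Sum>i<N. f (i div 2)) \<le> (\<Sum>i<2 * N. f (i div 2))"
    by (intro sum_mono2) (auto simp: assms)
  also have "\<dots> \<le> 2 * suminf f"
    unfolding eq by (intro mult_left_mono sum_le_suminf assms) auto
  finally show "(\<Sum>i<N. f (i div 2)) \<le> 2 * suminf f" .
qed (simp add: assms)

text \<open>From \<open>a + b \<le> 2 * max a b\<close>. The crude constant is harmless for
  summability, and the estimate covers exponents below 1 as well.\<close>

lemma powr_add_le:
  fixes a b q :: real
  assumes "a \<ge> 0" "b \<ge> 0" "q \<ge> 0"
  shows "(a + b) powr q \<le> 2 powr q * (a powr q + b powr q)"
proof -
  have "(a + b) powr q \<le> (2 * max a b) powr q" using assms by (intro powr_mono2) auto
  also have "\<dots> = 2 powr q * max a b powr q" by (simp add: powr_mult)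
  also have "\<dots> \<le> 2 powr q * (a powr q + b powr q)"
    by (intro mult_left_mono) (auto simp: max_def)
  finally show ?thesis .
qed

text \<open>Young's inequality without sharp constants: if \<open>M\<close> is the larger of the two
  powers, then \<open>a \<le> M powr (1 / r)\<close> and \<open>b \<le> M powr (1 / s)\<close>, and
  the exponents add up to \<open>1 / t\<close>.\<close>

lemma powr_mult_le:
  fixes a b r s t :: real
  assumes "a \<ge> 0" "b \<ge> 0" "r > 0" "s > 0" "t > 0" "1 / t = 1 / r + 1 / s"
  shows "(a * b) powr t \<le> a powr r + b powr s"
proof -
  define M where "M = max (a powr r) (b powr s)"
  have M0: "M \<ge> 0" by (simp add: M_def max_def)
  have "a = (a powr r) powr (1 / r)" using assms by (simp add: powr_powr)
  also have "\<dots> \<le> M powr (1 / r)" using assms by (intro powr_mono2) (auto simp: M_def)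
  finally have a: "a \<le> M powr (1 / r)" .
  have "b = (b powr s) powr (1 / s)" using assms by (simp add: powr_powr)
  also have "\<dots> \<le> M powr (1 / s)" using assms by (intro powr_mono2) (auto simp: M_def)
  finally have "a * b \<le> M powr (1 / r) * M powr (1 / s)" using a assms by (intro mult_mono) auto
  also have "\<dots> = M powr (1 / t)" unfolding assms(6) by (simp add: powr_add)
  finally have "(a * b) powr t \<le> (M powr (1 / t)) powr t" using assms by (intro powr_mono2) auto
  also have "\<dots> = M" using M0 assms(5) unfolding powr_powr by simp
  also have "\<dots> \<le> a powr r + b powr s" by (auto simp: M_def max_def)
  finally show ?thesis .
qed

lemma approx_class_add:
  assumes S: "S \<in> approx_class q H1 H2" and T: "T \<in> approx_class q H1 H2"
    and H2: "complex_vector.subspace H2" and q: "q \<ge> 0"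
  shows "S + T \<in> approx_class q H1 H2"
proof -
  obtain \<alpha> where \<alpha>: "\<And>n. 0 \<le> \<alpha> n" "\<And>n. approximable H1 H2 S n (\<alpha> n)" "summable (\<lambda>n. \<alpha> n powr q)"
    using approx_classE [OF S] by metis
  obtain \<beta> where \<beta>: "\<And>n. 0 \<le> \<beta> n" "\<And>n. approximable H1 H2 T n (\<beta> n)" "summable (\<lambda>n. \<beta> n powr q)"
    using approx_classE [OF T] by metis
  show ?thesis
  proof (rule approx_classI)
    show "S + T \<in> bounded_ops H1 H2" using S T H2 by (intro bounded_ops_add approx_classD)
    show "0 \<le> \<alpha> (n div 2) + \<beta> (n div 2)" for n using \<alpha>(1) \<beta>(1) by simp
    show "approximable H1 H2 (S + T) n (\<alpha> (n div 2) + \<beta> (n div 2))" for n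
      by (rule approximable_mono [OF approximable_add [OF \<alpha>(2) \<beta>(2) H2]]) simp
    have "summable (\<lambda>n. 2 powr q * (\<alpha> (n div 2) powr q + \<beta> (n div 2) powr q))"
      by (intro summable_mult summable_add summable_div_2 [of "\<lambda>n. \<alpha> n powr q"]
          summable_div_2 [of "\<lambda>n. \<beta> n powr q"] \<alpha> \<beta>) auto
    then show "summable (\<lambda>n. (\<alpha> (n div 2) + \<beta> (n div 2)) powr q)"
      by (rule summable_comparison_test') (use powr_add_le \<alpha>(1) \<beta>(1) q in auto)
  qed
qed

lemma approx_class_comp_left:
  assumes T: "T \<in> approx_class q H1 H2" and B: "B \<in> bounded_ops H2 H3"
    and H2: "complex_vector.subspace H2"
  shows "B \<circ> T \<in> approx_class q H1 H3"
proof -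
  obtain \<alpha> where \<alpha>: "\<And>n. 0 \<le> \<alpha> n" "\<And>n. approximable H1 H2 T n (\<alpha> n)" "summable (\<lambda>n. \<alpha> n powr q)"
    using approx_classE [OF T] by metis
  obtain K where K: "K \<ge> 0" "\<And>x. x \<in> H2 \<Longrightarrow> norm (B x) \<le> K * norm x"
    using bounded_ops_bound [OF B] by blast
  show ?thesis
  proof (rule approx_classI)
    show "B \<circ> T \<in> bounded_ops H1 H3" by (rule bounded_ops_comp [OF B approx_classD [OF T] H2])
    show "0 \<le> K * \<alpha> n" for n using \<alpha>(1) K(1) by simp
    show "approximable H1 H3 (B \<circ> T) n (K * \<alpha> n)" for n
      by (rule approximable_comp_left [OF \<alpha>(2) B approx_classD [OF T] H2 K])
    show "summable (\<lambda>n. (K * \<alpha> n) powr q)"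
      unfolding powr_mult by (rule summable_mult [OF \<alpha>(3)])
  qed
qed

text \<open>Hoelder's inequality for operators. Errors multiply at the cost of adding ranks, so
  termwise use of \<open>powr_mult_le\<close> suffices.\<close>

lemma approx_class_comp:
  assumes T: "T \<in> approx_class r H2 H3" and S: "S \<in> approx_class s H1 H2"
    and H2: "complex_vector.subspace H2" and H3: "complex_vector.subspace H3"
    and q: "r > 0" "s > 0" "t > 0" "1 / t = 1 / r + 1 / s"
  shows "T \<circ> S \<in> approx_class t H1 H3"
proof -
  obtain \<alpha> where \<alpha>: "\<And>n. 0 \<le> \<alpha> n" "\<And>n. approximable H2 H3 T n (\<alpha> n)" "summable (\<lambda>n. \<alpha> n powr r)"
    using approx_classE [OF T] by metis
  obtain \<beta> where \<beta>: "\<And>n. 0 \<le> \<beta> n" "\<And>n. approximable H1 H2 S n (\<beta> n)" "summable (\<lambda>n. \<beta> n powr s)"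
    using approx_classE [OF S] by metis
  show ?thesis
  proof (rule approx_classI)
    show "T \<circ> S \<in> bounded_ops H1 H3"
      by (rule bounded_ops_comp [OF approx_classD [OF T] approx_classD [OF S] H2])
    show "0 \<le> \<alpha> (n div 2) * \<beta> (n div 2)" for n using \<alpha>(1) \<beta>(1) by simp
    show "approximable H1 H3 (T \<circ> S) n (\<alpha> (n div 2) * \<beta> (n div 2))" for n
      by (rule approximable_mono [OF approximable_comp [OF \<alpha>(2) \<beta>(2) approx_classD [OF T]
              approx_classD [OF S] H2 H3 \<alpha>(1)]]) simp
    have "summable (\<lambda>n. \<alpha> (n div 2) powr r + \<beta> (n div 2) powr s)"
      by (intro summable_add summable_div_2 [of "\<lambda>n. \<alpha> n powr r"]
          summable_div_2 [of "\<lambda>n. \<beta> n powr s"] \<alpha> \<beta>) auto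
    then show "summable (\<lambda>n. (\<alpha> (n div 2) * \<beta> (n div 2)) powr t)"
      by (rule summable_comparison_test') (use powr_mult_le [OF _ _ q] \<alpha>(1) \<beta>(1) in auto)
  qed
qed

lemma approx_class_scaleC:
  assumes T: "T \<in> approx_class q H1 H2" and H2: "complex_vector.subspace H2"
  shows "c *\<^sub>C T \<in> approx_class q H1 H2"
proof -
  have "(c *\<^sub>C id_op H2) \<circ> T \<in> approx_class q H1 H2"
    by (intro approx_class_comp_left [OF T _ H2] bounded_ops_scaleC id_op_bounded H2)
  also have "(c *\<^sub>C id_op H2) \<circ> T = c *\<^sub>C T"
    by (simp add: comp_scaleC_left id_op_comp [OF approx_classD [OF T]])
  finally show ?thesis .
qed

lemma approx_class_0:
  assumes H2: "complex_vector.subspace H2" and q: "q > 0"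
  shows "0 \<in> approx_class q H1 H2"
proof (rule approx_classI [where \<alpha> = "\<lambda>_. 0"])
  have "fin_rank H1 H2 n 0" for n unfolding fin_rank_def
    using H2 by (intro conjI exI [of _ "[]"]) simp_all
  then show "approximable H1 H2 0 n 0" for n
    unfolding approximable_def by (intro exI [of _ 0]) simp
qed (use H2 q in simp_all)

lemma approx_class_subspace:
  assumes "complex_vector.subspace H2" "q > 0"
  shows "complex_vector.subspace (approx_class q H1 H2)"
  unfolding complex_vector.subspace_def
  using approx_class_0 [OF assms] approx_class_add [OF _ _ assms(1)]
    approx_class_scaleC [OF _ assms(1)] assms(2) by simp

lemma approx_errors_tendsto_0:
  fixes \<alpha> :: "nat \<Rightarrow> real"
  assumes "\<And>n. 0 \<le> \<alpha> n" "summable (\<lambda>n. \<alpha> n powr q)" "q > 0"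
  shows "\<alpha> \<longlonglongrightarrow> 0"
proof -
  have "(\<lambda>n. (\<alpha> n powr q) powr (1 / q)) \<longlonglongrightarrow> 0"
    by (rule tendsto_zero_powrI [OF summable_LIMSEQ_zero [OF assms(2)] tendsto_const])
      (use assms in auto)
  then show ?thesis using assms by (simp add: powr_powr)
qed

text \<open>The errors tend to 0, and below 1 a larger exponent gives a smaller power. This replaces
  the given summability exponent of the commutators by 2m.\<close>

lemma approx_class_mono:
  assumes T: "T \<in> approx_class p H1 H2" and "0 < p" "p \<le> q"
  shows "T \<in> approx_class q H1 H2"
proof -
  obtain \<alpha> where \<alpha>: "\<And>n. 0 \<le> \<alpha> n" "\<And>n. approximable H1 H2 T n (\<alpha> n)" "summable (\<lambda>n. \<alpha> n powr p)"
    using approx_classE [OF T] by metis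
  have "\<forall>\<^sub>F n in sequentially. \<alpha> n < 1"
    using order_tendstoD(2) [OF approx_errors_tendsto_0 [OF \<alpha>(1,3) assms(2)]] by simp
  then have "\<forall>\<^sub>F n in sequentially. norm (\<alpha> n powr q) \<le> \<alpha> n powr p"
    by eventually_elim (use \<alpha>(1) assms in \<open>simp add: powr_mono'\<close>)
  then have "summable (\<lambda>n. \<alpha> n powr q)"
    by (rule summable_comparison_test_ev [OF _ \<alpha>(3)])
  with \<alpha>(1,2) show ?thesis by (intro approx_classI [OF approx_classD [OF T]])
qed

text \<open>Each term of the list sends the unit ball into the image of a closed disc under
  \<open>\<lambda>c. c *\<^sub>C snd p\<close>, and sums of compact sets are compact.\<close>

lemma fin_rank_unit_ball:
  assumes "fin_rank H1 H2 n R"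
  obtains C where "compact C" "R ` {x\<in>H1. norm x \<le> 1} \<subseteq> C"
proof -
  from assms obtain L where L:
    "\<forall>p\<in>set L. snd p \<in> H2 \<and> clinear_on H1 (fst p) \<and> (\<exists>K. \<forall>x\<in>H1. cmod (fst p x) \<le> K * norm x)"
    "\<forall>x\<in>H1. R x = (\<Sum>p\<leftarrow>L. rank_form p x)"
    unfolding fin_rank_def by blast
  have "\<exists>C. compact C \<and> (\<forall>x\<in>H1. norm x \<le> 1 \<longrightarrow> (\<Sum>p\<leftarrow>L. rank_form p x) \<in> C)"
    using L(1)
  proof (induction L)
    case Nil
    show ?case by (intro exI [of _ "{0}"]) simp
  next
    case (Cons p L)
    then obtain C K where C: "compact C" "\<forall>x\<in>H1. norm x \<le> 1 \<longrightarrow> (\<Sum>p\<leftarrow>L. rank_form p x) \<in> C"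
      and K: "\<forall>x\<in>H1. cmod (fst p x) \<le> K * norm x" by auto
    define D where "D = (\<lambda>c. c *\<^sub>C snd p) ` cball 0 \<bar>K\<bar>"
    have "compact D" unfolding D_def
      by (intro compact_continuous_image compact_cball
          bounded_linear.continuous_on [OF bounded_linear_scaleC_left] continuous_on_id)
    then have "compact (\<Union>x\<in>D. \<Union>y\<in>C. {x + y})" by (intro compact_sums' C(1))
    moreover have "rank_form p x \<in> D" if "x \<in> H1" "norm x \<le> 1" for x
    proof -
      have "cmod (fst p x) \<le> K * norm x" using K that by blast
      also have "\<dots> \<le> \<bar>K\<bar> * 1" using that by (intro mult_mono) auto
      finally show ?thesis unfolding D_def rank_form_def by (intro imageI) simp
    qed
    ultimately show ?case using C(2)
      by (intro exI [of _ "\<Union>x\<in>D. \<Union>y\<in>C. {x + y}"]) auto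
  qed
  with L(2) that show thesis by force
qed

lemma approx_class_compact:
  assumes T: "T \<in> approx_class q H1 H2" and q: "q > 0" and H2: "complete H2"
  shows "compact_op H1 T"
  unfolding compact_op_def compact_eq_totally_bounded
proof (intro conjI allI impI)
  obtain \<alpha> where \<alpha>: "\<And>n. 0 \<le> \<alpha> n" "\<And>n. approximable H1 H2 T n (\<alpha> n)" "summable (\<lambda>n. \<alpha> n powr q)"
    using approx_classE [OF T] by metis
  let ?U = "{x\<in>H1. norm x \<le> 1}"
  have "T ` ?U \<subseteq> H2" using bounded_opsD(1) [OF approx_classD [OF T]] by blast
  then have "closure (T ` ?U) \<subseteq> H2" by (rule closure_minimal [OF _ complete_imp_closed [OF H2]])
  then show "complete (closure (T ` ?U))" by (rule complete_closed_subset [OF closed_closure _ H2])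
  fix e :: real assume e: "e > 0"
  from order_tendstoD(2) [OF approx_errors_tendsto_0 [OF \<alpha>(1,3) q], of "e / 3"] e
  obtain n where n: "\<alpha> n < e / 3" by (auto simp: eventually_sequentially)
  from \<alpha>(2) [of n] obtain R where R: "fin_rank H1 H2 n R" "\<forall>x\<in>H1. norm (T x - R x) \<le> \<alpha> n * norm x"
    unfolding approximable_def by blast
  obtain C where C: "compact C" "R ` ?U \<subseteq> C" using fin_rank_unit_ball [OF R(1)] .
  then obtain k where k: "finite k" "C \<subseteq> (\<Union>x\<in>k. ball x (e / 3))"
    using e compact_eq_totally_bounded [of C] by (metis divide_pos_pos zero_less_numeral)
  \<comment> \<open>One third of \<open>e\<close> goes to the approximation and one third to the
    net. The balls are closed so that the inclusion survives the closure; the last third is for the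
    return to open balls of radius \<open>e\<close>.\<close>
  have "T x \<in> (\<Union>y\<in>k. cball y (2 * e / 3))" if x: "x \<in> ?U" for x
  proof -
    from x C(2) k(2) obtain y where y: "y \<in> k" "dist y (R x) < e / 3" by (force simp: subset_iff)
    have "norm (T x - R x) \<le> \<alpha> n * norm x" using R(2) x by blast
    also have "\<dots> \<le> (e / 3) * 1" using x n e by (intro mult_mono) auto
    finally have "dist (R x) (T x) \<le> e / 3" by (simp add: dist_norm norm_minus_commute)
    with y(2) have "dist y (T x) \<le> 2 * e / 3" using dist_triangle [of y "T x" "R x"] by linarith
    with y(1) show ?thesis by auto
  qed
  then have "T ` ?U \<subseteq> (\<Union>y\<in>k. cball y (2 * e / 3))" by blast
  then have "closure (T ` ?U) \<subseteq> (\<Union>y\<in>k. cball y (2 * e / 3))"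
    by (rule closure_minimal) (intro closed_UN k(1) ballI closed_cball)
  also have "\<dots> \<subseteq> (\<Union>y\<in>k. ball y e)" using e by (intro UN_mono) auto
  finally show "\<exists>k. finite k \<and> closure (T ` ?U) \<subseteq> (\<Union>x\<in>k. ball x e)" using k(1) by blast
qed

section \<open>Singular values against approximation errors\<close>

lemma sum_fun_apply: "(\<Sum>i\<in>A. f i) x = (\<Sum>i\<in>A. f i x)"
  for f :: "'i \<Rightarrow> 'a \<Rightarrow> 'b::comm_monoid_add"
  by (induction A rule: infinite_finite_induct) simp_all

text \<open>The \<open>n + 1\<close> columns \<open>A i\<close>, extended by 0, lie in the span of
  \<open>n\<close> unit vectors. Linear dependence is a property of sets rather than families, so
  equal columns form a separate case, with the relation that subtracts one from the other.\<close>

lemma underdetermined_system: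
  fixes a :: "nat \<Rightarrow> nat \<Rightarrow> complex"
  shows "\<exists>c. (\<exists>i\<le>n. c i \<noteq> 0) \<and> (\<forall>j<n. (\<Sum>i\<le>n. c i * a j i) = 0)"
proof -
  define A where "A = (\<lambda>i j. if j < n then a j i else 0)"
  show ?thesis
  proof (cases "inj_on A {..n}")
    case False
    then obtain i k where ik: "i \<le> n" "k \<le> n" "i \<noteq> k" "A i = A k" by (auto simp: inj_on_def)
    define c :: "nat \<Rightarrow> complex" where "c = (\<lambda>l. (if l = i then 1 else 0) - (if l = k then 1 else 0))"
    have "(\<Sum>l\<le>n. c l * a j l) = 0" if "j < n" for j
    proof -
      have "(\<Sum>l\<le>n. c l * a j l) = (\<Sum>l\<le>n. if l = i then a j l else 0) - (\<Sum>l\<le>n. if l = k then a j l else 0)"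
        unfolding sum_subtractf [symmetric] by (intro sum.cong refl) (simp add: c_def)
      also have "\<dots> = A i j - A k j" using ik(1,2) that by (simp add: A_def)
      also have "\<dots> = 0" unfolding ik(4) by simp
      finally show ?thesis .
    qed
    moreover have "c i \<noteq> 0" using ik by (simp add: c_def)
    ultimately show ?thesis using ik(1) by blast
  next
    case True
    define S where "S = A ` {..n}"
    define E where "E = (\<lambda>j i. if i = j then 1 else 0 :: complex) ` {..<n}"
    have "A i \<in> complex_vector.span E" for i
    proof -
      have "A i = (\<Sum>j<n. a j i *\<^sub>C (\<lambda>k. if k = j then 1 else 0))"
      proof
        fix k
        have "(\<Sum>j<n. a j i *\<^sub>C (\<lambda>k. if k = j then 1 else 0 :: complex)) k
          = (\<Sum>j<n. if k = j then a j i else 0)"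
          unfolding sum_fun_apply by (intro sum.cong refl) (simp add: scaleC_fun_def scaleC_complex_def)
        then show "A i k = (\<Sum>j<n. a j i *\<^sub>C (\<lambda>k. if k = j then 1 else 0)) k"
          by (simp add: A_def)
      qed
      moreover have "(\<lambda>k. if k = j then 1 else 0) \<in> E" if "j \<in> {..<n}" for j
        using that by (auto simp: E_def)
      ultimately show ?thesis
        by (simp only:) (intro complex_vector.span_sum complex_vector.span_scale complex_vector.span_base)
    qed
    then have SE: "S \<subseteq> complex_vector.span E" by (auto simp: S_def)
    have fE: "finite E" and cE: "card E \<le> n"
      unfolding E_def using card_image_le [of "{..<n}"] by auto
    have cS: "card S = Suc n" unfolding S_def using card_image [OF True] by simp
    have "complex_vector.dependent S"
      using complex_vector.independent_span_bound [OF fE _ SE] cE cS by fastforce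
    then obtain u where u: "\<exists>v\<in>S. u v \<noteq> 0" "(\<Sum>v\<in>S. u v *\<^sub>C v) = 0"
      using complex_vector.dependent_finite [of S] by (auto simp: S_def)
    have "(\<Sum>i\<le>n. u (A i) *\<^sub>C A i) = 0"
      using u(2) unfolding S_def by (subst (asm) sum.reindex [OF True]) (simp add: o_def)
    then have sum0: "(\<Sum>i\<le>n. u (A i) * A i j) = 0" for j
      by (drule_tac fun_cong [of _ _ j]) (simp add: sum_fun_apply scaleC_fun_def scaleC_complex_def)
    have A_apply: "A i j = a j i" if "j < n" for i j using that by (simp add: A_def)
    have "(\<Sum>i\<le>n. u (A i) * a j i) = 0" if "j < n" for j
      using sum0 [of j] unfolding A_apply [OF that] .
    moreover have "\<exists>i\<le>n. u (A i) \<noteq> 0" using u(1) by (auto simp: S_def)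
    ultimately show ?thesis by (intro exI [of _ "\<lambda>i. u (A i)"]) blast
  qed
qed

text \<open>Dimension count as in the min-max principle: the at most \<open>n\<close> functionals of
  an approximant have a common zero \<open>x \<noteq> 0\<close> in the span of
  \<open>v 0, ..., v n\<close>. There the approximant vanishes, whereas \<open>T\<close> stretches
  \<open>x\<close> by at least the singular value of index \<open>n\<close>.\<close>

lemma (in singular_system) singular_value_le_error:
  assumes "approximable H1 H2 T n a" "a \<ge> 0"
  shows "norm (T (v n)) \<le> a"
proof (cases "norm (T (v n)) = 0")
  case False
  define s where "s = norm (T (v n))"
  then have s: "s > 0" using False by simp
  have nv: "norm (v i) = 1" if "i \<le> n" for i
  proof (rule v_norm1)
    have "norm (T (v i)) > 0" using sv_antimono [OF that] s unfolding s_def by linarith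
    then show "T (v i) \<noteq> 0" by simp
  qed
  from assms(1) obtain R where R: "fin_rank H1 H2 n R" "\<forall>x\<in>H1. norm (T x - R x) \<le> a * norm x"
    unfolding approximable_def by blast
  then obtain L where L: "length L \<le> n" "\<forall>p\<in>set L. clinear_on H1 (fst p)"
    "\<forall>x\<in>H1. R x = (\<Sum>p\<leftarrow>L. rank_form p x)"
    unfolding fin_rank_def by blast
  \<comment> \<open>If \<open>L\<close> is shorter than \<open>n\<close>, the surplus equations
    involve unspecified values of \<open>L ! j\<close>; they merely constrain \<open>c\<close>
    further.\<close>
  obtain c where c: "\<exists>i\<le>n. c i \<noteq> 0" "\<forall>j<n. (\<Sum>i\<le>n. c i * fst (L ! j) (v i)) = 0"
    using underdetermined_system [where a = "\<lambda>j i. fst (L ! j) (v i)"] by blast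
  define x where "x = (\<Sum>i\<le>n. c i *\<^sub>C v i)"
  have x: "x \<in> H1" unfolding x_def
    by (intro complex_vector.subspace_sum complex_vector.subspace_scale H1 v_in)
  have "fst p x = 0" if p: "p \<in> set L" for p
  proof -
    obtain j where j: "j < length L" "p = L ! j" using in_set_conv_nth [THEN iffD1, OF p] by blast
    have lin: "clinear_on H1 (fst p)" using L(2) p by blast
    have "fst p x = (\<Sum>i\<le>n. c i * fst p (v i))" unfolding x_def
      by (subst clinear_on_sum [OF lin H1(1)])
        (simp_all add: clinear_onD(2) [OF lin] v_in complex_vector.subspace_scale [OF H1(1)] scaleC_complex_def)
    then show ?thesis using c(2) j L(1) by simp
  qed
  then have "(\<Sum>p\<leftarrow>L. rank_form p x) = (\<Sum>p\<leftarrow>L. 0)"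
    by (intro arg_cong [of _ _ sum_list] map_cong refl) (simp add: rank_form_def)
  then have "R x = 0" using L(3) x by simp
  then have le: "norm (T x) \<le> a * norm x" using R(2) x by force
  have "T x = (\<Sum>i\<le>n. c i *\<^sub>C T (v i))" unfolding x_def
    by (subst clinear_on_sum [OF T_linear H1(1)])
      (simp_all add: clinear_onD(2) [OF T_linear] v_in complex_vector.subspace_scale [OF H1(1)])
  also have "(norm \<dots>)\<^sup>2 = (\<Sum>i\<le>n. (norm (c i *\<^sub>C T (v i)))\<^sup>2)"
    by (rule norm_sum_orthogonal) (simp_all add: cinner_scaleC_left cinner_scaleC_right Tv_orth)
  finally have "(norm (T x))\<^sup>2 = (\<Sum>i\<le>n. (cmod (c i) * norm (T (v i)))\<^sup>2)"
    by (simp only: norm_scaleC)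
  also have "\<dots> \<ge> (\<Sum>i\<le>n. (cmod (c i) * s)\<^sup>2)"
    unfolding s_def by (intro sum_mono power_mono mult_left_mono sv_antimono) auto
  finally have 1: "(\<Sum>i\<le>n. (cmod (c i) * s)\<^sup>2) \<le> (norm (T x))\<^sup>2" .
  have "(norm x)\<^sup>2 = (\<Sum>i\<le>n. (norm (c i *\<^sub>C v i))\<^sup>2)" unfolding x_def
    by (rule norm_sum_orthogonal) (simp_all add: cinner_scaleC_left cinner_scaleC_right v_orth)
  then have nx: "(norm x)\<^sup>2 = (\<Sum>i\<le>n. (cmod (c i))\<^sup>2)"
    using nv by (simp add: norm_scaleC)
  have "(s * norm x)\<^sup>2 \<le> (norm (T x))\<^sup>2"
    using 1 unfolding power_mult_distrib nx by (simp add: sum_distrib_left mult.commute)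
  then have "s * norm x \<le> norm (T x)" by (rule power2_le_imp_le) simp
  with le have "s * norm x \<le> a * norm x" by simp
  moreover have "(norm x)\<^sup>2 > 0" unfolding nx
  proof -
    obtain i where "i \<le> n" "c i \<noteq> 0" using c(1) by blast
    then show "0 < (\<Sum>i\<le>n. (cmod (c i))\<^sup>2)" by (intro sum_pos2 [of _ i]) auto
  qed
  ultimately show ?thesis by (simp add: s_def)
qed (use assms in simp)

lemma approx_class_singular_system:
  assumes "T \<in> approx_class q H1 H2" "q > 0" "complex_vector.subspace H1" "complete H1"
    "complex_vector.subspace H2" "complete H2"
  obtains v where "singular_system H1 H2 T v" "summable (\<lambda>n. norm (T (v n)) powr q)"
proof -
  have "subseq_convergent_on H1 T"
    by (rule compact_op_subseq_convergent [OF approx_class_compact [OF assms(1,2,6)]])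
  then obtain v where v: "singular_system H1 H2 T v"
    using singular_system_exists [OF assms(3-5) approx_classD [OF assms(1)]] by blast
  obtain \<alpha> where \<alpha>: "\<And>n. 0 \<le> \<alpha> n" "\<And>n. approximable H1 H2 T n (\<alpha> n)" "summable (\<lambda>n. \<alpha> n powr q)"
    using approx_classE [OF assms(1)] by metis
  have "norm (T (v n)) \<le> \<alpha> n" for n
    by (rule singular_system.singular_value_le_error [OF v \<alpha>(2,1)])
  then have "summable (\<lambda>n. norm (T (v n)) powr q)"
    using assms(2) by (intro summable_comparison_test' [OF \<alpha>(3)]) (simp add: powr_mono2)
  with v show thesis by (rule that)
qed

lemma approx_class_schatten:
  assumes "T \<in> approx_class q H1 H2" "q > 0" "complex_vector.subspace H1" "complete H1"
    "complex_vector.subspace H2" "complete H2"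
  shows "T \<in> schatten q H1 H2"
proof -
  obtain v where v: "singular_system H1 H2 T v" "summable (\<lambda>n. norm (T (v n)) powr q)"
    using approx_class_singular_system [OF assms] .
  show ?thesis
    unfolding singular_system.schatten_iff [OF v(1)]
    using v(2) approx_class_compact [OF assms(1,2,6)] by blast
qed

text \<open>The truncated singular value expansions are the approximants, with errors given by
  \<open>truncation_error\<close>.\<close>

lemma schatten_approx_class:
  assumes sch: "T \<in> schatten q H1 H2" and "complex_vector.subspace H1" "complete H1"
    "complex_vector.subspace H2"
  shows "T \<in> approx_class q H1 H2"
proof -
  have bT: "T \<in> bounded_ops H1 H2" and "compact_op H1 T" using sch by (simp_all add: schatten_def)
  then obtain v where "singular_system H1 H2 T v"
    by (rule singular_system_exists [OF assms(2-4) _ compact_op_subseq_convergent])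
  then interpret singular_system H1 H2 T v .
  have "approximable H1 H2 T n (norm (T (v n)))" for n
  proof -
    define R where "R = (\<lambda>x. if x \<in> H1 then \<Sum>k<n. cinner (v k) x *\<^sub>C T (v k) else 0)"
    define L where "L = map (\<lambda>k. (cinner (v k), T (v k))) [0..<n]"
    have RL: "R x = (\<Sum>p\<leftarrow>L. rank_form p x)" if "x \<in> H1" for x
      using that by (simp add: R_def L_def rank_form_def o_def interv_sum_list_conv_sum_set_nat atLeast0LessThan)
    have "R \<in> bounded_ops H1 H2"
    proof (rule bounded_opsI [where K = "\<Sum>k<n. norm (v k) * norm (T (v k))"])
      fix x assume x: "x \<in> H1"
      show "R x \<in> H2" using x
        by (simp add: R_def complex_vector.subspace_sum [OF H2] complex_vector.subspace_scale [OF H2] Tv_in)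
      have "norm (R x) \<le> (\<Sum>k<n. norm (cinner (v k) x *\<^sub>C T (v k)))"
        using x by (simp add: R_def norm_sum)
      also have "\<dots> \<le> (\<Sum>k<n. (norm (v k) * norm x) * norm (T (v k)))"
        unfolding norm_scaleC by (intro sum_mono mult_right_mono complex_cauchy_schwarz) simp
      finally show "norm (R x) \<le> (\<Sum>k<n. norm (v k) * norm (T (v k))) * norm x"
        unfolding sum_distrib_right by (simp only: mult_ac)
      show "R (c *\<^sub>C x) = c *\<^sub>C R x" for c
        using x by (simp add: R_def cinner_scaleC_right complex_vector.subspace_scale [OF H1(1)]
            complex_vector.scale_sum_right scaleC_scaleC)
      show "R (x + y) = R x + R y" if "y \<in> H1" for y
        using x that by (simp add: R_def cinner_add_right complex_vector.subspace_add [OF H1(1)]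
            scaleC_add_left sum.distrib)
    qed (simp add: R_def)
    moreover have "\<forall>p\<in>set L. snd p \<in> H2 \<and> clinear_on H1 (fst p) \<and>
        (\<exists>K. \<forall>x\<in>H1. cmod (fst p x) \<le> K * norm x)"
    proof
      fix p assume "p \<in> set L"
      then obtain k where p: "fst p = cinner (v k)" "snd p = T (v k)" by (auto simp: L_def)
      have "clinear_on H1 (cinner (v k))"
        by (simp add: clinear_on_def cinner_add_right cinner_scaleC_right scaleC_complex_def)
      moreover have "\<forall>x\<in>H1. cmod (cinner (v k) x) \<le> norm (v k) * norm x"
        by (intro ballI complex_cauchy_schwarz)
      ultimately show "snd p \<in> H2 \<and> clinear_on H1 (fst p) \<and>
          (\<exists>K. \<forall>x\<in>H1. cmod (fst p x) \<le> K * norm x)"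
        unfolding p using Tv_in by blast
    qed
    moreover have "length L \<le> n" by (simp add: L_def)
    ultimately have "fin_rank H1 H2 n R"
      using RL unfolding fin_rank_def by blast
    moreover have "norm (T x - R x) \<le> norm (T (v n)) * norm x" if "x \<in> H1" for x
      using truncation_error [OF that, of n] that by (simp add: R_def)
    ultimately show ?thesis unfolding approximable_def by blast
  qed
  moreover have "summable (\<lambda>n. norm (T (v n)) powr q)"
    using sch unfolding schatten_iff by (rule conjunct2)
  ultimately show ?thesis by (intro approx_classI [OF bT, of "\<lambda>n. norm (T (v n))"] norm_ge_zero)
qed

section \<open>The trace\<close>

lemma orthonormal_basisD:
  assumes "orthonormal_basis H B"
  shows "B \<subseteq> H" "orthonormal B"
  using assms by (auto simp: orthonormal_basis_def orthonormal_def)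

lemma orthonormal_coeffs_product_sum_le:
  assumes "orthonormal J" "finite J"
  shows "(\<Sum>e\<in>J. cmod (cinner x e * cinner e y)) \<le> norm x * norm y"
proof -
  have "(\<Sum>e\<in>J. cmod (cinner x e * cinner e y))
      = (\<Sum>e\<in>J. \<bar>cmod (cinner e x)\<bar> * \<bar>cmod (cinner e y)\<bar>)"
    by (simp add: norm_mult cmod_cinner_commute [of x])
  also have "\<dots> \<le> L2_set (\<lambda>e. cmod (cinner e x)) J * L2_set (\<lambda>e. cmod (cinner e y)) J"
    by (rule L2_set_mult_ineq)
  also have "\<dots> \<le> norm x * norm y"
    unfolding L2_set_def using bessel_finite(2) [OF assms]
    by (intro mult_mono real_le_lsqrt) (simp_all add: sum_nonneg)
  finally show ?thesis .
qed

text \<open>Insert the expansion of \<open>T e\<close> and interchange the sums over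
  \<open>e\<close> and \<open>n\<close>. By Cauchy-Schwarz and Bessel the sum over \<open>e\<close>
  of the moduli is at most \<open>norm (T (v n))\<close>, so the double series converges absolutely;
  its columns are evaluated by Parseval. The result does not mention \<open>B\<close>.\<close>

lemma trace_has_sum_singular:
  fixes H :: "'h::complex_inner set"
  assumes v: "singular_system H H T v" and summ: "summable (\<lambda>n. norm (T (v n)))"
    and B: "orthonormal_basis H B"
  shows "((\<lambda>e. cinner e (T e)) has_sum (\<Sum>\<^sub>\<infinity>n. cinner (v n) (T (v n)))) B"
proof -
  interpret singular_system H H T v by (rule v)
  note BD = orthonormal_basisD [OF B]
  define f where "f = (\<lambda>e n. cinner (v n) e * cinner e (T (v n)))"
  have bound: "(\<Sum>x\<in>F. cmod (case x of (e, n) \<Rightarrow> f e n)) \<le> (\<Sum>n. norm (T (v n)))"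
    if F: "F \<subseteq> B \<times> UNIV" "finite F" for F
  proof -
    define J N where "J = fst ` F" and "N = snd ` F"
    have J: "J \<subseteq> B" "finite J" and N: "finite N" using F by (auto simp: J_def N_def)
    have oJ: "orthonormal J" using BD(2) J(1) by (auto simp: orthonormal_def subset_iff)
    have "F \<subseteq> J \<times> N" by (force simp: J_def N_def)
    then have "(\<Sum>x\<in>F. cmod (case x of (e, n) \<Rightarrow> f e n)) \<le> (\<Sum>x\<in>J \<times> N. cmod (case x of (e, n) \<Rightarrow> f e n))"
      using J N by (intro sum_mono2) auto
    also have "\<dots> = (\<Sum>e\<in>J. \<Sum>n\<in>N. cmod (f e n))"
      by (simp add: sum.cartesian_product case_prod_unfold)
    also have "\<dots> = (\<Sum>n\<in>N. \<Sum>e\<in>J. cmod (f e n))" by (rule sum.swap)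
    also have "\<dots> \<le> (\<Sum>n\<in>N. norm (v n) * norm (T (v n)))"
      unfolding f_def by (intro sum_mono orthonormal_coeffs_product_sum_le oJ J)
    also have "\<dots> \<le> (\<Sum>n\<in>N. norm (T (v n)))"
    proof (rule sum_mono)
      fix n
      have "norm (v n) \<le> 1" using v_norm [of n] by auto
      then show "norm (v n) * norm (T (v n)) \<le> norm (T (v n))"
        by (rule mult_left_le_one_le [rotated 2]) simp_all
    qed
    also have "\<dots> \<le> (\<Sum>n. norm (T (v n)))" by (intro sum_le_suminf summ N) simp
    finally show ?thesis .
  qed
  have "(\<lambda>x. norm (case x of (e, n) \<Rightarrow> f e n)) summable_on B \<times> UNIV"
  proof (rule nonneg_bdd_above_summable_on)
    show "bdd_above (sum (\<lambda>x. norm (case x of (e, n) \<Rightarrow> f e n)) ` {F. F \<subseteq> B \<times> UNIV \<and> finite F})"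
      using bound by (intro bdd_aboveI [of _ "\<Sum>n. norm (T (v n))"]) blast
  qed simp
  then have fsum: "(\<lambda>(e, n). f e n) summable_on B \<times> UNIV" by (rule abs_summable_summable)
  have row: "infsum (f e) UNIV = cinner e (T e)" if e: "e \<in> B" for e
  proof -
    have "f e summable_on UNIV" by (rule summable_on_SigmaD1 [OF fsum e])
    then have "f e sums infsum (f e) UNIV" by (intro has_sum_imp_sums has_sum_infsum)
    moreover have "f e sums cinner e (T e)"
      using bounded_linear.sums [OF bounded_linear_cinner_right T_sums [OF subsetD [OF BD(1) e]], of e]
      by (simp add: cinner_scaleC_right f_def)
    ultimately show ?thesis by (rule sums_unique2)
  qed
  have column: "infsum (\<lambda>e. f e n) B = cinner (v n) (T (v n))" for n
    unfolding f_def by (rule infsumI [OF parseval [OF B Tv_in]])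
  have "(\<lambda>e. infsum (f e) UNIV) summable_on B"
    by (rule summable_on_Sigma_banach [OF fsum])
  then have "((\<lambda>e. infsum (f e) UNIV) has_sum infsum (\<lambda>e. infsum (f e) UNIV) B) B"
    by (rule has_sum_infsum)
  also have "infsum (\<lambda>e. infsum (f e) UNIV) B = (\<Sum>\<^sub>\<infinity>n. cinner (v n) (T (v n)))"
    unfolding infsum_swap_banach [OF fsum] column ..
  finally show ?thesis
    using has_sum_cong [of B "\<lambda>e. infsum (f e) UNIV" "\<lambda>e. cinner e (T e)"] row by blast
qed

text \<open>Basis independence, which makes the \<open>SOME\<close> in \<open>trace_op\<close>
  harmless: later computations choose the basis that suits them.\<close>

lemma trace_has_sum:
  fixes H :: "'h::complex_inner set"
  assumes H: "complex_vector.subspace H" "complete H" and T: "T \<in> approx_class 1 H H"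
    and B: "orthonormal_basis H B"
  shows "((\<lambda>e. cinner e (T e)) has_sum trace_op H T) B"
proof -
  obtain v where v: "singular_system H H T v" "summable (\<lambda>n. norm (T (v n)) powr 1)"
    by (rule approx_class_singular_system [OF T _ H H]) simp_all
  then have summ: "summable (\<lambda>n. norm (T (v n)))" by simp
  have "trace_op H T = (\<Sum>\<^sub>\<infinity>n. cinner (v n) (T (v n)))" unfolding trace_op_def
    by (rule infsumI [OF trace_has_sum_singular [OF v(1) summ orthonormal_basis_exists [OF H]]])
  then show ?thesis using trace_has_sum_singular [OF v(1) summ B] by simp
qed

lemma trace_op_add:
  fixes H :: "'h::complex_inner set"
  assumes H: "complex_vector.subspace H" "complete H"
    and S: "S \<in> approx_class 1 H H" and T: "T \<in> approx_class 1 H H"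
  shows "trace_op H (S + T) = trace_op H S + trace_op H T"
proof -
  note B = orthonormal_basis_exists [OF H]
  have "S + T \<in> approx_class 1 H H" by (rule approx_class_add [OF S T H(1)]) simp
  from trace_has_sum [OF H this B]
  have "((\<lambda>e. cinner e (S e) + cinner e (T e)) has_sum trace_op H (S + T)) (SOME B. orthonormal_basis H B)"
    by (simp add: cinner_add_right)
  then show ?thesis
    using has_sum_add [OF trace_has_sum [OF H S B] trace_has_sum [OF H T B]] by (rule has_sum_unique)
qed

lemma trace_op_scaleC:
  fixes H :: "'h::complex_inner set"
  assumes H: "complex_vector.subspace H" "complete H" and T: "T \<in> approx_class 1 H H"
  shows "trace_op H (c *\<^sub>C T) = c * trace_op H T"
proof -
  note B = orthonormal_basis_exists [OF H]
  from trace_has_sum [OF H approx_class_scaleC [OF T H(1)] B]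
  have "((\<lambda>e. c * cinner e (T e)) has_sum trace_op H (c *\<^sub>C T)) (SOME B. orthonormal_basis H B)"
    by (simp add: cinner_scaleC_right scaleC_fun_def)
  then show ?thesis
    using has_sum_cmult_right [OF trace_has_sum [OF H T B]] by (rule has_sum_unique)
qed

lemma orthonormal_family:
  assumes "\<And>m n. m \<in> N \<Longrightarrow> n \<in> N \<Longrightarrow> cinner (f m) (f n) = (if m = n then 1 else 0)"
  shows "inj_on f N" "orthonormal (f ` N)"
proof -
  show inj: "inj_on f N"
  proof (rule inj_onI)
    fix m n assume mn: "m \<in> N" "n \<in> N" "f m = f n"
    have "cinner (f m) (f n) = 1" unfolding mn(3) using assms [OF mn(2,2)] by simp
    then show "m = n" using assms [OF mn(1,2)] by (cases "m = n") simp_all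
  qed
  show "orthonormal (f ` N)" unfolding orthonormal_def
  proof (intro ballI)
    fix x y assume "x \<in> f ` N" "y \<in> f ` N"
    then obtain m n where mn: "x = f m" "y = f n" "m \<in> N" "n \<in> N" by blast
    then have "x = y \<longleftrightarrow> m = n" using inj_onD [OF inj, of m n] by blast
    then show "cinner x y = (if x = y then 1 else 0)"
      unfolding mn(1,2) using assms [OF mn(3,4)] by simp
  qed
qed

text \<open>Neither factor need be trace class. With \<open>A = \<Sum>\<^sub>n \<sigma>\<^sub>n \<langle>v\<^sub>n, \<cdot>\<rangle> u\<^sub>n\<close> both traces are equal to
  \<open>\<Sum>\<^sub>n \<sigma>\<^sub>n \<langle>v\<^sub>n, B u\<^sub>n\<rangle>\<close>: the left one in a basis extending the \<open>u\<^sub>n\<close>, the right one in a basis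
  extending the \<open>v\<^sub>n\<close>.\<close>

lemma trace_op_comp_commute:
  fixes H1 H2 :: "'h::complex_inner set"
  assumes H1: "complex_vector.subspace H1" "complete H1"
    and H2: "complex_vector.subspace H2" "complete H2"
    and A: "A \<in> approx_class q H1 H2" "q > 0" and B: "B \<in> bounded_ops H2 H1"
    and AB: "A \<circ> B \<in> approx_class 1 H2 H2" and BA: "B \<circ> A \<in> approx_class 1 H1 H1"
  shows "trace_op H2 (A \<circ> B) = trace_op H1 (B \<circ> A)"
proof -
  obtain v where v: "singular_system H1 H2 A v"
    by (rule approx_class_singular_system [OF A H1 H2])
  then interpret S: singular_system H1 H2 A v .
  define s where "s = (\<lambda>n. norm (A (v n)))"
  define N where "N = {n. A (v n) \<noteq> 0}"
  define u where "u = (\<lambda>n. complex_of_real (1 / s n) *\<^sub>C A (v n))"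
  have s: "s n > 0" if "n \<in> N" for n using that by (simp add: s_def N_def)
  have v0: "A (v n) = 0" "v n = 0" if "n \<notin> N" for n using that S.v_ker by (auto simp: N_def)
  have v_ons: "cinner (v m) (v n) = (if m = n then 1 else 0)" if "m \<in> N" "n \<in> N" for m n
  proof (cases "m = n")
    case True
    have "norm (v m) = 1" using S.v_norm1 that by (simp add: N_def)
    with True show ?thesis by (simp add: cinner_self)
  qed (simp add: S.v_orth)
  have u_ons: "cinner (u m) (u n) = (if m = n then 1 else 0)" if "m \<in> N" "n \<in> N" for m n
  proof (cases "m = n")
    case True
    have "norm (u m) = 1" using s [OF that(1)] by (simp add: u_def norm_scaleC s_def norm_divide)
    with True show ?thesis by (simp add: cinner_self)
  qed (simp add: u_def cinner_scaleC_left cinner_scaleC_right S.Tv_orth)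
  have u_in: "u n \<in> H2" for n
    unfolding u_def by (rule complex_vector.subspace_scale [OF H2(1) S.Tv_in])
  note BD = bounded_opsD [OF B]
  define t where "t = (\<lambda>n. cinner (v n) (B (A (v n))))"
  have inj: "inj_on v N" "inj_on u N" and ons: "orthonormal (v ` N)" "orthonormal (u ` N)"
    by (rule orthonormal_family [of N v, OF v_ons] orthonormal_family [of N u, OF u_ons]; assumption)+
  have sub: "v ` N \<subseteq> H1" "u ` N \<subseteq> H2"
    using S.v_in u_in by (simp_all add: image_subset_iff)
  obtain B1 where B1: "v ` N \<subseteq> B1" "orthonormal_basis H1 B1"
    by (rule orthonormal_basis_extend [OF H1 sub(1) ons(1)])
  obtain B2 where B2: "u ` N \<subseteq> B2" "orthonormal_basis H2 B2"
    by (rule orthonormal_basis_extend [OF H2 sub(2) ons(2)])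
  note B1D = orthonormal_basisD [OF B1(2)] and B2D = orthonormal_basisD [OF B2(2)]
  \<comment> \<open>A basis vector outside the family is orthogonal to every \<open>v n\<close>,
    including those that are 0, so all terms of its expansion vanish.\<close>
  have "A e = 0" if e: "e \<in> B1 - v ` N" for e
  proof -
    have e1: "e \<in> H1" using e B1D(1) by blast
    have "cinner (v n) e = 0" for n
    proof (cases "n \<in> N")
      case True
      then have "v n \<in> B1" "v n \<noteq> e" using e B1(1) by auto
      with e B1D(2) show ?thesis unfolding orthonormal_def by simp
    qed (simp add: v0)
    with S.T_sums [OF e1] have "(\<lambda>n. 0) sums A e" by simp
    then show ?thesis using sums_zero by (rule sums_unique2)
  qed
  then have B0: "cinner e ((B \<circ> A) e) = 0" if "e \<in> B1 - v ` N" for e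
    using that clinear_on_0 [OF BD(3) H2(1)] by simp
  have "((\<lambda>e. cinner e ((B \<circ> A) e)) has_sum trace_op H1 (B \<circ> A)) (v ` N)"
    by (rule has_sum_cong_neutral [THEN iffD1, OF _ _ _ trace_has_sum [OF H1 BA B1(2)]])
      (use B1(1) B0 in auto)
  from has_sum_reindex [OF inj(1), THEN iffD1, OF this]
  have 1: "(t has_sum trace_op H1 (B \<circ> A)) N"
    by (simp add: o_def t_def)
  have A0: "cinner e ((A \<circ> B) e) = 0" if e: "e \<in> B2 - u ` N" for e
  proof -
    have e2: "B e \<in> H1" using e B2D(1) BD(1) by blast
    have zero: "cinner e (A (v n)) = 0" for n
    proof (cases "n \<in> N")
      case True
      then have "u n \<in> B2" "e \<noteq> u n" using e B2(1) by auto
      with e B2D(2) have "cinner e (u n) = 0" unfolding orthonormal_def by simp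
      with s [OF True] show ?thesis by (simp add: u_def cinner_scaleC_right)
    qed (simp only: v0(1) cinner_zero not_False_eq_True)
    have "(\<lambda>n. 0) sums cinner e ((A \<circ> B) e)"
      using bounded_linear.sums [OF bounded_linear_cinner_right S.T_sums [OF e2], of e]
      by (simp add: cinner_scaleC_right zero)
    then show ?thesis using sums_zero by (rule sums_unique2)
  qed
  have "((\<lambda>e. cinner e ((A \<circ> B) e)) has_sum trace_op H2 (A \<circ> B)) (u ` N)"
    by (rule has_sum_cong_neutral [THEN iffD1, OF _ _ _ trace_has_sum [OF H2 AB B2(2)]])
      (use B2(1) A0 in auto)
  from has_sum_reindex [OF inj(2), THEN iffD1, OF this]
  have "((\<lambda>n. cinner (u n) (A (B (u n)))) has_sum trace_op H2 (A \<circ> B)) N"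
    by (simp add: o_def)
  \<comment> \<open>\<open>v_eigen\<close> removes \<open>A\<close> from both sides of the inner
    product at the price of \<open>(s n)\<^sup>2\<close>, which cancels the two normalising factors
    \<open>1 / s n\<close> of \<open>u n\<close>.\<close>
  moreover have "cinner (u n) (A (B (u n))) = t n" if n: "n \<in> N" for n
  proof -
    have Bu: "B (u n) = complex_of_real (1 / s n) *\<^sub>C B (A (v n))"
      unfolding u_def by (rule clinear_onD(2) [OF BD(3) S.Tv_in])
    have "cinner (u n) (A (B (u n))) = complex_of_real (1 / s n) * (complex_of_real ((s n)\<^sup>2) * cinner (v n) (B (u n)))"
      unfolding s_def S.v_eigen [OF BD(1) [OF u_in], symmetric]
      by (simp add: u_def cinner_scaleC_left s_def)
    also have "\<dots> = complex_of_real (1 / s n * (s n)\<^sup>2 * (1 / s n)) * t n"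
      unfolding Bu cinner_scaleC_right t_def by simp
    also have "1 / s n * (s n)\<^sup>2 * (1 / s n) = 1"
      using s [OF n] by (simp add: power2_eq_square)
    finally show ?thesis by simp
  qed
  ultimately have "(t has_sum trace_op H2 (A \<circ> B)) N"
    using has_sum_cong [of N "\<lambda>n. cinner (u n) (A (B (u n)))" t] by blast
  with 1 show ?thesis by (rule has_sum_unique [rotated])
qed

section \<open>Composable strings of commutators\<close>

lemma composable_single: "composable C [X] [] \<longleftrightarrow> X \<in> Ob C"
  by (simp add: composable_def)

lemma composable_Cons:
  "composable C (X # Zs) (f # gs) \<longleftrightarrow>
    X \<in> Ob C \<and> Zs \<noteq> [] \<and> f \<in> Hom C (hd Zs) X \<and> composable C Zs gs"
proof -
  have "(\<forall>i<Suc (length gs). (f # gs) ! i \<in> Hom C ((X # Zs) ! Suc i) ((X # Zs) ! i)) \<longleftrightarrow>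
    f \<in> Hom C (Zs ! 0) X \<and> (\<forall>i<length gs. gs ! i \<in> Hom C (Zs ! Suc i) (Zs ! i))"
    by (subst All_less_Suc2) simp
  then show ?thesis
    by (cases Zs) (auto simp: composable_def)
qed

lemma composable_induct [consumes 1, case_names single Cons]:
  assumes "composable C Xs fs" and "\<And>X. X \<in> Ob C \<Longrightarrow> P [X] []"
    and "\<And>X Zs f gs. X \<in> Ob C \<Longrightarrow> Zs \<noteq> [] \<Longrightarrow> hd Zs \<in> Ob C \<Longrightarrow> f \<in> Hom C (hd Zs) X \<Longrightarrow>
      composable C Zs gs \<Longrightarrow> P Zs gs \<Longrightarrow> P (X # Zs) (f # gs)"
  shows "P Xs fs"
  using assms(1)
proof (induction fs arbitrary: Xs)
  case Nil
  then obtain X where "Xs = [X]" "X \<in> Ob C"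
    by (cases Xs) (auto simp: composable_def)
  then show ?case using assms(2) by simp
next
  case (Cons f gs)
  then obtain X Zs where Xs: "Xs = X # Zs" by (cases Xs) (auto simp: composable_def)
  with Cons.prems have Z: "X \<in> Ob C" "Zs \<noteq> []" "f \<in> Hom C (hd Zs) X" "composable C Zs gs"
    by (simp_all add: composable_Cons)
  then have "hd Zs \<in> Ob C" by (auto simp: composable_def)
  with Z Cons.IH [OF Z(4)] show ?case unfolding Xs by (intro assms(3)) auto
qed

lemma composable_ends:
  assumes "composable C Xs fs"
  shows "Xs \<noteq> []" "hd Xs \<in> Ob C" "last Xs \<in> Ob C" "length Xs = Suc (length fs)"
proof -
  show "Xs \<noteq> []" "length Xs = Suc (length fs)" using assms by (auto simp: composable_def)
  then show "hd Xs \<in> Ob C" "last Xs \<in> Ob C" using assms by (auto simp: composable_def)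
qed

lemma composable_append:
  "composable C (As @ X # Bs) (fs @ gs) \<longleftrightarrow> composable C (As @ [X]) fs \<and> composable C (X # Bs) gs"
  if "length As = length fs"
  using that
proof (induction As fs rule: list_induct2)
  case Nil
  then show ?case by (auto simp: composable_single) (auto simp: composable_def)
next
  case (Cons A As f fs)
  then show ?case by (cases As) (auto simp: composable_Cons)
qed

lemma composable_list_update:
  assumes "composable C Xs fs" "g \<in> Hom C (Xs ! Suc i) (Xs ! i)"
  shows "composable C Xs (fs[i := g])"
  using assms unfolding composable_def
  by (metis (no_types, lifting) length_list_update nth_list_update_eq nth_list_update_neq)

text \<open>With this rule the simplifier expands equations between composite operators pointwise.\<close>

declare comp_apply [simp del]

lemma bounded_comp_sum_right:
  assumes "S \<in> bounded_ops H2 H3" "\<And>i. i \<in> A \<Longrightarrow> T i \<in> bounded_ops H1 H2"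
    "complex_vector.subspace H2"
  shows "S \<circ> (\<Sum>i\<in>A. T i) = (\<Sum>i\<in>A. S \<circ> T i)"
  using assms(2)
proof (induction A rule: infinite_finite_induct)
  case (insert a A)
  then have "(\<Sum>i\<in>A. T i) \<in> bounded_ops H1 H2"
    by (intro complex_vector.subspace_sum bounded_ops_subspace assms(3)) auto
  then have "S \<circ> (T a + (\<Sum>i\<in>A. T i)) = (S \<circ> T a) + (S \<circ> (\<Sum>i\<in>A. T i))"
    using insert.prems by (intro comp_add_right [OF assms(1) _ _ assms(3)]) auto
  moreover have "S \<circ> (\<Sum>i\<in>A. T i) = (\<Sum>i\<in>A. S \<circ> T i)"
    using insert.prems by (intro insert.IH) auto
  ultimately show ?case unfolding sum.insert [OF insert.hyps(1,2)] by (simp only:)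
qed (use clinear_on_0 [OF bounded_opsD(3) [OF assms(1)] assms(3)] in \<open>auto simp: fun_eq_iff comp_apply\<close>)

lemma sign_comp_square: "(- 1) ^ k * (- 1) ^ k = (1 :: complex)"
  by (simp add: power_mult_distrib [symmetric])

section \<open>Calculus of graded commutators\<close>

lemma gcomm_add:
  assumes "S \<in> bounded_ops (Ho X) (Ho Y)" "T \<in> bounded_ops (Ho X) (Ho Y)"
    "F Y \<in> bounded_ops (Ho Y) (Ho Y)" "complex_vector.subspace (Ho Y)"
  shows "gcomm F k X Y (S + T) = gcomm F k X Y S + gcomm F k X Y T"
  unfolding gcomm_def comp_add_left comp_add_right [OF assms(3,1,2,4)] scaleC_add_right by simp

lemma gcomm_scaleC:
  assumes "T \<in> bounded_ops (Ho X) (Ho Y)"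
    "F Y \<in> bounded_ops (Ho Y) (Ho Y)" "complex_vector.subspace (Ho Y)"
  shows "gcomm F k X Y (c *\<^sub>C T) = c *\<^sub>C gcomm F k X Y T"
  unfolding gcomm_def comp_scaleC_left comp_scaleC_right [OF assms(2,1,3)]
    complex_vector.scale_right_diff_distrib scaleC_scaleC mult.commute [of c] ..

lemma gcomm_bounded:
  assumes "T \<in> bounded_ops (Ho X) (Ho Y)" "F X \<in> bounded_ops (Ho X) (Ho X)"
    "F Y \<in> bounded_ops (Ho Y) (Ho Y)" "complex_vector.subspace (Ho X)" "complex_vector.subspace (Ho Y)"
  shows "gcomm F k X Y T \<in> bounded_ops (Ho X) (Ho Y)"
  unfolding gcomm_def
  by (intro bounded_ops_diff bounded_ops_scaleC bounded_ops_comp [OF assms(3,1,5)]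
      bounded_ops_comp [OF assms(1,2,4)] assms(5))

lemma gcomm_comp:
  assumes g: "g \<in> bounded_ops (Ho Y) (Ho Z)" and f: "f \<in> bounded_ops (Ho X) (Ho Y)"
    and F: "F X \<in> bounded_ops (Ho X) (Ho X)" "F Y \<in> bounded_ops (Ho Y) (Ho Y)"
    and H: "complex_vector.subspace (Ho X)" "complex_vector.subspace (Ho Y)"
  shows "gcomm F (i + j) X Z (g \<circ> f)
    = (gcomm F i Y Z g \<circ> f) + (- 1) ^ i *\<^sub>C (g \<circ> gcomm F j X Y f)"
proof -
  have "g \<circ> gcomm F j X Y f = (g \<circ> (F Y \<circ> f)) - (- 1) ^ j *\<^sub>C (g \<circ> (f \<circ> F X))"
    unfolding gcomm_def
      comp_diff_right [OF g bounded_ops_comp [OF F(2) f H(2)]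
        bounded_ops_scaleC [OF bounded_ops_comp [OF f F(1) H(1)] H(2)] H(2)]
      comp_scaleC_right [OF g bounded_ops_comp [OF f F(1) H(1)] H(2)] ..
  then show ?thesis
    unfolding gcomm_def comp_diff_left comp_scaleC_left
    by (simp add: complex_vector.scale_right_diff_distrib scaleC_scaleC power_add comp_assoc)
qed

text \<open>Since \<open>F\<close> squares to the identity, both sides equal \<open>T\<close> minus
  \<open>(- 1) ^ k\<close> times \<open>F T F\<close>. This single relation yields both the
  vanishing of the second differential and the signs in the trace identities.\<close>

lemma gcomm_anticommute:
  assumes T: "T \<in> bounded_ops (Ho X) (Ho Y)"
    and F: "F X \<in> bounded_ops (Ho X) (Ho X)" "F Y \<in> bounded_ops (Ho Y) (Ho Y)"
    and sq: "F X \<circ> F X = id_op (Ho X)" "F Y \<circ> F Y = id_op (Ho Y)"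
    and H: "complex_vector.subspace (Ho X)" "complex_vector.subspace (Ho Y)"
  shows "F Y \<circ> gcomm F k X Y T = (- 1) ^ Suc k *\<^sub>C (gcomm F k X Y T \<circ> F X)"
proof -
  have 1: "F Y \<circ> (F Y \<circ> T) = T"
    unfolding comp_assoc [symmetric] sq(2) by (rule id_op_comp [OF T])
  have 2: "T \<circ> F X \<circ> F X = T"
    unfolding comp_assoc sq(1) by (rule comp_id_op [OF H(1) T])
  have "F Y \<circ> gcomm F k X Y T = T - (- 1) ^ k *\<^sub>C (F Y \<circ> (T \<circ> F X))"
    unfolding gcomm_def
      comp_diff_right [OF F(2) bounded_ops_comp [OF F(2) T H(2)]
        bounded_ops_scaleC [OF bounded_ops_comp [OF T F(1) H(1)] H(2)] H(2)]
      comp_scaleC_right [OF F(2) bounded_ops_comp [OF T F(1) H(1)] H(2)] 1 ..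
  moreover have "gcomm F k X Y T \<circ> F X = (F Y \<circ> (T \<circ> F X)) - (- 1) ^ k *\<^sub>C T"
    unfolding gcomm_def comp_diff_left comp_scaleC_left 2 by (simp add: comp_assoc)
  ultimately show ?thesis
    by (simp add: complex_vector.scale_right_diff_distrib scaleC_scaleC sign_comp_square
        scaleC_one)
qed

text \<open>The integer \<open>m\<close> is eliminated: with \<open>n\<close> = 2m - 1 the exponent
  of a single commutator is \<open>Suc n\<close>, and the oddness of \<open>n\<close> is what the
  sign computations use.\<close>

locale summable_fredholm_module =
  odd_fredholm_module C Ho Hm p F + clinear_category C
  for C :: "('o, 'a::complex_vector) semicat"
    and Ho :: "'o \<Rightarrow> 'h::complex_inner set" and Hm :: "'o \<Rightarrow> 'o \<Rightarrow> 'a \<Rightarrow> 'h \<Rightarrow> 'h"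
    and p :: real and F :: "'o \<Rightarrow> 'h \<Rightarrow> 'h" +
  fixes n :: nat
  assumes p_ge_1: "1 \<le> p" and p_le: "p \<le> real (Suc n)" and n_odd: "odd n"
begin

abbreviation Om :: "nat \<Rightarrow> 'o \<Rightarrow> 'o \<Rightarrow> ('h \<Rightarrow> 'h) set" where
  "Om k X Y \<equiv> complex_vector.span (omega_generators C Ho Hm F k X Y)"

abbreviation cprod where "cprod \<equiv> comm_prod Ho Hm F"

definition dm :: "'o \<Rightarrow> 'o \<Rightarrow> 'a \<Rightarrow> 'h \<Rightarrow> 'h" where
  "dm X Y f = (F Y \<circ> Hm X Y f) - (Hm X Y f \<circ> F X)"

lemma subspace_Ho: "X \<in> Ob C \<Longrightarrow> complex_vector.subspace (Ho X)"
  and complete_Ho: "X \<in> Ob C \<Longrightarrow> complete (Ho X)"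
  using fun_ob by (auto simp: SHilb_def sep_hilbert_def)

lemma Hm_bounded:
  "X \<in> Ob C \<Longrightarrow> Y \<in> Ob C \<Longrightarrow> f \<in> Hom C X Y \<Longrightarrow> Hm X Y f \<in> bounded_ops (Ho X) (Ho Y)"
  using fun_hom by (auto simp: SHilb_def)

lemma Hm_add:
  "X \<in> Ob C \<Longrightarrow> Y \<in> Ob C \<Longrightarrow> f \<in> Hom C X Y \<Longrightarrow> g \<in> Hom C X Y \<Longrightarrow> Hm X Y (f + g) = Hm X Y f + Hm X Y g"
  using clinear_onD(1) [OF fun_linear] .

lemma Hm_scaleC:
  "X \<in> Ob C \<Longrightarrow> Y \<in> Ob C \<Longrightarrow> f \<in> Hom C X Y \<Longrightarrow> Hm X Y (c *\<^sub>C f) = c *\<^sub>C Hm X Y f"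
  using clinear_onD(2) [OF fun_linear] .

lemma Hm_0: "X \<in> Ob C \<Longrightarrow> Y \<in> Ob C \<Longrightarrow> Hm X Y 0 = 0"
  using clinear_on_0 [OF fun_linear hom_subspace] .

lemma Hm_cmp:
  "\<lbrakk>X \<in> Ob C; Y \<in> Ob C; Z \<in> Ob C; g \<in> Hom C Y Z; f \<in> Hom C X Y\<rbrakk> \<Longrightarrow>
    Hm X Z (Cmp C X Y Z g f) = Hm Y Z g \<circ> Hm X Y f"
  using fun_cmp by (simp add: SHilb_def)

lemma dm_gcomm: "dm X Y f = gcomm F 0 X Y (Hm X Y f)"
  by (simp add: dm_def gcomm_def scaleC_one)

lemma dm_bounded:
  "X \<in> Ob C \<Longrightarrow> Y \<in> Ob C \<Longrightarrow> f \<in> Hom C X Y \<Longrightarrow> dm X Y f \<in> bounded_ops (Ho X) (Ho Y)"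
  unfolding dm_gcomm by (intro gcomm_bounded Hm_bounded F_bounded subspace_Ho)

lemma dm_linear:
  assumes "X \<in> Ob C" "Y \<in> Ob C"
  shows "clinear_on (Hom C X Y) (dm X Y)"
  unfolding clinear_on_def dm_gcomm
proof (intro conjI ballI allI)
  fix f g assume "f \<in> Hom C X Y" "g \<in> Hom C X Y"
  with assms show "gcomm F 0 X Y (Hm X Y (f + g)) = gcomm F 0 X Y (Hm X Y f) + gcomm F 0 X Y (Hm X Y g)"
    unfolding Hm_add [OF assms \<open>f \<in> Hom C X Y\<close> \<open>g \<in> Hom C X Y\<close>]
    by (intro gcomm_add [where Ho = Ho] Hm_bounded F_bounded subspace_Ho)
next
  fix c f assume "f \<in> Hom C X Y"
  with assms show "gcomm F 0 X Y (Hm X Y (c *\<^sub>C f)) = c *\<^sub>C gcomm F 0 X Y (Hm X Y f)"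
    unfolding Hm_scaleC [OF assms \<open>f \<in> Hom C X Y\<close>]
    by (intro gcomm_scaleC [where Ho = Ho] Hm_bounded F_bounded subspace_Ho)
qed

lemma dm_cmp:
  assumes "X \<in> Ob C" "Y \<in> Ob C" "Z \<in> Ob C" "g \<in> Hom C Y Z" "f \<in> Hom C X Y"
  shows "dm X Z (Cmp C X Y Z g f) = (dm Y Z g \<circ> Hm X Y f) + (Hm Y Z g \<circ> dm X Y f)"
  using gcomm_comp [of "Hm Y Z g" Ho Y Z "Hm X Y f" X F 0 0] assms
  by (simp add: dm_gcomm Hm_cmp Hm_bounded F_bounded subspace_Ho scaleC_one)

lemma dm_anticommute:
  assumes "X \<in> Ob C" "Y \<in> Ob C" "f \<in> Hom C X Y"
  shows "F Y \<circ> dm X Y f = - 1 *\<^sub>C (dm X Y f \<circ> F X)"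
  using gcomm_anticommute [of "Hm X Y f" Ho X Y F 0] assms
  by (simp add: dm_gcomm Hm_bounded F_bounded F_square subspace_Ho)

lemma dm_approx_class:
  assumes "X \<in> Ob C" "Y \<in> Ob C" "f \<in> Hom C X Y"
  shows "dm X Y f \<in> approx_class (real (Suc n)) (Ho X) (Ho Y)"
proof -
  have "dm X Y f \<in> approx_class p (Ho X) (Ho Y)"
    unfolding dm_def using assms
    by (intro schatten_approx_class commutator_schatten subspace_Ho complete_Ho)
  then show ?thesis by (rule approx_class_mono) (use p_ge_1 p_le in auto)
qed

lemma cprod_single: "cprod [X] [] = id_op (Ho X)"
  by simp

lemma cprod_Cons: "Zs \<noteq> [] \<Longrightarrow> cprod (X # Zs) (f # gs) = dm (hd Zs) X f \<circ> cprod Zs gs"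
  by (cases Zs) (simp_all add: dm_def)

declare comm_prod.simps [simp del]

lemma cprod_bounded:
  "composable C Xs fs \<Longrightarrow> cprod Xs fs \<in> bounded_ops (Ho (last Xs)) (Ho (hd Xs))"
proof (induction rule: composable_induct)
  case (single X)
  then show ?case by (simp add: cprod_single id_op_bounded subspace_Ho)
next
  case (Cons X Zs f gs)
  then have "dm (hd Zs) X f \<circ> cprod Zs gs \<in> bounded_ops (Ho (last Zs)) (Ho X)"
    by (intro bounded_ops_comp [OF dm_bounded _ subspace_Ho])
  with Cons.hyps(2) show ?case by (simp only: cprod_Cons list.sel last_ConsR not_False_eq_True)
qed

lemma cprod_append:
  assumes "composable C (As @ [X]) fs" "composable C (X # Bs) gs"
  shows "cprod (As @ X # Bs) (fs @ gs) = cprod (As @ [X]) fs \<circ> cprod (X # Bs) gs"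
proof -
  have "length As = length fs" using composable_ends(4) [OF assms(1)] by simp
  then show ?thesis using assms(1)
  proof (induction As fs rule: list_induct2)
    case Nil
    show ?case
      using id_op_comp [OF cprod_bounded [OF assms(2)]] by (simp add: cprod_single)
  next
    case (Cons A As f fs)
    then have "cprod (As @ X # Bs) (fs @ gs) = cprod (As @ [X]) fs \<circ> cprod (X # Bs) gs"
      unfolding append_Cons composable_Cons by blast
    moreover have "hd (As @ X # Bs) = hd (As @ [X])" by (cases As) simp_all
    ultimately show ?case by (simp only: append_Cons cprod_Cons append_is_Nil_conv list.distinct
          simp_thms comp_assoc)
  qed
qed

text \<open>Every factor anticommutes with \<open>F\<close>, so moving \<open>F\<close> through the
  product costs one sign per factor. In other words, products of commutators are closed.\<close>

lemma cprod_F: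
  "composable C Xs fs \<Longrightarrow>
    F (hd Xs) \<circ> cprod Xs fs = (- 1) ^ length fs *\<^sub>C (cprod Xs fs \<circ> F (last Xs))"
proof (induction rule: composable_induct)
  case (single X)
  then show ?case
    using comp_id_op [OF subspace_Ho F_bounded] id_op_comp [OF F_bounded]
    by (simp add: cprod_single scaleC_one)
next
  case (Cons X Zs f gs)
  let ?Y = "hd Zs" and ?P = "cprod Zs gs"
  note ob = Cons.hyps(1,3) composable_ends(3) [OF Cons.hyps(5)]
  have b: "?P \<circ> F (last Zs) \<in> bounded_ops (Ho (last Zs)) (Ho ?Y)"
    by (intro bounded_ops_comp [OF cprod_bounded [OF Cons.hyps(5)] F_bounded subspace_Ho] ob)
  have "F X \<circ> (dm ?Y X f \<circ> ?P) = - 1 *\<^sub>C (dm ?Y X f \<circ> (F ?Y \<circ> ?P))"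
    unfolding comp_assoc [symmetric] dm_anticommute [OF ob(2,1) Cons.hyps(4)] comp_scaleC_left ..
  also have "dm ?Y X f \<circ> (F ?Y \<circ> ?P) = (- 1) ^ length gs *\<^sub>C (dm ?Y X f \<circ> (?P \<circ> F (last Zs)))"
    unfolding Cons.IH by (rule comp_scaleC_right [OF dm_bounded [OF ob(2,1) Cons.hyps(4)] b subspace_Ho [OF ob(2)]])
  finally have "F X \<circ> (dm ?Y X f \<circ> ?P) =
      (- 1) ^ length (f # gs) *\<^sub>C (dm ?Y X f \<circ> (?P \<circ> F (last Zs)))"
    by (simp only: scaleC_scaleC list.size power_Suc add_Suc_right add_0_right)
  with Cons.hyps(2) show ?case
    by (simp only: cprod_Cons list.sel last_ConsR simp_thms comp_assoc)
qed

text \<open>The reciprocals of the exponents add under composition, each factor contributing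
  \<open>1 / Suc n\<close>. The empty product is excluded because the identity operator is only
  bounded.\<close>

lemma cprod_approx_class:
  "composable C Xs fs \<Longrightarrow> fs \<noteq> [] \<Longrightarrow>
    cprod Xs fs \<in> approx_class (real (Suc n) / real (length fs)) (Ho (last Xs)) (Ho (hd Xs))"
proof (induction rule: composable_induct)
  case (single X)
  then show ?case by simp
next
  case (Cons X Zs f gs)
  note d = dm_approx_class [OF Cons.hyps(3,1,4)]
  show ?case
  proof (cases "gs = []")
    case True
    then obtain Y where Y: "Zs = [Y]"
      using composable_ends(4) [OF Cons.hyps(5)] by (cases Zs) auto
    then have "cprod (X # Zs) (f # gs) = dm Y X f"
      using comp_id_op [OF subspace_Ho [OF Cons.hyps(3)] dm_bounded [OF Cons.hyps(3,1,4)]]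
      unfolding Y True by (simp add: cprod_Cons cprod_single)
    then show ?thesis using d True Y by simp
  next
    case False
    have "dm (hd Zs) X f \<circ> cprod Zs gs \<in>
      approx_class (real (Suc n) / real (Suc (length gs))) (Ho (last Zs)) (Ho X)"
    proof (rule approx_class_comp [OF d Cons.IH [OF False]])
      show "0 < real (Suc n) / real (length gs)" using False by (intro divide_pos_pos) simp_all
      show "1 / (real (Suc n) / real (Suc (length gs)))
          = 1 / real (Suc n) + 1 / (real (Suc n) / real (length gs))"
        using False by (simp add: field_simps)
    qed (use Cons.hyps in \<open>simp_all add: subspace_Ho\<close>)
    then show ?thesis using Cons.hyps(2) by (simp add: cprod_Cons)
  qed
qed


section \<open>The semicategory of the cycle\<close>

lemma Om_subspace: "complex_vector.subspace (Om k X Y)"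
  by (rule complex_vector.subspace_span)

lemma Hm_cprod_in_Om:
  assumes "composable C Xs fs" "Y \<in> Ob C" "f \<in> Hom C (hd Xs) Y"
  shows "Hm (hd Xs) Y f \<circ> cprod Xs fs \<in> Om (length fs) (last Xs) Y"
proof -
  have "(Hm (hd Xs) Y f + 0 *\<^sub>C id_op (Ho Y)) \<circ> cprod Xs fs \<in>
    omega_generators C Ho Hm F (length fs) (last Xs) Y"
    unfolding omega_generators_def using assms by blast
  then show ?thesis by (auto dest: complex_vector.span_base)
qed

lemma cprod_in_Om:
  assumes "composable C Xs fs"
  shows "cprod Xs fs \<in> Om (length fs) (last Xs) (hd Xs)"
proof -
  note X = composable_ends(2) [OF assms]
  have "(Hm (hd Xs) (hd Xs) 0 + 1 *\<^sub>C id_op (Ho (hd Xs))) \<circ> cprod Xs fs \<in>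
    omega_generators C Ho Hm F (length fs) (last Xs) (hd Xs)"
    unfolding omega_generators_def using assms complex_vector.subspace_0 [OF hom_subspace [OF X X]] by blast
  then have "id_op (Ho (hd Xs)) \<circ> cprod Xs fs \<in> Om (length fs) (last Xs) (hd Xs)"
    by (auto simp: Hm_0 [OF X X] scaleC_one dest: complex_vector.span_base)
  then show ?thesis unfolding id_op_comp [OF cprod_bounded [OF assms]] .
qed

text \<open>Induction over the span. Splitting off the scalar \<open>\<mu>\<close> leaves two kinds
  of generators, products of commutators with and without a leading morphism.\<close>

lemma Om_subset:
  assumes V: "complex_vector.subspace V" and Y: "Y \<in> Ob C"
    and 1: "\<And>Xs fs f. \<lbrakk>composable C Xs fs; length fs = k; last Xs = X; f \<in> Hom C (hd Xs) Y\<rbrakk> \<Longrightarrow>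
      Hm (hd Xs) Y f \<circ> cprod Xs fs \<in> V"
    and 2: "\<And>Xs fs. \<lbrakk>composable C Xs fs; length fs = k; last Xs = X; hd Xs = Y\<rbrakk> \<Longrightarrow>
      cprod Xs fs \<in> V"
  shows "Om k X Y \<subseteq> V"
proof (rule complex_vector.span_minimal [OF _ V], rule subsetI)
  fix T assume "T \<in> omega_generators C Ho Hm F k X Y"
  then obtain Xs fs f \<mu> where T: "T = (Hm (hd Xs) Y f + \<mu> *\<^sub>C id_op (Ho Y)) \<circ> cprod Xs fs"
    and *: "composable C Xs fs" "length fs = k" "last Xs = X" "f \<in> Hom C (hd Xs) Y"
    and \<mu>: "\<mu> = 0 \<or> hd Xs = Y"
    unfolding omega_generators_def by blast
  have "\<mu> *\<^sub>C (id_op (Ho Y) \<circ> cprod Xs fs) \<in> V"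
  proof (cases "\<mu> = 0")
    case True
    then show ?thesis by (simp add: complex_vector.subspace_0 [OF V])
  next
    case False
    with \<mu> have hd: "hd Xs = Y" by simp
    then have "id_op (Ho Y) \<circ> cprod Xs fs = cprod Xs fs"
      using id_op_comp [OF cprod_bounded [OF *(1)]] by simp
    then show ?thesis using 2 [OF *(1-3) hd] complex_vector.subspace_scale [OF V] by simp
  qed
  then show "T \<in> V"
    unfolding T comp_add_left comp_scaleC_left
    by (intro complex_vector.subspace_add [OF V] 1 *)
qed

lemma Om_bounded:
  assumes "X \<in> Ob C" "Y \<in> Ob C"
  shows "Om k X Y \<subseteq> bounded_ops (Ho X) (Ho Y)"
proof (rule Om_subset [OF bounded_ops_subspace [OF subspace_Ho [OF assms(2)]] assms(2)])
  fix Xs fs assume *: "composable C Xs fs" "length fs = k" "last Xs = X"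
  note ob = composable_ends(2) [OF *(1)]
  show "Hm (hd Xs) Y f \<circ> cprod Xs fs \<in> bounded_ops (Ho X) (Ho Y)" if "f \<in> Hom C (hd Xs) Y" for f
    using bounded_ops_comp [OF Hm_bounded [OF ob assms(2) that] cprod_bounded [OF *(1)] subspace_Ho [OF ob]] *(3)
    by simp
  show "cprod Xs fs \<in> bounded_ops (Ho X) (Ho Y)" if "hd Xs = Y"
    using cprod_bounded [OF *(1)] that *(3) by simp
qed

lemmas Om_boundedD = subsetD [OF Om_bounded]

text \<open>Such sets serve as \<open>V\<close> in \<open>Om_subset\<close>. Boundedness is part of
  them because composition with \<open>B\<close> on the left is linear only on operators with values
  in \<open>H2\<close>.\<close>

lemma left_comp_preimage_subspace:
  fixes H1 H2 H3 :: "'h set"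
  assumes B: "B \<in> bounded_ops H2 H3" and H2: "complex_vector.subspace H2"
    and V: "complex_vector.subspace V"
  shows "complex_vector.subspace {T \<in> bounded_ops H1 H2. B \<circ> T \<in> V}"
  unfolding complex_vector.subspace_def
proof (intro conjI ballI allI)
  have "B \<circ> (0 :: 'h \<Rightarrow> 'h) = 0"
    using clinear_on_0 [OF bounded_opsD(3) [OF B] H2] by (auto simp: fun_eq_iff comp_apply)
  then show "0 \<in> {T \<in> bounded_ops H1 H2. B \<circ> T \<in> V}"
    using complex_vector.subspace_0 [OF V] H2 by simp
  show "S + T \<in> {T \<in> bounded_ops H1 H2. B \<circ> T \<in> V}"
    if "S \<in> {T \<in> bounded_ops H1 H2. B \<circ> T \<in> V}" "T \<in> {T \<in> bounded_ops H1 H2. B \<circ> T \<in> V}" for S T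
    using that by (simp add: comp_add_right [OF B _ _ H2, of _ H1] bounded_ops_add [OF _ _ H2]
        complex_vector.subspace_add [OF V])
  show "c *\<^sub>C T \<in> {T \<in> bounded_ops H1 H2. B \<circ> T \<in> V}"
    if "T \<in> {T \<in> bounded_ops H1 H2. B \<circ> T \<in> V}" for c T
    using that by (simp add: comp_scaleC_right [OF B _ H2, of _ H1] bounded_ops_scaleC [OF _ H2]
        complex_vector.subspace_scale [OF V])
qed

lemma right_comp_preimage_subspace:
  assumes V: "complex_vector.subspace V"
  shows "complex_vector.subspace {T :: 'h \<Rightarrow> 'h. T \<circ> B \<in> V}"
  unfolding complex_vector.subspace_def
proof (intro conjI ballI allI)
  have "(0 :: 'h \<Rightarrow> 'h) \<circ> B = 0" by (simp add: fun_eq_iff comp_apply)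
  then show "0 \<in> {T :: 'h \<Rightarrow> 'h. T \<circ> B \<in> V}"
    using complex_vector.subspace_0 [OF V] by simp
qed (simp_all add: comp_add_left comp_scaleC_left complex_vector.subspace_add [OF V]
    complex_vector.subspace_scale [OF V])

lemma Hm_comp_Om:
  assumes ob: "X \<in> Ob C" "Y \<in> Ob C" "Z \<in> Ob C" and f: "f \<in> Hom C Y Z" and T: "T \<in> Om k X Y"
  shows "Hm Y Z f \<circ> T \<in> Om k X Z"
proof -
  have "Om k X Y \<subseteq> {T \<in> bounded_ops (Ho X) (Ho Y). Hm Y Z f \<circ> T \<in> Om k X Z}"
  proof (rule Om_subset [OF left_comp_preimage_subspace
        [OF Hm_bounded [OF ob(2,3) f] subspace_Ho [OF ob(2)] Om_subspace] ob(2)])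
    fix Xs fs assume *: "composable C Xs fs" "length fs = k" "last Xs = X"
    note h = composable_ends(2) [OF *(1)]
    show "Hm (hd Xs) Y g \<circ> cprod Xs fs \<in> {T \<in> bounded_ops (Ho X) (Ho Y). Hm Y Z f \<circ> T \<in> Om k X Z}"
      if g: "g \<in> Hom C (hd Xs) Y" for g
      using Hm_cprod_in_Om [OF *(1) ob(3) cmp_in_hom [OF h ob(2,3) f g]]
        Om_boundedD [OF ob(1,2)] Hm_cprod_in_Om [OF *(1) ob(2) g] *
      by (auto simp: Hm_cmp [OF h ob(2,3) f g] comp_assoc)
    show "cprod Xs fs \<in> {T \<in> bounded_ops (Ho X) (Ho Y). Hm Y Z f \<circ> T \<in> Om k X Z}"
      if "hd Xs = Y"
      using Hm_cprod_in_Om [OF *(1) ob(3)] cprod_bounded [OF *(1)] f that * by auto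
  qed
  with T show ?thesis by blast
qed

text \<open>The Leibniz rule in the form \<open>[F, f] g = [F, f g] - f [F, g]\<close> moves a
  commutator past the leading morphism of a generator; for this reason the span is closed under
  composition.\<close>

lemma dm_comp_Om:
  assumes ob: "X \<in> Ob C" "Y \<in> Ob C" "Z \<in> Ob C" and f: "f \<in> Hom C Y Z" and T: "T \<in> Om k X Y"
  shows "dm Y Z f \<circ> T \<in> Om (Suc k) X Z"
proof -
  have "Om k X Y \<subseteq> {T \<in> bounded_ops (Ho X) (Ho Y). dm Y Z f \<circ> T \<in> Om (Suc k) X Z}"
  proof (rule Om_subset [OF left_comp_preimage_subspace
        [OF dm_bounded [OF ob(2,3) f] subspace_Ho [OF ob(2)] Om_subspace] ob(2)])
    fix Xs fs assume *: "composable C Xs fs" "length fs = k" "last Xs = X"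
    note h = composable_ends(2) [OF *(1)] and ne = composable_ends(1) [OF *(1)]
    have cons: "dm (hd Xs) W g \<circ> cprod Xs fs = cprod (W # Xs) (g # fs)" for W g
      by (simp add: cprod_Cons [OF ne])
    show "Hm (hd Xs) Y g \<circ> cprod Xs fs \<in> {T \<in> bounded_ops (Ho X) (Ho Y). dm Y Z f \<circ> T \<in> Om (Suc k) X Z}"
      if g: "g \<in> Hom C (hd Xs) Y" for g
    proof -
      let ?fg = "Cmp C (hd Xs) Y Z f g"
      have c1: "composable C (Z # Xs) (?fg # fs)"
        using * ob ne cmp_in_hom [OF h ob(2,3) f g] by (simp add: composable_Cons)
      have c2: "composable C (Y # Xs) (g # fs)" using * ob ne g by (simp add: composable_Cons)
      have "cprod (Z # Xs) (?fg # fs) - (Hm Y Z f \<circ> cprod (Y # Xs) (g # fs)) \<in> Om (Suc k) X Z"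
        using cprod_in_Om [OF c1] Hm_cprod_in_Om [OF c2 ob(3)] f * ne
        by (intro complex_vector.span_diff) auto
      also have "cprod (Z # Xs) (?fg # fs) - (Hm Y Z f \<circ> cprod (Y # Xs) (g # fs))
        = dm Y Z f \<circ> (Hm (hd Xs) Y g \<circ> cprod Xs fs)"
        unfolding cons [symmetric] dm_cmp [OF h ob(2,3) f g] comp_add_left
        by (simp add: comp_assoc)
      finally show ?thesis
        using Om_boundedD [OF ob(1,2)] Hm_cprod_in_Om [OF *(1) ob(2) g] * by auto
    qed
    show "cprod Xs fs \<in> {T \<in> bounded_ops (Ho X) (Ho Y). dm Y Z f \<circ> T \<in> Om (Suc k) X Z}"
      if hd: "hd Xs = Y"
    proof -
      have "composable C (Z # Xs) (f # fs)" using * ob ne f hd by (simp add: composable_Cons)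
      from cprod_in_Om [OF this] have "dm Y Z f \<circ> cprod Xs fs \<in> Om (Suc k) X Z"
        using cons [of Z f] hd ne * by simp
      then show ?thesis using cprod_bounded [OF *(1)] hd * by auto
    qed
  qed
  with T show ?thesis by blast
qed

lemma cprod_comp_Om:
  assumes "composable C Xs fs" "X \<in> Ob C" "T \<in> Om k X (last Xs)"
  shows "cprod Xs fs \<circ> T \<in> Om (length fs + k) X (hd Xs)"
  using assms
proof (induction rule: composable_induct)
  case (single Y)
  then show ?case
    using id_op_comp [OF Om_boundedD] by (simp add: cprod_single)
next
  case (Cons Y Zs f gs)
  then have "dm (hd Zs) Y f \<circ> (cprod Zs gs \<circ> T) \<in> Om (Suc (length gs + k)) X Y"
    by (intro dm_comp_Om) auto
  with Cons.hyps(2) show ?case by (simp add: cprod_Cons comp_assoc)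
qed

lemma Om_comp:
  assumes ob: "X \<in> Ob C" "Y \<in> Ob C" "Z \<in> Ob C" and S: "S \<in> Om i Y Z" and T: "T \<in> Om j X Y"
  shows "S \<circ> T \<in> Om (i + j) X Z"
proof -
  have "Om i Y Z \<subseteq> {S. S \<circ> T \<in> Om (i + j) X Z}"
  proof (rule Om_subset [OF right_comp_preimage_subspace [OF Om_subspace] ob(3)])
    fix Xs fs assume *: "composable C Xs fs" "length fs = i" "last Xs = Y"
    note h = composable_ends(2) [OF *(1)]
    have c: "cprod Xs fs \<circ> T \<in> Om (i + j) X (hd Xs)"
      using cprod_comp_Om [OF *(1) ob(1)] T * by simp
    show "Hm (hd Xs) Z f \<circ> cprod Xs fs \<in> {S. S \<circ> T \<in> Om (i + j) X Z}" if "f \<in> Hom C (hd Xs) Z" for f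
      using Hm_comp_Om [OF ob(1) h ob(3) that c] by (simp add: comp_assoc)
    show "cprod Xs fs \<in> {S. S \<circ> T \<in> Om (i + j) X Z}" if "hd Xs = Z"
      using c that by simp
  qed
  with S show ?thesis by blast
qed

text \<open>In the Leibniz rule the second term vanishes because products of commutators are closed,
  so differentiation just turns the leading morphism into one more commutator.\<close>

lemma gcomm_Hm_cprod:
  assumes c: "composable C Xs fs" and Y: "Y \<in> Ob C" and f: "f \<in> Hom C (hd Xs) Y"
  shows "gcomm F (length fs) (last Xs) Y (Hm (hd Xs) Y f \<circ> cprod Xs fs) = cprod (Y # Xs) (f # fs)"
proof -
  note e = composable_ends [OF c]
  have "gcomm F (0 + length fs) (last Xs) Y (Hm (hd Xs) Y f \<circ> cprod Xs fs) =
    (gcomm F 0 (hd Xs) Y (Hm (hd Xs) Y f) \<circ> cprod Xs fs) +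
    (- 1) ^ 0 *\<^sub>C (Hm (hd Xs) Y f \<circ> gcomm F (length fs) (last Xs) (hd Xs) (cprod Xs fs))"
    using e by (intro gcomm_comp [where Ho = Ho] Hm_bounded f Y cprod_bounded [OF c] F_bounded subspace_Ho)
  also have "gcomm F (length fs) (last Xs) (hd Xs) (cprod Xs fs) = 0"
    unfolding gcomm_def cprod_F [OF c] by simp
  also have "Hm (hd Xs) Y f \<circ> 0 = 0"
    using clinear_on_0 [OF bounded_opsD(3) [OF Hm_bounded [OF e(2) Y f]] subspace_Ho [OF e(2)]]
    by (auto simp: fun_eq_iff comp_apply)
  finally show ?thesis using e(1) by (simp add: cprod_Cons dm_gcomm)
qed

lemma gcomm_linear:
  assumes "X \<in> Ob C" "Y \<in> Ob C"
  shows "clinear_on (Om k X Y) (gcomm F j X Y)"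
  unfolding clinear_on_def
  using gcomm_add [of _ Ho X Y _ F j, OF Om_boundedD [OF assms] Om_boundedD [OF assms]
      F_bounded [OF assms(2)] subspace_Ho [OF assms(2)]]
    gcomm_scaleC [of _ Ho X Y F j, OF Om_boundedD [OF assms] F_bounded [OF assms(2)] subspace_Ho [OF assms(2)]]
  by blast

lemma gcomm_in_Om:
  assumes ob: "X \<in> Ob C" "Y \<in> Ob C" and T: "T \<in> Om k X Y"
  shows "gcomm F k X Y T \<in> Om (Suc k) X Y"
proof -
  note b = Om_boundedD [OF ob]
  have 0: "gcomm F k X Y 0 = 0"
    using clinear_on_0 [OF gcomm_linear [OF ob] Om_subspace] .
  have "Om k X Y \<subseteq> {T \<in> Om k X Y. gcomm F k X Y T \<in> Om (Suc k) X Y}"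
  proof (rule Om_subset [OF _ ob(2)])
    show "complex_vector.subspace {T \<in> Om k X Y. gcomm F k X Y T \<in> Om (Suc k) X Y}"
      unfolding complex_vector.subspace_def
      using clinear_onD [OF gcomm_linear [OF ob, of k k]] 0
      by (auto intro: complex_vector.span_add complex_vector.span_scale complex_vector.span_zero)
    fix Xs fs assume *: "composable C Xs fs" "length fs = k" "last Xs = X"
    note e = composable_ends [OF *(1)]
    show "Hm (hd Xs) Y f \<circ> cprod Xs fs \<in> {T \<in> Om k X Y. gcomm F k X Y T \<in> Om (Suc k) X Y}"
      if f: "f \<in> Hom C (hd Xs) Y" for f
    proof -
      have "composable C (Y # Xs) (f # fs)" using * e f ob by (simp add: composable_Cons)
      from cprod_in_Om [OF this] show ?thesis
        using gcomm_Hm_cprod [OF *(1) ob(2) f] Hm_cprod_in_Om [OF *(1) ob(2) f] * e by simp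
    qed
    show "cprod Xs fs \<in> {T \<in> Om k X Y. gcomm F k X Y T \<in> Om (Suc k) X Y}" if "hd Xs = Y"
      using cprod_in_Om [OF *(1)] cprod_F [OF *(1)] * that
      by (simp add: gcomm_def complex_vector.span_zero)
  qed
  with T show ?thesis by blast
qed

lemma gcomm_F:
  assumes ob: "X \<in> Ob C" "Y \<in> Ob C" and T: "T \<in> Om k X Y"
  shows "F Y \<circ> gcomm F k X Y T = (- 1) ^ Suc k *\<^sub>C (gcomm F k X Y T \<circ> F X)"
  by (rule gcomm_anticommute [where Ho = Ho, OF Om_boundedD [OF ob T]])
    (use ob in \<open>simp_all add: F_bounded F_square subspace_Ho\<close>)

lemma Om_leibniz:
  assumes ob: "X \<in> Ob C" "Y \<in> Ob C" "Z \<in> Ob C" and g: "g \<in> Om i Y Z" and f: "f \<in> Om j X Y"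
  shows "gcomm F (i + j) X Z (g \<circ> f)
    = (gcomm F i Y Z g \<circ> f) + (- 1) ^ i *\<^sub>C (g \<circ> gcomm F j X Y f)"
  by (rule gcomm_comp [where Ho = Ho, OF Om_boundedD [OF ob(2,3) g] Om_boundedD [OF ob(1,2) f]])
    (use ob in \<open>simp_all add: F_bounded subspace_Ho\<close>)

lemma Omega_dg_semicategory: "dg_semicategory (Omega C Ho Hm F)"
proof (unfold_locales, unfold Omega_def dg_semicat.simps)
  fix X Y Z W :: 'o and i j k :: nat and g f h :: "'h \<Rightarrow> 'h"
  show "complex_vector.subspace (Om i X Y)" by (rule Om_subspace)
  show "g \<circ> f \<in> Om (i + j) X Z"
    if "X \<in> Ob C" "Y \<in> Ob C" "Z \<in> Ob C" "g \<in> Om i Y Z" "f \<in> Om j X Y"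
    using Om_comp that by blast
  show "clinear_on (Om i Y Z) (\<lambda>g. g \<circ> f)"
    by (simp add: clinear_on_def comp_add_left comp_scaleC_left)
  show "clinear_on (Om j X Y) ((\<circ>) g)"
    if ob: "X \<in> Ob C" "Y \<in> Ob C" "Z \<in> Ob C" and g: "g \<in> Om i Y Z"
    unfolding clinear_on_def
    using comp_add_right [OF Om_boundedD [OF ob(2,3) g] _ _ subspace_Ho [OF ob(2)]]
      comp_scaleC_right [OF Om_boundedD [OF ob(2,3) g] _ subspace_Ho [OF ob(2)]]
      Om_boundedD [OF ob(1,2)] by blast
  show "h \<circ> g \<circ> f = h \<circ> (g \<circ> f)" by (rule comp_assoc)
  show "gcomm F k X Y f \<in> Om (Suc k) X Y" if "X \<in> Ob C" "Y \<in> Ob C" "f \<in> Om k X Y"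
    using gcomm_in_Om that by blast
  show "clinear_on (Om k X Y) (gcomm F k X Y)" if "X \<in> Ob C" "Y \<in> Ob C"
    using gcomm_linear that by blast
  \<comment> \<open>In degree \<open>Suc k\<close>, the relation \<open>gcomm_F\<close> says
    precisely that the graded commutator of \<open>gcomm F k X Y f\<close> with \<open>F\<close>
    vanishes.\<close>
  show "gcomm F (Suc k) X Y (gcomm F k X Y f) = 0" if "X \<in> Ob C" "Y \<in> Ob C" "f \<in> Om k X Y"
    unfolding gcomm_def [of F "Suc k"] gcomm_F [OF that] by simp
  show "gcomm F (i + j) X Z (g \<circ> f)
      = (gcomm F i Y Z g \<circ> f) + (- 1) ^ i *\<^sub>C (g \<circ> gcomm F j X Y f)"
    if "X \<in> Ob C" "Y \<in> Ob C" "Z \<in> Ob C" "g \<in> Om i Y Z" "f \<in> Om j X Y"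
    using Om_leibniz that by simp
qed

lemma Omega_degree_zero_category: "clinear_category (degree_zero (Omega C Ho Hm F))"
proof -
  interpret O: dg_semicategory "Omega C Ho Hm F" by (rule Omega_dg_semicategory)
  \<comment> \<open>The identity operator is the empty product; the scalars \<open>\<mu>\<close> in
    the generators admit it in degree 0.\<close>
  have id: "id_op (Ho X) \<in> Om 0 X X" if "X \<in> Ob C" for X
    using cprod_in_Om [of "[X]" "[]"] that by (simp add: composable_single cprod_single)
  show ?thesis
  proof (unfold_locales, unfold degree_zero_def semicat.simps)
    fix X assume "X \<in> DOb (Omega C Ho Hm F)"
    then have X: "X \<in> Ob C" by (simp add: Omega_def)
    have "is_identity (degree_zero (Omega C Ho Hm F)) X (id_op (Ho X))"
      unfolding is_identity_def degree_zero_def Omega_def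
      using id [OF X] comp_id_op [OF subspace_Ho [OF X] Om_boundedD [OF X]]
        id_op_comp [OF Om_boundedD [OF _ X]] by simp
    then show "\<exists>e. is_identity \<lparr>Ob = DOb (Omega C Ho Hm F), Hom = DHom (Omega C Ho Hm F) 0,
        Cmp = DCmp (Omega C Ho Hm F) 0 0\<rparr> X e"
      unfolding degree_zero_def by blast
  qed (use O.dhom_subspace O.dcmp_in_hom [where i = 0 and j = 0] O.dcmp_linear_left O.dcmp_linear_right
      O.dcmp_assoc [where i = 0 and j = 0 and k = 0] in simp_all)
qed

lemma rho_semifunctor: "clinear_semifunctor C (degree_zero (Omega C Ho Hm F)) id Hm"
proof (unfold_locales, unfold degree_zero_def Omega_def semicat.simps dg_semicat.simps id_apply)
  show "Hm X Y f \<in> Om 0 X Y" if XY: "X \<in> Ob C" "Y \<in> Ob C" "f \<in> Hom C X Y" for X Y f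
    using Hm_cprod_in_Om [of "[X]" "[]" Y f] comp_id_op [OF subspace_Ho [OF XY(1)] Hm_bounded [OF XY]] XY
    by (simp add: composable_single cprod_single)
qed (simp_all add: fun_linear Hm_cmp)

lemma Om_approx_class:
  assumes ob: "X \<in> Ob C" "Y \<in> Ob C" and k: "k > 0"
  shows "Om k X Y \<subseteq> approx_class (real (Suc n) / real k) (Ho X) (Ho Y)"
proof (rule Om_subset [OF approx_class_subspace [OF subspace_Ho [OF ob(2)]] ob(2)])
  show "0 < real (Suc n) / real k" using k by simp
  fix Xs fs assume *: "composable C Xs fs" "length fs = k" "last Xs = X"
  note h = composable_ends(2) [OF *(1)]
  have c: "cprod Xs fs \<in> approx_class (real (Suc n) / real k) (Ho X) (Ho (hd Xs))"
    using cprod_approx_class [OF *(1)] * k by auto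
  show "Hm (hd Xs) Y f \<circ> cprod Xs fs \<in> approx_class (real (Suc n) / real k) (Ho X) (Ho Y)"
    if "f \<in> Hom C (hd Xs) Y" for f
    by (rule approx_class_comp_left [OF c Hm_bounded [OF h ob(2) that] subspace_Ho [OF h]])
  show "cprod Xs fs \<in> approx_class (real (Suc n) / real k) (Ho X) (Ho Y)" if "hd Xs = Y"
    using c that by simp
qed

lemma F_comp_Om_approx_class:
  assumes X: "X \<in> Ob C" and T: "T \<in> Om (Suc n) X X"
  shows "F X \<circ> T \<in> approx_class 1 (Ho X) (Ho X)"
proof -
  have "T \<in> approx_class 1 (Ho X) (Ho X)"
    using Om_approx_class [OF X X, of "Suc n"] T by auto
  then show ?thesis by (rule approx_class_comp_left [OF _ F_bounded [OF X] subspace_Ho [OF X]])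
qed

text \<open>The differential has degree \<open>Suc n\<close>, where the exponent
  \<open>Suc n / Suc n\<close> is 1.\<close>

lemma gcomm_trace_class:
  assumes X: "X \<in> Ob C" and T: "T \<in> Om n X X"
  shows "gcomm F n X X T \<in> trace_class (Ho X) (Ho X)"
proof (rule approx_class_schatten)
  show "gcomm F n X X T \<in> approx_class 1 (Ho X) (Ho X)"
    using Om_approx_class [OF X X, of "Suc n"] gcomm_in_Om [OF X X T] by auto
qed (use X in \<open>simp_all add: subspace_Ho complete_Ho\<close>)

section \<open>The closed graded trace\<close>

abbreviation Tr where "Tr X \<equiv> trace_op (Ho X)"

abbreviation STr where "STr \<equiv> super_trace Ho F n"

lemma Tr_F_add:
  assumes X: "X \<in> Ob C" and "S \<in> Om (Suc n) X X" "T \<in> Om (Suc n) X X"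
  shows "Tr X (F X \<circ> (S + c *\<^sub>C T)) = Tr X (F X \<circ> S) + c * Tr X (F X \<circ> T)"
proof -
  note H = subspace_Ho [OF X] complete_Ho [OF X]
  have cT: "c *\<^sub>C T \<in> Om (Suc n) X X" using assms(3) by (rule complex_vector.span_scale)
  note b = Om_boundedD [OF X X]
  have "F X \<circ> (S + c *\<^sub>C T) = (F X \<circ> S) + c *\<^sub>C (F X \<circ> T)"
    unfolding comp_add_right [OF F_bounded [OF X] b [OF assms(2)] b [OF cT] H(1)]
      comp_scaleC_right [OF F_bounded [OF X] b [OF assms(3)] H(1)] ..
  then show ?thesis
    using trace_op_add [OF H F_comp_Om_approx_class [OF X assms(2)]
        approx_class_scaleC [OF F_comp_Om_approx_class [OF X assms(3)] H(1)]]
      trace_op_scaleC [OF H F_comp_Om_approx_class [OF X assms(3)]] by simp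
qed

lemma STr_linear:
  assumes X: "X \<in> Ob C"
  shows "clinear_on (Om n X X) (STr X)"
proof -
  have lin: "STr X (S + c *\<^sub>C T) = STr X S + c * STr X T" if "S \<in> Om n X X" "T \<in> Om n X X" for S T c
  proof -
    have "gcomm F n X X (S + c *\<^sub>C T) = gcomm F n X X S + c *\<^sub>C gcomm F n X X T"
      unfolding clinear_onD(1) [OF gcomm_linear [OF X X] that(1) complex_vector.span_scale [OF that(2)]]
        clinear_onD(2) [OF gcomm_linear [OF X X] that(2)] ..
    then show ?thesis
      unfolding super_trace_def
      using Tr_F_add [OF X gcomm_in_Om [OF X X that(1)] gcomm_in_Om [OF X X that(2)], of c]
      by (simp add: field_simps)
  qed
  have 0: "STr X 0 = 0"
    using lin [OF complex_vector.span_zero complex_vector.span_zero, of 1] by simp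
  show ?thesis unfolding clinear_on_def
  proof (intro conjI ballI allI)
    show "STr X (S + T) = STr X S + STr X T" if "S \<in> Om n X X" "T \<in> Om n X X" for S T
      using lin [OF that, of 1] by (simp add: scaleC_one)
    show "STr X (c *\<^sub>C T) = c *\<^sub>C STr X T" if "T \<in> Om n X X" for c T
      using lin [OF complex_vector.span_zero that, of c] 0 by (simp add: scaleC_complex_def)
  qed
qed

lemma STr_closed:
  assumes X: "X \<in> Ob C" and T: "T \<in> Om k X X" and "Suc k = n"
  shows "STr X (gcomm F k X X T) = 0"
proof -
  note H = subspace_Ho [OF X] complete_Ho [OF X]
  have "gcomm F n X X (gcomm F k X X T) = 0"
    unfolding assms(3) [symmetric] gcomm_def [of F "Suc k"] gcomm_F [OF X X T] by simp
  then show ?thesis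
    \<comment> \<open>With \<open>S = T = 0\<close> and \<open>c = 1\<close> additivity reads
      \<open>t = t + t\<close>, so the trace of \<open>F X \<circ> 0\<close> is 0.\<close>
    using Tr_F_add [OF X complex_vector.span_zero complex_vector.span_zero, of 1]
    by (simp add: super_trace_def scaleC_one)
qed

text \<open>Move \<open>F\<close> past the differential of \<open>g\<close>, which costs the sign,
  and then commute the factors \<open>\<partial>g\<close> and \<open>F Y \<circ> g'\<close> under
  the trace. The differential has positive degree and is therefore the factor with singular vectors,
  while \<open>g'\<close> may be of degree 0 and merely bounded.\<close>

lemma Tr_F_gcomm_commute:
  assumes ob: "X \<in> Ob C" "Y \<in> Ob C" and g: "g \<in> Om i Y X" and g': "g' \<in> Om j X Y" and "i + j = n"
  shows "Tr X (F X \<circ> (gcomm F i Y X g \<circ> g')) = (- 1) ^ Suc i * Tr Y (F Y \<circ> (g' \<circ> gcomm F i Y X g))"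
proof -
  let ?d = "gcomm F i Y X g"
  have d: "?d \<in> Om (Suc i) Y X" by (rule gcomm_in_Om [OF ob(2,1) g])
  have n: "Suc i + j = Suc n" "j + Suc i = Suc n" using assms(5) by simp_all
  have dg: "?d \<circ> g' \<in> Om (Suc n) X X" using Om_comp [OF ob(1,2,1) d g'] unfolding n .
  have gd: "g' \<circ> ?d \<in> Om (Suc n) Y Y" using Om_comp [OF ob(2,1,2) g' d] unfolding n .
  note bd = Om_boundedD [OF ob(2,1) d] and bg = Om_boundedD [OF ob(1,2) g']
  have B: "F Y \<circ> g' \<in> bounded_ops (Ho X) (Ho Y)"
    by (rule bounded_ops_comp [OF F_bounded [OF ob(2)] bg subspace_Ho [OF ob(2)]])
  have eq: "F X \<circ> (?d \<circ> g') = (- 1) ^ Suc i *\<^sub>C (?d \<circ> (F Y \<circ> g'))"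
    unfolding comp_assoc [symmetric] gcomm_F [OF ob(2,1) g] comp_scaleC_left ..
  \<comment> \<open>The product \<open>F X \<circ> (?d \<circ> g')\<close> is trace class for degree
    reasons and differs from this operator by a sign only; scaling by the same sign once more
    removes it.\<close>
  have AB: "?d \<circ> (F Y \<circ> g') \<in> approx_class 1 (Ho X) (Ho X)"
    using approx_class_scaleC [OF F_comp_Om_approx_class [OF ob(1) dg] subspace_Ho [OF ob(1)],
        of "(- 1) ^ Suc i"]
    unfolding eq scaleC_scaleC sign_comp_square scaleC_one .
  have BA: "(F Y \<circ> g') \<circ> ?d \<in> approx_class 1 (Ho Y) (Ho Y)"
    using F_comp_Om_approx_class [OF ob(2) gd] by (simp add: comp_assoc)
  have A: "?d \<in> approx_class (real (Suc n) / real (Suc i)) (Ho Y) (Ho X)"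
    using Om_approx_class [OF ob(2,1), of "Suc i"] d by blast
  have q: "0 < real (Suc n) / real (Suc i)" by simp
  have "Tr X (?d \<circ> (F Y \<circ> g')) = Tr Y ((F Y \<circ> g') \<circ> ?d)"
    by (rule trace_op_comp_commute [OF subspace_Ho [OF ob(2)] complete_Ho [OF ob(2)]
          subspace_Ho [OF ob(1)] complete_Ho [OF ob(1)] A q B AB BA])
  then show ?thesis
    unfolding eq trace_op_scaleC [OF subspace_Ho [OF ob(1)] complete_Ho [OF ob(1)] AB]
    by (simp only: comp_assoc)
qed

text \<open>By the Leibniz rule and \<open>Tr_F_gcomm_commute\<close>, both sides are combinations
  of the same two traces \<open>U\<close> and \<open>V\<close>. As \<open>i + j\<close> is odd,
  exactly one of the degrees is even, so \<open>i * j\<close> is even and the remaining signs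
  agree.\<close>

lemma STr_graded:
  assumes ob: "X \<in> Ob C" "Y \<in> Ob C" and g: "g \<in> Om i Y X" and g': "g' \<in> Om j X Y" and ij: "i + j = n"
  shows "STr X (g \<circ> g') = (- 1) ^ (i * j) * STr Y (g' \<circ> g)"
proof -
  have ji: "j + i = n" using ij by simp
  have n: "Suc i + j = Suc n" "i + Suc j = Suc n" "Suc j + i = Suc n" "j + Suc i = Suc n"
    using ij by simp_all
  let ?d = "gcomm F i Y X g" and ?d' = "gcomm F j X Y g'"
  have d: "?d \<in> Om (Suc i) Y X" and d': "?d' \<in> Om (Suc j) X Y"
    using gcomm_in_Om ob g g' by blast+
  have m: "?d \<circ> g' \<in> Om (Suc n) X X" "g \<circ> ?d' \<in> Om (Suc n) X X"
    "?d' \<circ> g \<in> Om (Suc n) Y Y" "g' \<circ> ?d \<in> Om (Suc n) Y Y"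
    using Om_comp [OF ob(1,2,1) d g'] Om_comp [OF ob(1,2,1) g d']
      Om_comp [OF ob(2,1,2) d' g] Om_comp [OF ob(2,1,2) g' d] unfolding n by simp_all
  define U V where "U = Tr X (F X \<circ> (g \<circ> ?d'))" and "V = Tr Y (F Y \<circ> (g' \<circ> ?d))"
  have 1: "2 * STr X (g \<circ> g') = (- 1) ^ Suc i * V + (- 1) ^ i * U"
    unfolding super_trace_def ij [symmetric] Om_leibniz [OF ob(1,2,1) g g']
      Tr_F_add [OF ob(1) m(1,2)] Tr_F_gcomm_commute [OF ob g g' ij] U_def V_def by simp
  have 2: "2 * STr Y (g' \<circ> g) = (- 1) ^ Suc j * U + (- 1) ^ j * V"
    unfolding super_trace_def ji [symmetric] Om_leibniz [OF ob(2,1,2) g' g]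
      Tr_F_add [OF ob(2) m(3,4)] Tr_F_gcomm_commute [OF ob(2,1) g' g ji] U_def V_def by simp
  have "2 * STr X (g \<circ> g') = (- 1) ^ (i * j) * (2 * STr Y (g' \<circ> g))"
    unfolding 1 2
  proof (cases "even i")
    case True
    then have "odd j" using n_odd ij by auto
    with True show "(- 1) ^ Suc i * V + (- 1) ^ i * U =
      (- 1) ^ (i * j) * ((- 1) ^ Suc j * U + (- 1) ^ j * V)" by simp
  next
    case False
    then have "even j" using n_odd ij by auto
    with False show "(- 1) ^ Suc i * V + (- 1) ^ i * U =
      (- 1) ^ (i * j) * ((- 1) ^ Suc j * U + (- 1) ^ j * V)" by simp
  qed
  then show ?thesis by simp
qed

theorem Omega_cycle: "is_cycle_over C n (Omega C Ho Hm F) STr id Hm"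
  unfolding is_cycle_over_def closed_graded_trace_def
proof (intro conjI Omega_dg_semicategory Omega_degree_zero_category rho_semifunctor)
  show "\<forall>X\<in>DOb (Omega C Ho Hm F). clinear_on (DHom (Omega C Ho Hm F) n X X) (STr X)"
    unfolding Omega_def dg_semicat.simps using STr_linear by blast
  show "\<forall>k. \<forall>X\<in>DOb (Omega C Ho Hm F). \<forall>f\<in>DHom (Omega C Ho Hm F) k X X.
      Suc k = n \<longrightarrow> STr X (DDiff (Omega C Ho Hm F) k X X f) = 0"
    unfolding Omega_def dg_semicat.simps using STr_closed by blast
  show "\<forall>i j. \<forall>X\<in>DOb (Omega C Ho Hm F). \<forall>Y\<in>DOb (Omega C Ho Hm F).
      \<forall>g\<in>DHom (Omega C Ho Hm F) i Y X. \<forall>g'\<in>DHom (Omega C Ho Hm F) j X Y. i + j = n \<longrightarrow>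
      STr X (DCmp (Omega C Ho Hm F) i j X Y X g g') =
      (- 1) ^ (i * j) * STr Y (DCmp (Omega C Ho Hm F) j i Y X Y g' g)"
    unfolding Omega_def dg_semicat.simps using STr_graded by blast
qed

end

section \<open>The character of the cycle\<close>

lemma composable_snoc:
  assumes "composable C Zs gs" "gs \<noteq> []"
  obtains As L X hs g where "Zs = As @ [L, X]" "gs = hs @ [g]" "length As = length hs"
    "composable C (As @ [L]) hs" "g \<in> Hom C X L" "X \<in> Ob C" "L \<in> Ob C"
proof -
  obtain hs g where gs: "gs = hs @ [g]" using assms(2) by (meson rev_exhaust)
  have len: "length Zs = Suc (Suc (length hs))" using composable_ends(4) [OF assms(1)] gs by simp
  then obtain Ws X where Ws: "Zs = Ws @ [X]" by (metis length_0_conv nat.distinct(1) rev_exhaust)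
  with len obtain As L where As: "Ws = As @ [L]" by (metis length_append_singleton length_0_conv nat.inject nat.distinct(1) rev_exhaust)
  have Zs: "Zs = As @ L # [X]" using Ws As by simp
  have lenA: "length As = length hs" using len Zs by simp
  from assms(1) have "composable C (As @ [L]) hs" "composable C (L # [X]) [g]"
    unfolding Zs gs composable_append [OF lenA] by blast+
  with Zs gs lenA show thesis
    by (intro that [of As L X hs g]) (simp_all add: composable_Cons composable_single)
qed

lemma clinear_on_compose:
  assumes "clinear_on V u" "\<And>x. x \<in> V \<Longrightarrow> u x \<in> W" "clinear_on W s"
  shows "clinear_on V (\<lambda>x. s (u x))"
  unfolding clinear_on_def
  using clinear_onD [OF assms(1)] clinear_onD [OF assms(3)] assms(2) by simp

text \<open>Algebra of the induction step of \<open>contr_telescope\<close>: one Leibniz term of the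
  first contraction cancels the leading term of the induction hypothesis, the other
  survives.\<close>

lemma telescope_step: "a + b + - (a - c *\<^sub>C x) = b - (- 1 * c) *\<^sub>C x"
  for x :: "'v::complex_vector"
  by simp

context summable_fredholm_module
begin

lemma Hm_in_Om: "X \<in> Ob C \<Longrightarrow> Y \<in> Ob C \<Longrightarrow> f \<in> Hom C X Y \<Longrightarrow> Hm X Y f \<in> Om 0 X Y"
  using clinear_semifunctor.fun_hom [OF rho_semifunctor, of X Y f]
  by (simp add: degree_zero_def Omega_def)

lemma cprod_pair:
  assumes "X \<in> Ob C" "Y \<in> Ob C" "f \<in> Hom C X Y"
  shows "cprod [Y, X] [f] = dm X Y f"
  using comp_id_op [OF subspace_Ho dm_bounded, OF assms(1) assms]
  by (simp add: cprod_Cons cprod_single)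

lemma dm_in_Om:
  assumes "X \<in> Ob C" "Y \<in> Ob C" "f \<in> Hom C X Y"
  shows "dm X Y f \<in> Om 1 X Y"
  using cprod_in_Om [of "[Y, X]" "[f]"] assms
  by (simp add: cprod_pair composable_Cons composable_single)

lemma character_Cons:
  "character_cochain Ho Hm F n (X # Ws) (f # hs)
    = STr X (Hm (hd (Ws @ [X])) X f \<circ> cprod (Ws @ [X]) hs)"
  unfolding character_cochain_def Let_def list.sel ..

lemma cprod_update_linear:
  assumes "composable C Xs fs" "i < length fs"
  shows "clinear_on (Hom C (Xs ! Suc i) (Xs ! i)) (\<lambda>g. cprod Xs (fs[i := g]))"
  using assms
proof (induction arbitrary: i rule: composable_induct)
  case (single X)
  then show ?case by simp
next
  case (Cons X Zs f gs)
  show ?case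
  proof (cases i)
    case 0
    have "clinear_on (Hom C (hd Zs) X) (\<lambda>g. dm (hd Zs) X g \<circ> cprod Zs gs)"
      unfolding clinear_on_def
      using clinear_onD [OF dm_linear [OF Cons.hyps(3,1)]] by (simp add: comp_add_left comp_scaleC_left)
    then show ?thesis using Cons.hyps(2) 0 by (simp add: cprod_Cons hd_conv_nth)
  next
    case (Suc j)
    let ?V = "Hom C (Zs ! Suc j) (Zs ! j)"
    have j: "j < length gs" using Cons.prems Suc by simp
    note ih = clinear_onD [OF Cons.IH [OF j]]
    have b: "cprod Zs (gs[j := g]) \<in> bounded_ops (Ho (last Zs)) (Ho (hd Zs))" if "g \<in> ?V" for g
      by (rule cprod_bounded [OF composable_list_update [OF Cons.hyps(5) that]])
    note d = dm_bounded [OF Cons.hyps(3,1,4)] and s = subspace_Ho [OF Cons.hyps(3)]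
    have "clinear_on ?V (\<lambda>g. dm (hd Zs) X f \<circ> cprod Zs (gs[j := g]))"
      unfolding clinear_on_def
    proof (intro conjI ballI allI)
      fix g h assume gh: "g \<in> ?V" "h \<in> ?V"
      show "dm (hd Zs) X f \<circ> cprod Zs (gs[j := g + h]) =
        (dm (hd Zs) X f \<circ> cprod Zs (gs[j := g])) + (dm (hd Zs) X f \<circ> cprod Zs (gs[j := h]))"
        unfolding ih(1) [OF gh] by (rule comp_add_right [OF d b [OF gh(1)] b [OF gh(2)] s])
    next
      fix c g assume g: "g \<in> ?V"
      show "dm (hd Zs) X f \<circ> cprod Zs (gs[j := c *\<^sub>C g]) = c *\<^sub>C (dm (hd Zs) X f \<circ> cprod Zs (gs[j := g]))"
        unfolding ih(2) [OF g] by (rule comp_scaleC_right [OF d b [OF g] s])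
    qed
    then show ?thesis using Cons.hyps(2) Suc by (simp add: cprod_Cons)
  qed
qed

lemma cyclic_tuple_cases:
  assumes "cyclic_tuple C k Xs fs"
  obtains X Ws f gs where "Xs = X # Ws" "fs = f # gs" "length Ws = k" "length gs = k"
    "composable C (Ws @ [X]) gs" "X \<in> Ob C" "f \<in> Hom C (hd (Ws @ [X])) X"
proof -
  obtain X Ws where X: "Xs = X # Ws" "length Ws = k"
    using assms by (auto simp: cyclic_tuple_def length_Suc_conv)
  obtain f gs where f: "fs = f # gs" "length gs = k"
    using assms by (auto simp: cyclic_tuple_def length_Suc_conv)
  have "composable C (X # (Ws @ [X])) (f # gs)"
    using assms by (simp add: cyclic_tuple_def X f)
  then show thesis unfolding composable_Cons by (intro that [OF X(1) f(1) X(2) f(2)]) simp_all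
qed

lemma character_cochain: "cochain C n (character_cochain Ho Hm F n)"
  unfolding cochain_def
proof (intro allI impI)
  fix Xs fs i assume ct: "cyclic_tuple C n Xs fs" and i: "i \<le> n"
  obtain X Ws f gs where *: "Xs = X # Ws" "fs = f # gs" "length Ws = n" "length gs = n"
    and c: "composable C (Ws @ [X]) gs" and X: "X \<in> Ob C" and f: "f \<in> Hom C (hd (Ws @ [X])) X"
    using cyclic_tuple_cases [OF ct] .
  define Zs where "Zs = Ws @ [X]"
  have cZ: "composable C Zs gs" and fZ: "f \<in> Hom C (hd Zs) X" and lZ: "last Zs = X"
    using c f by (simp_all add: Zs_def)
  note h = composable_ends(2) [OF cZ] and ne = composable_ends(1) [OF cZ]
  show "clinear_on (Hom C ((Xs @ [hd Xs]) ! Suc i) (Xs ! i)) (\<lambda>g. character_cochain Ho Hm F n Xs (fs[i := g]))"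
  proof (cases i)
    case 0
    have "clinear_on (Hom C (hd Zs) X) (\<lambda>g. Hm (hd Zs) X g \<circ> cprod Zs gs)"
      unfolding clinear_on_def
      using clinear_onD [OF fun_linear [OF h X]] by (simp add: comp_add_left comp_scaleC_left)
    moreover have "Hm (hd Zs) X g \<circ> cprod Zs gs \<in> Om n X X" if "g \<in> Hom C (hd Zs) X" for g
      using Hm_cprod_in_Om [OF cZ X that] *(4) lZ by simp
    ultimately have "clinear_on (Hom C (hd Zs) X) (\<lambda>g. STr X (Hm (hd Zs) X g \<circ> cprod Zs gs))"
      by (rule clinear_on_compose [OF _ _ STr_linear [OF X]])
    then show ?thesis using 0 ne
      by (simp add: *(1,2) character_Cons Zs_def [symmetric] hd_conv_nth)
  next
    case (Suc j)
    then have j: "j < length gs" "j < length Ws" using i * by simp_all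
    let ?V = "Hom C (Zs ! Suc j) (Zs ! j)"
    have cu: "composable C Zs (gs[j := g])" if "g \<in> ?V" for g
      by (rule composable_list_update [OF cZ that])
    note lin = clinear_onD [OF cprod_update_linear [OF cZ j(1)]]
    note b = cprod_bounded [OF cu]
    have "clinear_on ?V (\<lambda>g. Hm (hd Zs) X f \<circ> cprod Zs (gs[j := g]))"
      unfolding clinear_on_def
    proof (intro conjI ballI allI)
      fix g g' assume g: "g \<in> ?V" "g' \<in> ?V"
      show "Hm (hd Zs) X f \<circ> cprod Zs (gs[j := g + g']) =
        (Hm (hd Zs) X f \<circ> cprod Zs (gs[j := g])) + (Hm (hd Zs) X f \<circ> cprod Zs (gs[j := g']))"
        unfolding lin(1) [OF g]
        by (rule comp_add_right [OF Hm_bounded [OF h X fZ] b [OF g(1)] b [OF g(2)] subspace_Ho [OF h]])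
    next
      fix a g assume g: "g \<in> ?V"
      show "Hm (hd Zs) X f \<circ> cprod Zs (gs[j := a *\<^sub>C g]) = a *\<^sub>C (Hm (hd Zs) X f \<circ> cprod Zs (gs[j := g]))"
        unfolding lin(2) [OF g]
        by (rule comp_scaleC_right [OF Hm_bounded [OF h X fZ] b [OF g] subspace_Ho [OF h]])
    qed
    moreover have "Hm (hd Zs) X f \<circ> cprod Zs (gs[j := g]) \<in> Om n X X" if "g \<in> ?V" for g
      using Hm_cprod_in_Om [OF cu [OF that] X fZ] *(4) lZ by simp
    ultimately have "clinear_on ?V (\<lambda>g. STr X (Hm (hd Zs) X f \<circ> cprod Zs (gs[j := g])))"
      by (rule clinear_on_compose [OF _ _ STr_linear [OF X]])
    moreover have "(Xs @ [hd Xs]) ! Suc i = Zs ! Suc j" "Xs ! i = Zs ! j"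
      using Suc j by (simp_all add: *(1) Zs_def nth_append)
    ultimately show ?thesis
      using Suc by (simp add: *(1,2) character_Cons Zs_def [symmetric])
  qed
qed

text \<open>With \<open>\<omega> = f\<^sup>0 [F, f\<^sup>1] \<dots> [F, f\<^sup>n\<^sup>-\<^sup>1]\<close>, cyclicity compares the traces of \<open>\<omega> [F, f\<^sup>n]\<close> and
  \<open>f\<^sup>n \<partial>\<omega>\<close>; their relation is that the trace vanishes on \<open>\<partial>(f\<^sup>n \<omega>) = [F, f\<^sup>n] \<omega> + f\<^sup>n \<partial>\<omega>\<close>.\<close>

lemma character_cyclic:
  assumes ct: "cyclic_tuple C n Xs fs"
  shows "cyclic_op n (character_cochain Ho Hm F n) Xs fs = character_cochain Ho Hm F n Xs fs"
proof -
  obtain X Ws f gs where *: "Xs = X # Ws" "fs = f # gs" "length Ws = n" "length gs = n"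
    and c: "composable C (Ws @ [X]) gs" and X: "X \<in> Ob C" and f: "f \<in> Hom C (hd (Ws @ [X])) X"
    using cyclic_tuple_cases [OF ct] .
  have "gs \<noteq> []" using *(4) n_odd by auto
  then obtain As L X' hs g where Z: "Ws @ [X] = As @ [L, X']" and gs: "gs = hs @ [g]"
    and len: "length As = length hs" and cA: "composable C (As @ [L]) hs"
    and g: "g \<in> Hom C X' L" and L: "L \<in> Ob C"
    using composable_snoc [OF c] by metis
  have X': "X' = X" and Ws: "Ws = As @ [L]" using Z by auto
  have g: "g \<in> Hom C X L" using g X' by simp
  define k where "k = length hs"
  have k: "k + 1 = n" "Suc k = n" "0 + k = k" using *(4) gs by (simp_all add: k_def)
  have even_k: "even k" using n_odd k(2) by auto
  have hd: "hd (Ws @ [X]) = hd (As @ [L])" unfolding Ws by (cases As) simp_all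
  have fA: "f \<in> Hom C (hd (As @ [L])) X" using f unfolding hd .
  define w where "w = Hm (hd (As @ [L])) X f \<circ> cprod (As @ [L]) hs"
  have w: "w \<in> Om k L X" unfolding w_def k_def using Hm_cprod_in_Om [OF cA X fA] by simp
  note dg = dm_in_Om [OF X L g]
  have "cprod (Ws @ [X]) gs = cprod (As @ [L]) hs \<circ> dm X L g"
    using cprod_append [OF cA, of "[X]" "[g]"] X L g
    by (simp add: Ws gs cprod_pair composable_Cons composable_single)
  then have "character_cochain Ho Hm F n Xs fs = STr X (w \<circ> dm X L g)"
    unfolding *(1,2) character_Cons hd w_def by (simp only: comp_assoc)
  \<comment> \<open>The sign of the graded trace is \<open>(- 1) ^ (k * 1)\<close>, which is 1
    because \<open>k = n - 1\<close> is even.\<close>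
  also have "\<dots> = STr L (dm X L g \<circ> w)"
    using STr_graded [OF X L w dg k(1)] even_k by simp
  finally have 1: "character_cochain Ho Hm F n Xs fs = STr L (dm X L g \<circ> w)" .
  have dw: "gcomm F k L X w = cprod (X # As @ [L]) (f # hs)"
    using gcomm_Hm_cprod [OF cA X fA] by (simp add: w_def k_def)
  have "last Xs # butlast Xs = L # X # As" "last fs # butlast fs = g # f # hs"
    by (simp_all add: *(1,2) Ws gs)
  then have 2: "character_cochain Ho Hm F n (last Xs # butlast Xs) (last fs # butlast fs)
      = STr L (Hm X L g \<circ> gcomm F k L X w)"
    by (simp only: character_Cons dw append_Cons list.sel)
  have hw: "Hm X L g \<circ> w \<in> Om k L L" by (rule Hm_comp_Om [OF L X L g w])
  have in_Om: "dm X L g \<circ> w \<in> Om n L L" "Hm X L g \<circ> gcomm F k L X w \<in> Om n L L"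
    using Om_comp [OF L X L dg w] Hm_comp_Om [OF L X L g gcomm_in_Om [OF L X w]] k(2) by simp_all
  have "gcomm F k L L (Hm X L g \<circ> w) = (dm X L g \<circ> w) + (Hm X L g \<circ> gcomm F k L X w)"
    using Om_leibniz [OF L X L Hm_in_Om [OF X L g] w] by (simp add: dm_gcomm scaleC_one)
  then have "STr L (dm X L g \<circ> w) + STr L (Hm X L g \<circ> gcomm F k L X w) = 0"
    using STr_closed [OF L hw k(2)] clinear_onD(1) [OF STr_linear [OF L] in_Om] by simp
  \<comment> \<open>As \<open>n\<close> is odd, \<open>cyclic_op\<close> carries the sign -1, and
    the vanishing of the sum is the claim.\<close>
  then show ?thesis
    unfolding cyclic_op_def 1 2 using n_odd by (simp add: neg_eq_iff_add_eq_0 add.commute)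
qed

text \<open>With the leading morphism of a cyclic tuple split off, \<open>contr i\<close> is the
  operator behind the term of index \<open>i + 1\<close> in \<open>hochschild_b\<close>.\<close>

definition contr where
  "contr i Zs gs = cprod (take (Suc i) Zs @ drop (i + 2) Zs)
    (take i gs @ [Cmp C (Zs ! (i + 2)) (Zs ! (i + 1)) (Zs ! i) (gs ! i) (gs ! (i + 1))] @ drop (i + 2) gs)"

lemma contr_composable:
  assumes "composable C Zs gs" "Suc i < length gs"
  shows "composable C (take (Suc i) Zs @ drop (i + 2) Zs)
    (take i gs @ [Cmp C (Zs ! (i + 2)) (Zs ! (i + 1)) (Zs ! i) (gs ! i) (gs ! (i + 1))] @ drop (i + 2) gs)
    \<and> hd (take (Suc i) Zs @ drop (i + 2) Zs) = hd Zs \<and> last (take (Suc i) Zs @ drop (i + 2) Zs) = last Zs"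
  using assms
proof (induction arbitrary: i rule: composable_induct)
  case (single X)
  then show ?case by simp
next
  case (Cons X Zs f gs)
  show ?case
  proof (cases i)
    case 0
    with Cons.prems obtain g hs where gs: "gs = g # hs" by (cases gs) auto
    obtain Y Ws where Zs: "Zs = Y # Ws" using Cons.hyps(2) by (cases Zs) auto
    have c: "Y \<in> Ob C" "Ws \<noteq> []" "g \<in> Hom C (hd Ws) Y" "composable C Ws hs"
      using Cons.hyps(5) by (simp_all add: gs Zs composable_Cons)
    have "Cmp C (hd Ws) Y X f g \<in> Hom C (hd Ws) X"
      using cmp_in_hom [OF composable_ends(2) [OF c(4)] c(1) Cons.hyps(1)] c Cons.hyps(4) by (simp add: Zs)
    then show ?thesis
      using 0 c Cons.hyps(1) by (simp add: gs Zs composable_Cons hd_conv_nth)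
  next
    case (Suc j)
    with Cons.prems have j: "Suc j < length gs" by simp
    have ne: "take (Suc j) Zs @ drop (j + 2) Zs \<noteq> []" using Cons.hyps(2) by simp
    show ?thesis
      using Cons.IH [OF j] Cons.hyps Suc ne by (simp add: composable_Cons)
  qed
qed

lemma contr_bounded:
  "composable C Zs gs \<Longrightarrow> Suc i < length gs \<Longrightarrow> contr i Zs gs \<in> bounded_ops (Ho (last Zs)) (Ho (hd Zs))"
  using cprod_bounded [OF conjunct1 [OF contr_composable]] contr_composable
  unfolding contr_def by (metis (no_types, lifting))

lemma contr_Suc:
  assumes "Zs \<noteq> []"
  shows "contr (Suc i) (X # Zs) (f # gs) = dm (hd Zs) X f \<circ> contr i Zs gs"
proof -
  have "hd (take (Suc i) Zs @ drop (i + 2) Zs) = hd Zs" using assms by (cases Zs) simp_all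
  then show ?thesis using assms by (simp add: contr_def cprod_Cons)
qed

text \<open>Each commutator of a composite splits by Leibniz into two products in which one morphism
  stands undifferentiated, at position \<open>k\<close> or \<open>k + 1\<close>. In the alternating
  sum neighbouring terms cancel, and only those with the first or the last morphism undifferentiated
  remain.\<close>

lemma contr_telescope:
  assumes "composable C Zs gs" "gs \<noteq> []"
  shows "(\<Sum>k<length gs - 1. (- 1) ^ k *\<^sub>C contr k Zs gs) =
    (Hm (hd (tl Zs)) (hd Zs) (hd gs) \<circ> cprod (tl Zs) (tl gs)) -
    (- 1) ^ (length gs - 1) *\<^sub>C (cprod (butlast Zs) (butlast gs) \<circ> Hm (last Zs) (last (butlast Zs)) (last gs))"
  using assms
proof (induction rule: composable_induct)
  case (single X)
  then show ?case by simp
next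
  case (Cons X Zs f gs)
  obtain Y Ws where Zs: "Zs = Y # Ws" using Cons.hyps(2) by (cases Zs) auto
  have Y: "Y \<in> Ob C" and f: "f \<in> Hom C Y X" using Cons.hyps by (simp_all add: Zs)
  note X = Cons.hyps(1)
  show ?case
  proof (cases "gs = []")
    case True
    then have "Ws = []" using composable_ends(4) [OF Cons.hyps(5)] by (simp add: Zs)
    moreover note comp_id_op [OF subspace_Ho [OF Y] Hm_bounded [OF Y X f]] id_op_comp [OF Hm_bounded [OF Y X f]]
    ultimately show ?thesis using True by (simp add: Zs cprod_single scaleC_one)
  next
    case False
    then obtain g hs where gs: "gs = g # hs" by (cases gs) auto
    have c: "Ws \<noteq> []" "g \<in> Hom C (hd Ws) Y" "composable C Ws hs"
      using Cons.hyps(5) by (simp_all add: gs Zs composable_Cons)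
    note W = composable_ends(2) [OF c(3)]
    define N where "N = length hs"
    define P where "P = cprod Ws hs"
    define d where "d = dm Y X f"
    define B where "B = cprod (butlast Zs) (butlast gs) \<circ> Hm (last Zs) (last (butlast Zs)) (last gs)"
    have bd: "d \<in> bounded_ops (Ho Y) (Ho X)" unfolding d_def by (rule dm_bounded [OF Y X f])
    note sY = subspace_Ho [OF Y]
    have bP: "P \<in> bounded_ops (Ho (last Ws)) (Ho (hd Ws))" unfolding P_def by (rule cprod_bounded [OF c(3)])
    have bgP: "Hm (hd Ws) Y g \<circ> P \<in> bounded_ops (Ho (last Ws)) (Ho Y)"
      by (rule bounded_ops_comp [OF Hm_bounded [OF W Y c(2)] bP subspace_Ho [OF W]])
    have bB: "B \<in> bounded_ops (Ho (last Ws)) (Ho Y)"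
    proof -
      obtain As L X' ks k where *: "Zs = As @ [L, X']" "gs = ks @ [k]" "composable C (As @ [L]) ks"
        "k \<in> Hom C X' L" "X' \<in> Ob C" "L \<in> Ob C"
        using composable_snoc [OF Cons.hyps(5) False] by metis
      have h: "hd (As @ [L]) = Y" "last Ws = X'" using *(1) Zs c(1)
        by (cases As; simp)+
      have B: "B = cprod (As @ [L]) ks \<circ> Hm X' L k" unfolding B_def *(1,2) by (simp add: butlast_append)
      have "cprod (As @ [L]) ks \<in> bounded_ops (Ho L) (Ho Y)"
        using cprod_bounded [OF *(3)] h(1) by simp
      then show ?thesis unfolding B h(2)
        by (rule bounded_ops_comp [OF _ Hm_bounded [OF *(5,6,4)] subspace_Ho [OF *(6)]])
    qed
    have bc: "(- 1) ^ k *\<^sub>C contr k Zs gs \<in> bounded_ops (Ho (last Ws)) (Ho Y)" if "k < N" for k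
      using contr_bounded [OF Cons.hyps(5), of k] that c(1) bounded_ops_scaleC [OF _ sY]
      by (simp add: Zs gs N_def)
    have IH: "(\<Sum>k<N. (- 1) ^ k *\<^sub>C contr k Zs gs) = (Hm (hd Ws) Y g \<circ> P) - (- 1) ^ N *\<^sub>C B"
    proof -
      have "length gs - 1 = N" "tl Zs = Ws" "hd Zs = Y" "tl gs = hs" "hd gs = g"
        by (simp_all add: Zs gs N_def)
      then show ?thesis using Cons.IH [OF False] unfolding B_def P_def by (simp only:)
    qed
    have c0: "contr 0 (X # Zs) (f # gs) = (d \<circ> (Hm (hd Ws) Y g \<circ> P)) + (Hm Y X f \<circ> (dm (hd Ws) Y g \<circ> P))"
    proof -
      have "contr 0 (X # Zs) (f # gs) = dm (hd Ws) X (Cmp C (hd Ws) Y X f g) \<circ> P"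
        using c(1) by (simp add: contr_def Zs gs cprod_Cons P_def hd_conv_nth)
      then show ?thesis unfolding dm_cmp [OF W Y X f c(2)] comp_add_left d_def by (simp only: comp_assoc)
    qed
    have "(\<Sum>k<Suc N. (- 1) ^ k *\<^sub>C contr k (X # Zs) (f # gs)) =
      contr 0 (X # Zs) (f # gs) + (\<Sum>k<N. (- 1) ^ Suc k *\<^sub>C (d \<circ> contr k Zs gs))"
      unfolding sum.lessThan_Suc_shift contr_Suc [OF Cons.hyps(2)] d_def
      by (simp add: Zs scaleC_one)
    also have "(\<Sum>k<N. (- 1) ^ Suc k *\<^sub>C (d \<circ> contr k Zs gs)) = - (d \<circ> (\<Sum>k<N. (- 1) ^ k *\<^sub>C contr k Zs gs))"
    proof -
      have "(- 1) ^ Suc k *\<^sub>C (d \<circ> contr k Zs gs) = - (d \<circ> (- 1) ^ k *\<^sub>C contr k Zs gs)" if "k < N" for k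
        using comp_scaleC_right [OF bd _ sY, of "contr k Zs gs" "Ho (last Zs)" "(- 1) ^ k"]
          contr_bounded [OF Cons.hyps(5), of k] that by (simp add: Zs gs N_def)
      then have "(\<Sum>k<N. (- 1) ^ Suc k *\<^sub>C (d \<circ> contr k Zs gs)) = (\<Sum>k<N. - (d \<circ> (- 1) ^ k *\<^sub>C contr k Zs gs))"
        by (intro sum.cong refl) blast
      moreover have "d \<circ> (\<Sum>k<N. (- 1) ^ k *\<^sub>C contr k Zs gs) = (\<Sum>k<N. d \<circ> (- 1) ^ k *\<^sub>C contr k Zs gs)"
        by (rule bounded_comp_sum_right [OF bd _ sY]) (use bc in simp)
      ultimately show ?thesis by (simp only: sum_negf)
    qed
    also have "d \<circ> (\<Sum>k<N. (- 1) ^ k *\<^sub>C contr k Zs gs) = (d \<circ> (Hm (hd Ws) Y g \<circ> P)) - (- 1) ^ N *\<^sub>C (d \<circ> B)"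
      unfolding IH comp_diff_right [OF bd bgP bounded_ops_scaleC [OF bB sY] sY]
        comp_scaleC_right [OF bd bB sY] ..
    also have "contr 0 (X # Zs) (f # gs) + - ((d \<circ> (Hm (hd Ws) Y g \<circ> P)) - (- 1) ^ N *\<^sub>C (d \<circ> B)) =
      (Hm Y X f \<circ> (dm (hd Ws) Y g \<circ> P)) - (- 1) ^ Suc N *\<^sub>C (d \<circ> B)"
      unfolding c0 power_Suc by (rule telescope_step)
    finally have sum: "(\<Sum>k<Suc N. (- 1) ^ k *\<^sub>C contr k (X # Zs) (f # gs)) =
      (Hm Y X f \<circ> (dm (hd Ws) Y g \<circ> P)) - (- 1) ^ Suc N *\<^sub>C (d \<circ> B)" .
    have P': "dm (hd Ws) Y g \<circ> P = cprod Zs gs" using c(1) by (simp add: Zs gs cprod_Cons P_def)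
    have B': "d \<circ> B = cprod (butlast (X # Zs)) (butlast (f # gs)) \<circ>
        Hm (last (X # Zs)) (last (butlast (X # Zs))) (last (f # gs))"
      using c(1) unfolding B_def d_def by (simp add: Zs gs cprod_Cons comp_assoc)
    have "length (f # gs) - 1 = Suc N" "hd Zs = Y" by (simp_all add: Zs gs N_def)
    then show ?thesis using sum unfolding P' B' by (simp only: list.sel)
  qed
qed

text \<open>Term 0 is the trace of \<open>A \<circ> R\<close>. The other inner terms telescope and
  cancel it, leaving \<open>(- 1) ^ n\<close> times the trace of
  \<open>A \<circ> (Q \<circ> G)\<close>, which the cyclic last term, of sign
  \<open>(- 1) ^ (n + 1)\<close>, cancels in turn.\<close>

lemma character_hochschild:
  assumes ct: "cyclic_tuple C (Suc n) Xs fs"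
  shows "hochschild_b C n (character_cochain Ho Hm F n) Xs fs = 0"
proof -
  obtain X Ws f gs where *: "Xs = X # Ws" "fs = f # gs" "length Ws = Suc n" "length gs = Suc n"
    and c: "composable C (Ws @ [X]) gs" and X: "X \<in> Ob C" and f: "f \<in> Hom C (hd (Ws @ [X])) X"
    using cyclic_tuple_cases [OF ct] .
  define Zs where "Zs = Ws @ [X]"
  have cZ: "composable C Zs gs" and fZ: "f \<in> Hom C (hd Zs) X" and lZ: "last Zs = X"
    using c f by (simp_all add: Zs_def)
  have gs0: "gs \<noteq> []" using *(4) by auto
  note h = composable_ends(2) [OF cZ]
  obtain As L X' hs g where Z: "Ws @ [X] = As @ [L, X']" and gs: "gs = hs @ [g]"
    and len: "length As = length hs" and cA: "composable C (As @ [L]) hs"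
    and g: "g \<in> Hom C X' L" and L: "L \<in> Ob C"
    using composable_snoc [OF c gs0] by metis
  have X': "X' = X" and Ws: "Ws = As @ [L]" using Z by auto
  have g: "g \<in> Hom C X L" using g X' by simp
  have hdW: "hd Ws = hd Zs" unfolding Zs_def Ws by (cases As) simp_all
  have lenh: "length hs = n" "length As = n" using *(4) gs len by simp_all
  define A where "A = Hm (hd Zs) X f"
  define Q where "Q = cprod Ws hs"
  define G where "G = Hm X L g"
  define R where "R = Hm (hd (tl Zs)) (hd Zs) (hd gs) \<circ> cprod (tl Zs) (tl gs)"
  let ?\<phi> = "character_cochain Ho Hm F n"
  let ?Ys = "Xs @ [hd Xs]"
  let ?t = "\<lambda>i. ?\<phi> (take (Suc i) Xs @ drop (i + 2) Xs)
    (take i fs @ [Cmp C (?Ys ! (i + 2)) (?Ys ! (i + 1)) (?Ys ! i) (fs ! i) (fs ! (i + 1))] @ drop (i + 2) fs)"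
  have bA: "A \<in> bounded_ops (Ho (hd Zs)) (Ho X)" unfolding A_def by (rule Hm_bounded [OF h X fZ])
  note sh = subspace_Ho [OF h]
  obtain Z1 Zs' g1 gs' where Zs: "Zs = Z1 # Zs'" and gs1: "gs = g1 # gs'"
    using composable_ends(1) [OF cZ] gs0 by (meson list.exhaust)
  have c1: "Z1 \<in> Ob C" "Zs' \<noteq> []" "g1 \<in> Hom C (hd Zs') Z1" "composable C Zs' gs'"
    using cZ unfolding Zs gs1 composable_Cons by auto
  note h1 = composable_ends(2) [OF c1(4)]
  have Ws1: "Ws = Z1 # tl Ws" "tl Ws @ [X] = Zs'"
    using Zs *(3) unfolding Zs_def by (cases Ws; simp)+
  have t0: "?t 0 = STr X (A \<circ> R)"
  proof -
    have "take (Suc 0) Xs @ drop (0 + 2) Xs = X # tl Ws"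
      by (simp add: *(1) drop_Suc)
    moreover have "?Ys ! (0 + 2) = hd Zs'" "?Ys ! (0 + 1) = Z1" "?Ys ! 0 = X"
      using c1(2) Zs unfolding *(1) by (simp_all add: Zs_def [symmetric] hd_conv_nth)
    moreover have "fs ! 0 = f" "fs ! (0 + 1) = g1" "drop (0 + 2) fs = gs'"
      by (simp_all add: *(2) gs1)
    ultimately have "?t 0 = STr X (Hm (hd Zs') X (Cmp C (hd Zs') Z1 X f g1) \<circ> cprod Zs' gs')"
      by (simp only: take_0 append_Nil append_Cons character_Cons Ws1(2))
    also have "Hm (hd Zs') X (Cmp C (hd Zs') Z1 X f g1) = A \<circ> Hm (hd Zs') Z1 g1"
      using Hm_cmp [OF h1 c1(1) X _ c1(3)] fZ by (simp add: A_def Zs)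
    finally show ?thesis by (simp add: R_def Zs gs1 comp_assoc)
  qed
  have tS: "?t (Suc k) = STr X (A \<circ> contr k Zs gs)" if k: "k < n" for k
  proof -
    have Yn: "?Ys ! Suc i = Zs ! i" for i unfolding *(1) by (simp add: Zs_def)
    have "take (Suc (Suc k)) Xs @ drop (Suc k + 2) Xs = X # (take (Suc k) Ws @ drop (k + 2) Ws)"
      by (simp add: *(1))
    moreover have "(take (Suc k) Ws @ drop (k + 2) Ws) @ [X] = take (Suc k) Zs @ drop (k + 2) Zs"
      using k *(3) by (simp add: Zs_def)
    moreover have "hd (take (Suc k) Zs @ drop (k + 2) Zs) = hd Zs" by (simp add: Zs)
    moreover have "take (Suc k) fs @ [Cmp C (?Ys ! (Suc k + 2)) (?Ys ! (Suc k + 1)) (?Ys ! Suc k) (fs ! Suc k) (fs ! (Suc k + 1))] @ drop (Suc k + 2) fs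
      = f # (take k gs @ [Cmp C (Zs ! (k + 2)) (Zs ! (k + 1)) (Zs ! k) (gs ! k) (gs ! (k + 1))] @ drop (k + 2) gs)"
      using Yn [of "k + 2"] Yn [of "k + 1"] Yn [of k] by (simp add: *(2))
    ultimately show ?thesis
      by (simp only: character_Cons contr_def A_def)
  qed
  have inOm: "A \<circ> contr k Zs gs \<in> Om n X X" if k: "k < n" for k
  proof -
    have k': "Suc k < length gs" using k *(4) by simp
    note cc = contr_composable [OF cZ k']
    have "contr k Zs gs \<in> Om n X (hd Zs)"
      using cprod_in_Om [OF conjunct1 [OF cc]] cc k *(4) lZ unfolding contr_def by simp
    then show ?thesis unfolding A_def by (rule Hm_comp_Om [OF X h X fZ])
  qed
  have bc: "contr k Zs gs \<in> bounded_ops (Ho X) (Ho (hd Zs))" if "k < n" for k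
    using contr_bounded [OF cZ, of k] that *(4) lZ by simp
  have tele: "(\<Sum>k<n. (- 1) ^ k *\<^sub>C contr k Zs gs) = R - (- 1) ^ n *\<^sub>C (Q \<circ> G)"
  proof -
    have "butlast Zs = Ws" "last Zs = X" "last (butlast Zs) = L" "butlast gs = hs" "last gs = g"
      by (simp_all add: Zs_def Ws gs butlast_append)
    then show ?thesis
      using contr_telescope [OF cZ gs0] *(4) by (simp add: R_def Q_def G_def)
  qed
  have Qin: "Q \<in> Om n L (hd Zs)" using cprod_in_Om [OF cA] lenh hdW by (simp add: Q_def Ws)
  have Gin: "G \<in> Om 0 X L" unfolding G_def by (rule Hm_in_Om [OF X L g])
  have AQ: "A \<circ> Q \<in> Om n L X" unfolding A_def by (rule Hm_comp_Om [OF L h X fZ Qin])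
  have QG: "Q \<circ> G \<in> Om n X (hd Zs)" using Om_comp [OF X L h Qin Gin] by simp
  have AQG: "A \<circ> (Q \<circ> G) \<in> Om n X X" unfolding A_def by (rule Hm_comp_Om [OF X h X fZ QG])
  have Rin: "R \<in> Om n X (hd Zs)"
    using Hm_cprod_in_Om [OF c1(4) c1(1) c1(3)] *(4) lZ c1(2) by (simp add: R_def Zs gs1)
  have AR: "A \<circ> R \<in> Om n X X" unfolding A_def by (rule Hm_comp_Om [OF X h X fZ Rin])
  note lin = STr_linear [OF X]
  have "(\<Sum>k<n. (- 1) ^ k * STr X (A \<circ> contr k Zs gs)) = (\<Sum>k<n. STr X ((- 1) ^ k *\<^sub>C (A \<circ> contr k Zs gs)))"
    by (intro sum.cong refl) (simp add: clinear_onD(2) [OF lin inOm] scaleC_complex_def)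
  also have "\<dots> = STr X (\<Sum>k<n. (- 1) ^ k *\<^sub>C (A \<circ> contr k Zs gs))"
    by (rule clinear_on_sum [OF lin Om_subspace, symmetric])
      (use inOm in \<open>simp add: complex_vector.span_scale\<close>)
  also have "(\<Sum>k<n. (- 1) ^ k *\<^sub>C (A \<circ> contr k Zs gs)) = (\<Sum>k<n. A \<circ> ((- 1) ^ k *\<^sub>C contr k Zs gs))"
    by (intro sum.cong refl) (use comp_scaleC_right [OF bA bc sh] in simp)
  also have "\<dots> = A \<circ> (\<Sum>k<n. (- 1) ^ k *\<^sub>C contr k Zs gs)"
    by (rule bounded_comp_sum_right [OF bA _ sh, of _ _ "Ho X", symmetric])
      (use bc bounded_ops_scaleC [OF _ sh] in simp)
  also have "\<dots> = (A \<circ> R) - (- 1) ^ n *\<^sub>C (A \<circ> (Q \<circ> G))"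
    unfolding tele comp_diff_right [OF bA Om_boundedD [OF X h Rin]
        bounded_ops_scaleC [OF Om_boundedD [OF X h QG] sh] sh]
      comp_scaleC_right [OF bA Om_boundedD [OF X h QG] sh] ..
  also have "STr X \<dots> = STr X (A \<circ> R) - (- 1) ^ n * STr X (A \<circ> (Q \<circ> G))"
    unfolding clinear_on_diff [OF lin Om_subspace AR complex_vector.span_scale [OF AQG]]
      clinear_onD(2) [OF lin AQG] scaleC_complex_def ..
  finally have sum: "(\<Sum>k<n. (- 1) ^ k * STr X (A \<circ> contr k Zs gs)) =
    STr X (A \<circ> R) - (- 1) ^ n * STr X (A \<circ> (Q \<circ> G))" .
  have "(\<Sum>i\<le>n. (- 1) ^ i * ?t i) = ?t 0 + (\<Sum>k<n. (- 1) ^ Suc k * ?t (Suc k))"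
    unfolding sum.atMost_shift by simp
  also have "(\<Sum>k<n. (- 1) ^ Suc k * ?t (Suc k)) = - (\<Sum>k<n. (- 1) ^ k * STr X (A \<circ> contr k Zs gs))"
    unfolding sum_negf [symmetric] by (intro sum.cong refl) (simp only: tS lessThan_iff power_Suc, simp)
  finally have 1: "(\<Sum>i\<le>n. (- 1) ^ i * ?t i) = (- 1) ^ n * STr X (A \<circ> (Q \<circ> G))"
    unfolding t0 sum by simp
  have 2: "?\<phi> (Xs ! (n + 1) # take n (tl Xs))
      (Cmp C (Xs ! 1) (Xs ! 0) (Xs ! (n + 1)) (fs ! (n + 1)) (fs ! 0) # take n (tl fs)) = STr X (A \<circ> (Q \<circ> G))"
  proof -
    have "Xs ! (n + 1) = L" "take n (tl Xs) = As" "Xs ! 0 = X" "fs ! (n + 1) = g" "fs ! 0 = f" "take n (tl fs) = hs"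
      by (simp_all add: *(1,2) Ws gs lenh nth_append)
    moreover have "Xs ! 1 = hd Zs" using Ws1(1) Zs by (metis *(1) One_nat_def list.sel(1) nth_Cons_0 nth_Cons_Suc)
    moreover have "hd (As @ [L]) = hd Zs" using hdW unfolding Ws .
    ultimately have "?\<phi> (Xs ! (n + 1) # take n (tl Xs))
      (Cmp C (Xs ! 1) (Xs ! 0) (Xs ! (n + 1)) (fs ! (n + 1)) (fs ! 0) # take n (tl fs))
      = STr L (Hm (hd Zs) L (Cmp C (hd Zs) X L g f) \<circ> cprod (As @ [L]) hs)"
      by (simp only: character_Cons)
    also have "\<dots> = STr L (G \<circ> (A \<circ> Q))"
      unfolding Hm_cmp [OF h X L g fZ] Q_def Ws G_def A_def by (simp only: comp_assoc)
    \<comment> \<open>\<open>G\<close> has degree 0, so it moves from the front to the back without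
      a sign.\<close>
    also have "\<dots> = STr X ((A \<circ> Q) \<circ> G)"
      using STr_graded [OF X L AQ Gin] by simp
    finally show ?thesis by (simp only: comp_assoc)
  qed
  show ?thesis
    unfolding hochschild_b_def Let_def 1 2 by simp
qed

theorem character_cyclic_cocycle: "cyclic_cocycle C n (character_cochain Ho Hm F n)"
  unfolding cyclic_cocycle_def
  using character_cochain character_hochschild character_cyclic by blast

end

text \<open>\<open>trace_op\<close> is a total function, so the trace class property of the
  differentials is a separate conclusion; it ensures that \<open>super_trace\<close> is a genuine
  trace and not a default value.\<close>

theorem theorem5p4:
  fixes C :: "('o, 'a::complex_vector) semicat"
    and Ho :: "'o \<Rightarrow> 'h::complex_inner set"
    and Hm :: "'o \<Rightarrow> 'o \<Rightarrow> 'a \<Rightarrow> 'h \<Rightarrow> 'h"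
    and F :: "'o \<Rightarrow> 'h \<Rightarrow> 'h"
    and p :: real and m :: int
  assumes "clinear_category C"
    and "1 \<le> p"
    and "odd_fredholm_module C Ho Hm p F"
    and "p \<le> 2 * real_of_int m"
  defines "n \<equiv> nat (2 * m - 1)"
  shows "(\<forall>X\<in>Ob C. \<forall>T\<in>DHom (Omega C Ho Hm F) n X X.
            gcomm F n X X T \<in> trace_class (Ho X) (Ho X))
    \<and> is_cycle_over C n (Omega C Ho Hm F) (super_trace Ho F n) id Hm
    \<and> cyclic_cocycle C n (character_cochain Ho Hm F n)"
proof -
  \<comment> \<open>From \<open>1 \<le> p \<le> 2m\<close>. Hence \<open>nat\<close> truncates
    nothing, and \<open>Suc n\<close> is exactly 2m.\<close>
  have m: "m \<ge> 1" using assms(2,4) by linarith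
  have "even (Suc n)" "real (Suc n) = 2 * real_of_int m"
    using m unfolding n_def by (simp_all add: even_nat_iff)
  with assms interpret summable_fredholm_module C Ho Hm p F n
    by (intro summable_fredholm_module.intro summable_fredholm_module_axioms.intro) simp_all
  show ?thesis
    using gcomm_trace_class Omega_cycle character_cyclic_cocycle by (simp add: Omega_def)
qed

end
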